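(* Let $k$ be an infinite field, $R=k[x_0,\ldots,x_n]$, and let $c,\ell$ be integers with $1\le c\le n$ and $\ell\ge c$. Let $\mathbb{L}=\{L_1,\ldots,L_\ell\}\subseteq R$ be a set of $\ell$ linear forms such that every subset of $\mathbb{L}$ of size at most $\min\{\ell,n+1\}$ is linearly independent, and let $I_{\mathbb{X}(\ell,c)}$ be the ideal of the star configuration of codimension $c$ in $\mathbb{P}^n$ associated to $\mathbb{L}$. Then $I_{\mathbb{X}(\ell,c)}$ is a geometrically vertex decomposable ideal if and only if $I_{\mathbb{X}(\ell,c)}$ is a Knutson ideal.
   Context: **Star configurations.** For $\mathbb{L}=\{L_1,\ldots,L_\ell\}$ and $c$ as in the claim, $$I_{\mathbb{X}(\ell,c)}=\bigcap_{\{j_1,\ldots,j_c\}\subseteq[\ell]}(L_{j_1},\ldots,L_{j_c}),$$ the intersection being over all subsets of $[\ell]=\{1,\ldots,\ell\}$ of size $c$. **Geometrically vertex decomposable ideals.** Let $R$ be a polynomial ring over $k$ in finitely many variables $x_0,\ldots,x_n$, let $y=x_j$ be a variable, and let $S=k[x_0,\ldots,\widehat{x_j},\ldots,x_n]$ be the polynomial ring in the remaining variables. A nonzero $f\in R$ is written $f=\sum_{i=0}^d\alpha_iy^i$ with $\alpha_i\in S$, $\alpha_d\neq0$; its initial $y$-form is $\mathrm{in}_y(f)=\alpha_dy^d$. For an ideal $I$, $\mathrm{in}_y(I)=(\mathrm{in}_y(f):f\in I)$. A monomial order $<$ is $y$-compatible if $\mathrm{in}_<(\mathrm{in}_y(f))=\mathrm{in}_<(f)$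 for all $f\in R$. Given a $y$-compatible order $<$ and a Gröbner basis $\{g_1,\ldots,g_m\}$ of $I$, write $g_i=y^{d_i}q_i+r_i$ with $\mathrm{in}_y(g_i)=y^{d_i}q_i$ and $y$ not dividing any term of $q_i$, and set $$C_{y,I}=(q_1,\ldots,q_m),\qquad N_{y,I}=(q_i: d_i=0).$$ These ideals are generated by elements of $S$, are regarded as ideals of $R$ or of $S$, and do not depend on the choice of Gröbner basis or of $y$-compatible order. If $\mathrm{in}_y(I)=C_{y,I}\cap(N_{y,I}+(y))$, this is called a geometric vertex decomposition of $I$ with respect to $y$. An ideal $I\subset R$ is geometrically vertex decomposable (GVD) if $I$ is unmixed and either (a) $I=(1)$ or $I$ is generated by a (possibly empty) subset of the variables of $R$; or (b) there is a variable $y=x_j$ such that $\mathrm{in}_y(I)=C_{y,I}\cap(N_{y,I}+(y))$ is a geometric vertex decomposition and the contractions of $C_{y,I}$ and $N_{y,I}$ to $S$ are geometrically vertex decomposable (recursively). **Knutson ideals.** Let $f\in R$ be a polynomial whose leading term $\mathrm{in}_<(f)$ is squarefree with respect to a fixed monomial order $<$. Let $C_f$ be the smallest set of ideals of $R$ such that: (I) $(f)\in C_f$; (II) if $I\in C_f$, then $I:J\in C_f$ for every ideal $J\subseteq R$; (III) if $I,J\in C_f$, then $I+J\in C_f$; (IV) if $I,J\in C_f$, then $I\cap J\in C_f$. An ideal in $C_f$ is called a Knutson ideal associated to $f$. An ideal is a Knutson ideal if it is a Knutson ideal associated to some $f$ for some monomial order $<$ with $\mathrm{in}_<(f)$ squarefree.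 *)

theory Defs
  imports
    "HOL-Library.Poly_Mapping"
    "HOL-Library.Extended_Nat"
    "HOL-Algebra.QuotRing"
begin

section \<open>Polynomial rings over a finite set of variables\<close>

text \<open>
  A monomial is an exponent vector, and a polynomial is a finitely supported map from monomials to
  coefficients, with the convolution product of \<^theory>\<open>HOL-Library.Poly_Mapping\<close>. The recursion
  in the definition of geometric vertex decomposability removes variables one at a time, so
  k[x_i : i in V] is the subring of polynomials whose monomials involve only variables in V.
\<close>

type_synonym monom = "nat \<Rightarrow>\<^sub>0 nat"
type_synonym 'a mpoly = "monom \<Rightarrow>\<^sub>0 'a"
type_synonym monom_rel = "monom \<Rightarrow> monom \<Rightarrow> bool"

definition monoms :: "nat set \<Rightarrow> monom set" where
  "monoms V = {m. Poly_Mapping.keys m \<subseteq> V}"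

definition mpoly_ring :: "nat set \<Rightarrow> ('a::comm_ring_1) mpoly ring" where
  "mpoly_ring V =
     \<lparr>carrier = {p. Poly_Mapping.keys p \<subseteq> monoms V}, mult = (*), one = 1, zero = 0, add = (+)\<rparr>"

definition Var :: "nat \<Rightarrow> ('a::comm_ring_1) mpoly" where
  "Var i = Poly_Mapping.single (Poly_Mapping.single i 1) 1"

definition scale_mpoly :: "'a \<Rightarrow> ('a::comm_ring_1) mpoly \<Rightarrow> 'a mpoly" where
  "scale_mpoly c p = Poly_Mapping.single 0 c * p"

definition linear_forms :: "nat set \<Rightarrow> ('a::comm_ring_1) mpoly set" where
  "linear_forms V = {p. \<forall>m\<in>Poly_Mapping.keys p. \<exists>i\<in>V. m = Poly_Mapping.single i 1}"

lemma zero_in_monoms: "0 \<in> monoms V"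
  by (simp add: monoms_def)

lemma add_in_monoms: "m \<in> monoms V \<Longrightarrow> m' \<in> monoms V \<Longrightarrow> m + m' \<in> monoms V"
  unfolding monoms_def using Poly_Mapping.keys_add[of m m'] by auto

lemma mpoly_ring_mult_closed:
  fixes p q :: "('a::comm_ring_1) mpoly"
  assumes "Poly_Mapping.keys p \<subseteq> monoms V" "Poly_Mapping.keys q \<subseteq> monoms V"
  shows "Poly_Mapping.keys (p * q) \<subseteq> monoms V"
  using Poly_Mapping.keys_mult[of p q] assms add_in_monoms by blast

lemma cring_mpoly_ring: "cring (mpoly_ring V :: ('a::comm_ring_1) mpoly ring)"
proof (rule cringI)
  show "abelian_group (mpoly_ring V :: 'a mpoly ring)"
  proof (rule abelian_groupI)
    fix x :: "'a mpoly"
    assume x: "x \<in> carrier (mpoly_ring V)"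
    show "\<exists>y\<in>carrier (mpoly_ring V). y \<oplus>\<^bsub>mpoly_ring V\<^esub> x = \<zero>\<^bsub>mpoly_ring V\<^esub>"
      using x by (intro bexI[of _ "- x"]) (auto simp: mpoly_ring_def)
  next
    fix x y :: "'a mpoly"
    assume "x \<in> carrier (mpoly_ring V)" "y \<in> carrier (mpoly_ring V)"
    then show "x \<oplus>\<^bsub>mpoly_ring V\<^esub> y \<in> carrier (mpoly_ring V)"
      using Poly_Mapping.keys_add[of x y] by (auto simp: mpoly_ring_def)
  qed (auto simp: mpoly_ring_def algebra_simps)
  show "Group.comm_monoid (mpoly_ring V :: 'a mpoly ring)"
    by (rule comm_monoidI)
      (auto simp: mpoly_ring_def zero_in_monoms algebra_simps intro: mpoly_ring_mult_closed[THEN subsetD])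
qed (auto simp: mpoly_ring_def algebra_simps)

lemma vector_space_scale_mpoly: "vector_space (scale_mpoly :: 'a::field \<Rightarrow> 'a mpoly \<Rightarrow> 'a mpoly)"
  by unfold_locales
    (simp_all add: scale_mpoly_def distrib_left distrib_right single_add mult_single
      flip: single_one mult.assoc)


section \<open>Unmixed ideals\<close>

text \<open>The dimension of the zero ring is 0 under this definition, as a supremum in \<^typ>\<open>enat\<close>; it plays
  no role below, because the unit ideal has no associated primes.\<close>

definition krull_dim :: "('a, 'b) ring_scheme \<Rightarrow> enat" where
  "krull_dim R = Sup {enat r | r.
     \<exists>P :: nat \<Rightarrow> 'a set. (\<forall>i\<le>r. primeideal (P i) R) \<and> (\<forall>i<r. P i \<subset> P (Suc i))}"

definition colon :: "('a, 'b) ring_scheme \<Rightarrow> 'a set \<Rightarrow> 'a set \<Rightarrow> 'a set" where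
  "colon R I J = {r \<in> carrier R. \<forall>j\<in>J. r \<otimes>\<^bsub>R\<^esub> j \<in> I}"

text \<open>The associated primes of the module R/I: prime ideals of the form (I : f), the annihilator of
  the class of f.\<close>

definition associated_primes :: "('a, 'b) ring_scheme \<Rightarrow> 'a set \<Rightarrow> 'a set set" where
  "associated_primes R I = {P. primeideal P R \<and> (\<exists>f\<in>carrier R. P = colon R I {f})}"

definition unmixed :: "('a, 'b) ring_scheme \<Rightarrow> 'a set \<Rightarrow> bool" where
  "unmixed R I \<longleftrightarrow> (\<forall>P\<in>associated_primes R I. krull_dim (R Quot P) = krull_dim (R Quot I))"


section \<open>Monomial orders and Groebner bases\<close>

text \<open>Strict monomial orders on the monomials in the variables V. For finite V the last condition
  is equivalent to being a well-order. Nothing is required of the relation outside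
  \<^term>\<open>monoms V\<close>.\<close>

definition monomial_order :: "nat set \<Rightarrow> monom_rel \<Rightarrow> bool" where
  "monomial_order V lt \<longleftrightarrow>
     (\<forall>a\<in>monoms V. \<not> lt a a) \<and>
     (\<forall>a\<in>monoms V. \<forall>b\<in>monoms V. \<forall>c\<in>monoms V. lt a b \<longrightarrow> lt b c \<longrightarrow> lt a c) \<and>
     (\<forall>a\<in>monoms V. \<forall>b\<in>monoms V. a \<noteq> b \<longrightarrow> lt a b \<or> lt b a) \<and>
     (\<forall>a\<in>monoms V. \<forall>b\<in>monoms V. \<forall>c\<in>monoms V. lt a b \<longrightarrow> lt (a + c) (b + c)) \<and>
     (\<forall>a\<in>monoms V. a \<noteq> 0 \<longrightarrow> lt 0 a)"

text \<open>Only meaningful for nonzero f.\<close>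

definition lead_monom :: "monom_rel \<Rightarrow> ('a::comm_ring_1) mpoly \<Rightarrow> monom" where
  "lead_monom lt f =
     (THE m. m \<in> Poly_Mapping.keys f \<and> (\<forall>m'\<in>Poly_Mapping.keys f. m' \<noteq> m \<longrightarrow> lt m' m))"

definition lead_term :: "monom_rel \<Rightarrow> ('a::comm_ring_1) mpoly \<Rightarrow> 'a mpoly" where
  "lead_term lt f = Poly_Mapping.single (lead_monom lt f) (Poly_Mapping.lookup f (lead_monom lt f))"

definition squarefree_monom :: "monom \<Rightarrow> bool" where
  "squarefree_monom m \<longleftrightarrow> (\<forall>i. Poly_Mapping.lookup m i \<le> 1)"

definition groebner_basis ::
    "nat set \<Rightarrow> monom_rel \<Rightarrow> ('a::comm_ring_1) mpoly set \<Rightarrow> 'a mpoly set \<Rightarrow> bool" where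
  "groebner_basis V lt I G \<longleftrightarrow> finite G \<and> G \<subseteq> I - {0} \<and>
     genideal (mpoly_ring V) (lead_term lt ` G) = genideal (mpoly_ring V) (lead_term lt ` (I - {0}))"


section \<open>Geometric vertex decomposition\<close>

definition deg_in :: "nat \<Rightarrow> ('a::comm_ring_1) mpoly \<Rightarrow> nat" where
  "deg_in y f = Max ((\<lambda>m. Poly_Mapping.lookup m y) ` Poly_Mapping.keys f)"

text \<open>The coefficient \<open>\<alpha>\<^sub>i\<close> in the expansion of f as a polynomial in the variable y.\<close>

definition coeff_in :: "nat \<Rightarrow> nat \<Rightarrow> ('a::comm_ring_1) mpoly \<Rightarrow> 'a mpoly" where
  "coeff_in y i f =
     (\<Sum>m | m \<in> Poly_Mapping.keys f \<and> Poly_Mapping.lookup m y = i.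
        Poly_Mapping.single (m - Poly_Mapping.single y i) (Poly_Mapping.lookup f m))"

definition lead_coeff_in :: "nat \<Rightarrow> ('a::comm_ring_1) mpoly \<Rightarrow> 'a mpoly" where
  "lead_coeff_in y f = coeff_in y (deg_in y f) f"

definition initial_form :: "nat \<Rightarrow> ('a::comm_ring_1) mpoly \<Rightarrow> 'a mpoly" where
  "initial_form y f = lead_coeff_in y f * Var y ^ deg_in y f"

definition initial_form_ideal ::
    "nat set \<Rightarrow> nat \<Rightarrow> ('a::comm_ring_1) mpoly set \<Rightarrow> 'a mpoly set" where
  "initial_form_ideal V y I = genideal (mpoly_ring V) (initial_form y ` (I - {0}))"

definition compatible_order :: "'a::comm_ring_1 itself \<Rightarrow> nat set \<Rightarrow> nat \<Rightarrow> monom_rel \<Rightarrow> bool" where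
  "compatible_order TYPE('a) V y lt \<longleftrightarrow> monomial_order V lt \<and>
     (\<forall>f\<in>carrier (mpoly_ring V :: 'a mpoly ring) - {0}.
        lead_term lt (initial_form y f) = lead_term lt f)"

text \<open>For a Groebner basis G, the ideal generated by its leading coefficients in y, and the
  ideal generated by those elements in which y does not occur (for them \<open>q\<^sub>i = g\<^sub>i\<close>).\<close>

definition C_ideal :: "nat set \<Rightarrow> nat \<Rightarrow> ('a::comm_ring_1) mpoly set \<Rightarrow> 'a mpoly set" where
  "C_ideal V y G = genideal (mpoly_ring V) (lead_coeff_in y ` G)"

definition N_ideal :: "nat set \<Rightarrow> nat \<Rightarrow> ('a::comm_ring_1) mpoly set \<Rightarrow> 'a mpoly set" where
  "N_ideal V y G = genideal (mpoly_ring V) (lead_coeff_in y ` {g \<in> G. deg_in y g = 0})"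

text \<open>\<open>C\<close> and \<open>N\<close> are the two ideals of \<open>I\<close> with respect to \<open>y\<close>. They do not depend on the order and
  the Groebner basis, which are therefore quantified existentially.\<close>

definition geometric_vertex_decomposition ::
    "nat set \<Rightarrow> nat \<Rightarrow> ('a::comm_ring_1) mpoly set \<Rightarrow> 'a mpoly set \<Rightarrow> 'a mpoly set \<Rightarrow> bool" where
  "geometric_vertex_decomposition V y I C N \<longleftrightarrow>
     (\<exists>lt G. compatible_order TYPE('a) V y lt \<and> groebner_basis V lt I G \<and>
        C = C_ideal V y G \<and> N = N_ideal V y G) \<and>
     initial_form_ideal V y I = C \<inter> (N <+>\<^bsub>mpoly_ring V\<^esub> genideal (mpoly_ring V) {Var y})"

inductive gvd :: "nat set \<Rightarrow> ('a::comm_ring_1) mpoly set \<Rightarrow> bool" where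
  unit: "\<lbrakk>ideal I (mpoly_ring V); unmixed (mpoly_ring V) I; I = carrier (mpoly_ring V)\<rbrakk> \<Longrightarrow> gvd V I"
| variables: "\<lbrakk>ideal I (mpoly_ring V); unmixed (mpoly_ring V) I; A \<subseteq> V;
    I = genideal (mpoly_ring V) (Var ` A)\<rbrakk> \<Longrightarrow> gvd V I"
| decomposition: "\<lbrakk>ideal I (mpoly_ring V); unmixed (mpoly_ring V) I; y \<in> V;
    geometric_vertex_decomposition V y I C N;
    gvd (V - {y}) (C \<inter> carrier (mpoly_ring (V - {y})));
    gvd (V - {y}) (N \<inter> carrier (mpoly_ring (V - {y})))\<rbrakk> \<Longrightarrow> gvd V I"


section \<open>Knutson ideals\<close>

inductive_set knutson_set :: "nat set \<Rightarrow> ('a::comm_ring_1) mpoly \<Rightarrow> 'a mpoly set set"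
  for V :: "nat set" and f :: "'a mpoly" where
  principal: "genideal (mpoly_ring V) {f} \<in> knutson_set V f"
| colon: "I \<in> knutson_set V f \<Longrightarrow> ideal J (mpoly_ring V) \<Longrightarrow> colon (mpoly_ring V) I J \<in> knutson_set V f"
| sum: "I \<in> knutson_set V f \<Longrightarrow> J \<in> knutson_set V f \<Longrightarrow> I <+>\<^bsub>mpoly_ring V\<^esub> J \<in> knutson_set V f"
| inter: "I \<in> knutson_set V f \<Longrightarrow> J \<in> knutson_set V f \<Longrightarrow> I \<inter> J \<in> knutson_set V f"

definition knutson_ideal :: "nat set \<Rightarrow> ('a::comm_ring_1) mpoly set \<Rightarrow> bool" where
  "knutson_ideal V I \<longleftrightarrow>
     (\<exists>lt f. monomial_order V lt \<and> f \<in> carrier (mpoly_ring V) - {0} \<and>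
        squarefree_monom (lead_monom lt f) \<and> I \<in> knutson_set V f)"


section \<open>Star configurations\<close>

definition star_ideal ::
    "nat set \<Rightarrow> (nat \<Rightarrow> ('a::comm_ring_1) mpoly) \<Rightarrow> nat \<Rightarrow> nat \<Rightarrow> 'a mpoly set" where
  "star_ideal V L l c = (\<Inter>J\<in>{J. J \<subseteq> {1..l} \<and> card J = c}. genideal (mpoly_ring V) (L ` J))"

end

theory Submission
  imports
    Defs
    "HOL-Computational_Algebra.Polynomial"
    "HOL-Computational_Algebra.Primes"
begin

text \<open>
  Call a set of linear forms triangular if its members can be ordered in such a way that each one
  involves a variable that does not occur in the later ones. If \<open>c = l\<close>, the star ideal is generated by
  linear forms, which Gaussian elimination makes triangular without changing the ideal, and both
  properties hold. If \<open>c < l\<close>, each of the two properties is equivalent to triangularity of the l given forms.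

  Triangularity suffices. The product f of triangular forms has a squarefree leading monomial in a
  lexicographic order that puts the pivots first. The ideal of a single form is the colon ideal of (f) by the
  product of the others, so the star ideal is a Knutson ideal associated to f
  (\<open>triangular_imp_knutson\<close>). At the pivot y of the first form M, the star ideal of codimension c is
  \<open>A + M B\<close>, where A and B are the star ideals of the other forms of codimension \<open>c - 1\<close> and c.
  This is a geometric vertex decomposition with \<open>N = A\<close> and \<open>C = B\<close>, and one proceeds by induction
  (\<open>triangular_imp_gvd\<close>). Unmixedness holds because the quotients by the linear primes whose
  intersection is the star ideal are polynomial rings in the same number of variables.

  Triangularity is necessary. Put \<open>d = l - c + 1\<close>, which is at least 2. The star ideal contains the product of any
  d of the forms, but no polynomial with a term of degree less than d
  (\<open>star_min_degree\<close>); the converse implications use only this. If the ideal has a vertex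
  decomposition at y, then y occurs in at most one form: otherwise a product of d forms would
  have degree at least 2 in y, and its leading coefficient \<open>\<alpha>\<close> in y would lie in C, so that
  \<open>\<alpha> y\<close>, of degree less than d, would be in the ideal of initial forms. Induction over the two ideals of the
  decomposition then orders the forms (\<open>gvd_imp_triangular\<close>). If the ideal is a Knutson ideal, its initial
  ideal is squarefree. If two forms had the same leading variable, the leading
  monomial of a product of d forms containing them would not be squarefree, and its squarefree part
  would be the leading monomial of an element of degree less than d. So the leading variables are
  distinct, and they order the forms (\<open>knutson_imp_triangular\<close>).

  The initial ideals of Knutson ideals are squarefree over a finite field with q elements because these ideals are
  mapped into themselves by \<open>h \<mapsto> Tr (f\<^bsup>q-1\<^esup> h)\<close>, where Tr is the trace of the
  Frobenius map, and this map acts on leading monomials by extraction of q-th roots. Over any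
  field, the finitely many coefficients that occur in the construction of an ideal generate a ring, and this ring
  has a prime with finite residue field modulo which they may be reduced
  (\<open>frobenius_place_exists\<close>). Sums, intersections and colon ideals commute with the
  reduction if finitely many further elements are taken into account, because division by a
  Groebner basis with leading coefficients 1 can be carried out in any ring that contains its
  coefficients (\<open>monic_division\<close>, \<open>sum_generic\<close>). What is needed of the initial ideal comes out in
  \<open>knutson_squarefree_initial\<close>.
\<close>

section \<open>Polynomials, monomials and ideals\<close>

abbreviation keys where "keys \<equiv> Poly_Mapping.keys"
abbreviation lookup where "lookup \<equiv> Poly_Mapping.lookup"
abbreviation single where "single \<equiv> Poly_Mapping.single"

abbreviation polys :: "nat set \<Rightarrow> ('a::comm_ring_1) mpoly set" where
  "polys V \<equiv> carrier (mpoly_ring V)"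

abbreviation idl :: "nat set \<Rightarrow> ('a::comm_ring_1) mpoly set \<Rightarrow> 'a mpoly set" where
  "idl V F \<equiv> genideal (mpoly_ring V) F"

lemma mpoly_ring_simps [simp]:
  "monoid.mult (mpoly_ring V) = (*)" "ring.add (mpoly_ring V) = (+)"
  "monoid.one (mpoly_ring V) = 1" "ring.zero (mpoly_ring V) = 0"
  by (simp_all add: mpoly_ring_def)

lemma polys_iff: "p \<in> polys V \<longleftrightarrow> keys p \<subseteq> monoms V"
  by (simp add: mpoly_ring_def)

lemma monoms_0 [simp]: "0 \<in> monoms V"
  by (rule zero_in_monoms)

lemma monoms_add_iff [simp]:
  "m + m' \<in> monoms V \<longleftrightarrow> m \<in> monoms V \<and> m' \<in> monoms V"
proof -
  have "keys (m + m') = keys m \<union> keys m'"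
    by (auto simp: in_keys_iff lookup_add)
  then show ?thesis by (simp add: monoms_def)
qed

lemma monoms_single [simp]: "single i n \<in> monoms V \<longleftrightarrow> n = 0 \<or> i \<in> V"
  by (auto simp: monoms_def)

lemma monoms_mono: "V \<subseteq> W \<Longrightarrow> m \<in> monoms V \<Longrightarrow> m \<in> monoms W"
  by (auto simp: monoms_def)

lemma monoms_Diff_iff: "m \<in> monoms (V - {y}) \<longleftrightarrow> m \<in> monoms V \<and> lookup m y = 0"
  by (auto simp: monoms_def in_keys_iff)

lemma polys_mono: "V \<subseteq> W \<Longrightarrow> p \<in> polys V \<Longrightarrow> p \<in> polys W"
  by (auto simp: polys_iff intro: monoms_mono)

lemma polys_0 [simp]: "0 \<in> polys V" and polys_1 [simp]: "1 \<in> polys V"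
  by (auto simp: polys_iff)

lemma polys_single [simp]: "single m c \<in> polys V \<longleftrightarrow> c = 0 \<or> m \<in> monoms V"
  by (auto simp: polys_iff)

lemma polys_add [intro]: "p \<in> polys V \<Longrightarrow> q \<in> polys V \<Longrightarrow> p + q \<in> polys V"
  using keys_add[of p q] by (auto simp: polys_iff)

lemma polys_uminus [simp]: "- p \<in> polys V \<longleftrightarrow> p \<in> polys V"
  by (simp add: polys_iff)

lemma polys_diff [intro]: "p \<in> polys V \<Longrightarrow> q \<in> polys V \<Longrightarrow> p - q \<in> polys V"
  using keys_diff[of p q] by (auto simp: polys_iff)

lemma polys_mult [intro]: "p \<in> polys V \<Longrightarrow> q \<in> polys V \<Longrightarrow> p * q \<in> polys V"
  using mpoly_ring_mult_closed by (simp add: polys_iff)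

lemma polys_power [intro]: "p \<in> polys V \<Longrightarrow> p ^ n \<in> polys V"
  by (induction n) auto

lemma polys_sum [intro]: "(\<And>i. i \<in> A \<Longrightarrow> f i \<in> polys V) \<Longrightarrow> sum f A \<in> polys V"
  by (induction A rule: infinite_finite_induct) auto

lemma polys_prod [intro]: "(\<And>i. i \<in> A \<Longrightarrow> f i \<in> polys V) \<Longrightarrow> prod f A \<in> polys V"
  by (induction A rule: infinite_finite_induct) auto

lemma mpoly_eq_sum_monomials:
  fixes p :: "('a::comm_ring_1) mpoly"
  shows "p = (\<Sum>m\<in>keys p. single m (lookup p m))"
proof (rule poly_mapping_eqI)
  fix k
  have "lookup (\<Sum>m\<in>keys p. single m (lookup p m)) k
      = (\<Sum>m\<in>keys p. if m = k then lookup p m else 0)"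
    by (simp add: lookup_sum lookup_single when_def)
  also have "\<dots> = lookup p k"
    by (auto simp: sum.delta not_in_keys_iff_lookup_eq_zero)
  finally show "lookup p k = lookup (\<Sum>m\<in>keys p. single m (lookup p m)) k" by simp
qed

lemma mpoly_additive_induct [case_names zero add]:
  fixes p :: "('a::comm_ring_1) mpoly"
  assumes "P 0"
    and "\<And>m q. m \<in> keys p \<Longrightarrow> P q \<Longrightarrow> P (single m (lookup p m) + q)"
  shows "P p"
proof -
  have "P (\<Sum>m\<in>A. single m (lookup p m))" if "A \<subseteq> keys p" for A
  proof -
    have "finite A" using that by (rule finite_subset) simp
    then show ?thesis using that
      by (induction A) (auto simp: assms)
  qed
  from this[of "keys p"] show ?thesis
    by (simp flip: mpoly_eq_sum_monomials)
qed

lemma lookup_single_mult: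
  fixes p :: "('a::comm_ring_1) mpoly"
  shows "lookup (single t c * p) (t + s) = c * lookup p s"
proof -
  have "single t c * p = (\<Sum>m\<in>keys p. single (t + m) (c * lookup p m))"
    by (subst mpoly_eq_sum_monomials[of p]) (simp add: sum_distrib_left mult_single)
  then have "lookup (single t c * p) (t + s)
      = (\<Sum>m\<in>keys p. if m = s then c * lookup p m else 0)"
    by (simp add: lookup_sum lookup_single when_def)
  then show ?thesis
    by (auto simp: not_in_keys_iff_lookup_eq_zero)
qed

lemma lookup_single_mult_notin:
  fixes p :: "('a::comm_ring_1) mpoly"
  assumes "\<And>s. k \<noteq> t + s"
  shows "lookup (single t c * p) k = 0"
proof (rule ccontr)
  assume "lookup (single t c * p) k \<noteq> 0"
  then have "k \<in> keys (single t c * p)" by (simp add: in_keys_iff)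
  then show False using keys_mult[of "single t c" p] assms by (fastforce split: if_splits)
qed

lemma monom_add_diff:
  fixes a t :: monom
  assumes "\<And>i. lookup t i \<le> lookup a i"
  shows "t + (a - t) = a"
  using assms by (auto intro!: poly_mapping_eqI simp: lookup_add lookup_minus)

lemma ideal_mpoly_ring_iff:
  fixes I :: "('a::comm_ring_1) mpoly set"
  shows "ideal I (mpoly_ring V) \<longleftrightarrow> I \<subseteq> polys V \<and> 0 \<in> I \<and> (\<forall>a\<in>I. \<forall>b\<in>I. a + b \<in> I) \<and>
     (\<forall>r\<in>polys V. \<forall>a\<in>I. r * a \<in> I)" (is "?L \<longleftrightarrow> ?R")
proof
  assume ?L
  then have L: ?L .
  note sub = ideal.axioms(1)[OF L]
  show ?R
  proof (intro conjI ballI)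
    show "I \<subseteq> polys V" by (rule additive_subgroup.a_subset[OF sub])
    show "0 \<in> I" using additive_subgroup.zero_closed[OF sub] unfolding mpoly_ring_simps .
    show "a + b \<in> I" if "a \<in> I" "b \<in> I" for a b
      using additive_subgroup.a_closed[OF sub that] unfolding mpoly_ring_simps .
    show "r * a \<in> I" if "r \<in> polys V" "a \<in> I" for r a
      using ideal.I_l_closed[OF L that(2,1)] unfolding mpoly_ring_simps .
  qed
next
  assume R: ?R
  interpret cring "mpoly_ring V :: 'a mpoly ring" by (rule cring_mpoly_ring)
  have neg: "- a \<in> I" if "a \<in> I" for a
  proof -
    have "(- 1 :: 'a mpoly) \<in> polys V" by simp
    then have "- 1 * a \<in> I" using R that by blast
    then show ?thesis by simp
  qed
  show ?L
  proof (rule idealI)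
    show "subgroup I (add_monoid (mpoly_ring V))"
    proof (rule add.subgroupI)
      fix a assume a: "a \<in> I"
      have "\<ominus>\<^bsub>mpoly_ring V\<^esub> a = - a"
        using a R by (intro minus_equality) auto
      then show "\<ominus>\<^bsub>mpoly_ring V\<^esub> a \<in> I" using neg a by simp
    qed (use R in auto)
  next
    fix a x :: "'a mpoly" assume ax: "a \<in> I" "x \<in> polys V"
    then have "x * a \<in> I" using R by blast
    then show "x \<otimes>\<^bsub>mpoly_ring V\<^esub> a \<in> I" "a \<otimes>\<^bsub>mpoly_ring V\<^esub> x \<in> I"
      by (simp_all add: Groups.mult.commute)
  qed (rule ring_axioms)
qed

lemma ideal_subset: "ideal I (mpoly_ring V) \<Longrightarrow> a \<in> I \<Longrightarrow> a \<in> polys V"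
  and ideal_0: "ideal I (mpoly_ring V) \<Longrightarrow> 0 \<in> I"
  and ideal_add: "ideal I (mpoly_ring V) \<Longrightarrow> a \<in> I \<Longrightarrow> b \<in> I \<Longrightarrow> a + b \<in> I"
  and ideal_mult: "ideal I (mpoly_ring V) \<Longrightarrow> a \<in> I \<Longrightarrow> r \<in> polys V \<Longrightarrow> r * a \<in> I"
  by (auto simp: ideal_mpoly_ring_iff)

lemma ideal_uminus: "ideal I (mpoly_ring V) \<Longrightarrow> a \<in> I \<Longrightarrow> - a \<in> I"
  using ideal_mult[of I V a "- 1"] by simp

lemma ideal_diff: "ideal I (mpoly_ring V) \<Longrightarrow> a \<in> I \<Longrightarrow> b \<in> I \<Longrightarrow> a - b \<in> I"
  using ideal_add[of I V a "- b"] ideal_uminus[of I V b] by simp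

lemma ideal_sum:
  "ideal I (mpoly_ring V) \<Longrightarrow> (\<And>i. i \<in> A \<Longrightarrow> f i \<in> I) \<Longrightarrow> sum f A \<in> I"
  by (induction A rule: infinite_finite_induct) (auto simp: ideal_0 ideal_add)

lemma ideal_Inter_polys:
  assumes "\<And>I. I \<in> S \<Longrightarrow> ideal I (mpoly_ring V)" "S \<noteq> {}"
  shows "ideal (\<Inter>S) (mpoly_ring V)"
  using assms unfolding ideal_mpoly_ring_iff by blast

lemma ideal_polys: "ideal (polys V) (mpoly_ring V)"
  by (auto simp: ideal_mpoly_ring_iff)

lemma ideal_idl: "F \<subseteq> polys V \<Longrightarrow> ideal (idl V F) (mpoly_ring V)"
  by (rule ring.genideal_ideal[OF cring.axioms(1)[OF cring_mpoly_ring]])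

lemma idl_incl: "F \<subseteq> polys V \<Longrightarrow> x \<in> F \<Longrightarrow> x \<in> idl V F"
  using ring.genideal_self[OF cring.axioms(1)[OF cring_mpoly_ring]] by blast

lemma idl_least: "ideal I (mpoly_ring V) \<Longrightarrow> F \<subseteq> I \<Longrightarrow> idl V F \<subseteq> I"
  by (rule ring.genideal_minimal[OF cring.axioms(1)[OF cring_mpoly_ring]])

lemma idl_mono: "F \<subseteq> F' \<Longrightarrow> F' \<subseteq> polys V \<Longrightarrow> idl V F \<subseteq> idl V F'"
  by (intro idl_least ideal_idl) (auto intro: idl_incl)

lemma idl_subset_polys: "F \<subseteq> polys V \<Longrightarrow> idl V F \<subseteq> polys V"
  by (intro idl_least ideal_polys)

lemma set_add_mpoly_ring: "I <+>\<^bsub>mpoly_ring V\<^esub> J = {i + j |i j. i \<in> I \<and> j \<in> J}"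
  by (auto simp: set_add_def set_mult_def)

lemma ideal_set_add:
  assumes "ideal I (mpoly_ring V)" "ideal J (mpoly_ring V)"
  shows "ideal (I <+>\<^bsub>mpoly_ring V\<^esub> J) (mpoly_ring V)"
  by (rule ring.add_ideals[OF cring.axioms(1)[OF cring_mpoly_ring] assms])

lemma idl_empty [simp]: "idl V {} = {0}"
proof
  have "ideal {0} (mpoly_ring V)" by (auto simp: ideal_mpoly_ring_iff)
  then show "idl V {} \<subseteq> {0}" by (rule idl_least) simp
  show "{0} \<subseteq> idl V {}" using ideal_0[OF ideal_idl[of "{}" V]] by simp
qed

lemma idl_insert:
  fixes a :: "('a::comm_ring_1) mpoly"
  assumes "a \<in> polys V" "F \<subseteq> polys V"
  shows "idl V (insert a F) = {r * a + b |r b. r \<in> polys V \<and> b \<in> idl V F}" (is "_ = ?S")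
proof
  note iF = ideal_idl[OF assms(2)]
  have "ideal ?S (mpoly_ring V)"
    unfolding ideal_mpoly_ring_iff
  proof (intro conjI ballI)
    show "?S \<subseteq> polys V" using assms iF by (auto dest: ideal_subset)
    have "0 * a + 0 \<in> ?S" using ideal_0[OF iF] polys_0 by blast
    then show "0 \<in> ?S" by simp
  next
    fix x y assume "x \<in> ?S" "y \<in> ?S"
    then obtain r b s c where rs: "x = r * a + b" "y = s * a + c"
      "r \<in> polys V" "b \<in> idl V F" "s \<in> polys V" "c \<in> idl V F" by blast
    then have "x + y = (r + s) * a + (b + c)" by (simp add: algebra_simps)
    then show "x + y \<in> ?S" using rs ideal_add[OF iF] polys_add by blast
  next
    fix t x :: "'a mpoly" assume t: "t \<in> polys V" and "x \<in> ?S"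
    then obtain r b where rs: "x = r * a + b" "r \<in> polys V" "b \<in> idl V F" by blast
    then have "t * x = (t * r) * a + t * b" by (simp add: algebra_simps)
    then show "t * x \<in> ?S" using rs t ideal_mult[OF iF] polys_mult by blast
  qed
  moreover have "insert a F \<subseteq> ?S"
  proof -
    have "1 * a + 0 \<in> ?S" using ideal_0[OF iF] polys_1 by blast
    moreover have "0 * a + b \<in> ?S" if "b \<in> F" for b
      using idl_incl[OF assms(2) that] polys_0 by blast
    ultimately show ?thesis by auto
  qed
  ultimately show "idl V (insert a F) \<subseteq> ?S" by (rule idl_least)
next
  have ins: "insert a F \<subseteq> polys V" using assms by simp
  have "r * a + b \<in> idl V (insert a F)" if "r \<in> polys V" "b \<in> idl V F" for r b
  proof (rule ideal_add[OF ideal_idl[OF ins]])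
    show "r * a \<in> idl V (insert a F)"
      by (rule ideal_mult[OF ideal_idl[OF ins]]) (use idl_incl[OF ins, of a] that in auto)
    show "b \<in> idl V (insert a F)"
      using idl_mono[OF _ ins, of F] that(2) by blast
  qed
  then show "?S \<subseteq> idl V (insert a F)" by blast
qed

lemma idl_finite:
  fixes F :: "('a::comm_ring_1) mpoly set"
  assumes "finite F" "F \<subseteq> polys V" "x \<in> idl V F"
  shows "\<exists>q. (\<forall>g\<in>F. q g \<in> polys V) \<and> x = (\<Sum>g\<in>F. q g * g)"
  using assms
proof (induction F arbitrary: x)
  case (insert a F)
  have "a \<in> polys V" "F \<subseteq> polys V" using insert.prems(1) by auto
  from idl_insert[OF this] insert.prems(2)
  obtain r b where r: "x = r * a + b" "r \<in> polys V" "b \<in> idl V F" by blast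
  obtain q where q: "\<forall>g\<in>F. q g \<in> polys V" "b = (\<Sum>g\<in>F. q g * g)"
    using insert.IH[of b] insert.prems(1) r(3) by auto
  have "(\<Sum>g\<in>F. (q(a := r)) g * g) = (\<Sum>g\<in>F. q g * g)"
    using insert.hyps by (intro sum.cong) auto
  then have "x = (\<Sum>g\<in>insert a F. (q(a := r)) g * g)"
    using insert.hyps r q by simp
  moreover have "\<forall>g\<in>insert a F. (q(a := r)) g \<in> polys V" using q r by auto
  ultimately show ?case by blast
qed simp

lemma idl_singleton:
  fixes a :: "('a::comm_ring_1) mpoly"
  shows "a \<in> polys V \<Longrightarrow> idl V {a} = {r * a |r. r \<in> polys V}"
  by (subst idl_insert) simp_all

lemma idl_insert_set_add:
  assumes "a \<in> polys V" "F \<subseteq> polys V"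
  shows "idl V (insert a F) = idl V {a} <+>\<^bsub>mpoly_ring V\<^esub> idl V F"
  unfolding idl_insert[OF assms] idl_singleton[OF assms(1)] set_add_mpoly_ring by blast

section \<open>Monomial orders and division\<close>

definition monom_dvd :: "monom \<Rightarrow> monom \<Rightarrow> bool" where
  "monom_dvd a b \<longleftrightarrow> (\<forall>i. lookup a i \<le> lookup b i)"

lemma monom_dvd_add: "monom_dvd a (a + b)"
  by (simp add: monom_dvd_def lookup_add)

lemma monom_dvdE:
  assumes "monom_dvd a b"
  obtains c where "b = a + c"
  using monom_add_diff[of a b] assms unfolding monom_dvd_def by metis

context
  fixes V lt
  assumes mo: "monomial_order V lt"
begin

lemma mo_irrefl: "a \<in> monoms V \<Longrightarrow> \<not> lt a a"
  and mo_trans: "\<lbrakk>a \<in> monoms V; b \<in> monoms V; c \<in> monoms V; lt a b; lt b c\<rbrakk> \<Longrightarrow> lt a c"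
  and mo_total: "\<lbrakk>a \<in> monoms V; b \<in> monoms V; a \<noteq> b\<rbrakk> \<Longrightarrow> lt a b \<or> lt b a"
  and mo_add: "\<lbrakk>a \<in> monoms V; b \<in> monoms V; c \<in> monoms V; lt a b\<rbrakk> \<Longrightarrow> lt (a + c) (b + c)"
  and mo_zero: "\<lbrakk>a \<in> monoms V; a \<noteq> 0\<rbrakk> \<Longrightarrow> lt 0 a"
  using mo unfolding monomial_order_def by blast+

lemma mo_asym: "\<lbrakk>a \<in> monoms V; b \<in> monoms V; lt a b\<rbrakk> \<Longrightarrow> \<not> lt b a"
  using mo_irrefl mo_trans by blast

lemma mo_add2:
  assumes "a \<in> monoms V" "b \<in> monoms V" "c \<in> monoms V" "d \<in> monoms V"
    "a = b \<or> lt a b" "c = d \<or> lt c d"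
  shows "a + c = b + d \<and> a = b \<and> c = d \<or> lt (a + c) (b + d)"
proof -
  have 1: "a + c = b + c \<or> lt (a + c) (b + c)" using assms mo_add by blast
  have "b + c = b + d \<or> lt (b + c) (b + d)"
    using assms mo_add[of c d b] by (auto simp: add.commute)
  with 1 show ?thesis
    using assms mo_trans[of "a + c" "b + c" "b + d"] by auto
qed

lemma mo_dvd: "monom_dvd a b \<Longrightarrow> b \<in> monoms V \<Longrightarrow> a = b \<or> lt a b"
  by (elim monom_dvdE) (use mo_zero mo_add[of 0] in \<open>force simp: add.commute\<close>)

end

text \<open>Leading monomials as a relation, which is false for the zero polynomial; \<^const>\<open>lead_monom\<close> is a definite
  description and says nothing there.\<close>

definition is_lead :: "monom_rel \<Rightarrow> monom \<Rightarrow> ('a::comm_ring_1) mpoly \<Rightarrow> bool" where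
  "is_lead lt u p \<longleftrightarrow> u \<in> keys p \<and> (\<forall>m\<in>keys p. m \<noteq> u \<longrightarrow> lt m u)"

lemma finite_max_monom:
  assumes mo: "monomial_order V lt" and "finite A" "A \<noteq> {}" "A \<subseteq> monoms V"
  shows "\<exists>u\<in>A. \<forall>m\<in>A. m \<noteq> u \<longrightarrow> lt m u"
  using assms(2-)
proof (induction A rule: finite_ne_induct)
  case (insert a A)
  then obtain u where u: "u \<in> A" "\<forall>m\<in>A. m \<noteq> u \<longrightarrow> lt m u" by auto
  have au: "a \<in> monoms V" "u \<in> monoms V" "a \<noteq> u" using insert u by auto
  from mo_total[OF mo au] show ?case
  proof
    assume "lt a u"
    then show ?thesis using u by auto
  next
    assume ua: "lt u a"
    have "lt m a" if "m \<in> A" for m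
      using u(2) that ua au insert.prems mo_trans[OF mo, of m u a] by (cases "m = u") auto
    then show ?thesis by auto
  qed
qed simp

lemma lead_exists:
  assumes "monomial_order V lt" "p \<in> polys V" "p \<noteq> 0"
  obtains u where "is_lead lt u p"
  using finite_max_monom[OF assms(1), of "keys p"] assms(2,3)
  unfolding is_lead_def polys_iff by auto

lemma lead_monom_eq:
  assumes mo: "monomial_order V lt" and "p \<in> polys V" "is_lead lt u p"
  shows "lead_monom lt p = u"
  unfolding lead_monom_def
proof (rule the_equality)
  show "u \<in> keys p \<and> (\<forall>m'\<in>keys p. m' \<noteq> u \<longrightarrow> lt m' u)"
    using assms(3) unfolding is_lead_def .
next
  fix m assume m: "m \<in> keys p \<and> (\<forall>m'\<in>keys p. m' \<noteq> m \<longrightarrow> lt m' m)"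
  have "m \<in> monoms V" "u \<in> monoms V" using assms m by (auto simp: polys_iff is_lead_def)
  then show "m = u" using m assms(3) mo_asym[OF mo, of m u] unfolding is_lead_def by metis
qed

lemma lead_monom_is_lead:
  assumes "monomial_order V lt" "p \<in> polys V" "p \<noteq> 0"
  shows "is_lead lt (lead_monom lt p) p"
  using lead_exists[OF assms] lead_monom_eq[OF assms(1,2)] by metis

lemma is_lead_monoms: "is_lead lt u p \<Longrightarrow> p \<in> polys V \<Longrightarrow> u \<in> monoms V"
  by (auto simp: is_lead_def polys_iff)

text \<open>Upper bounds u and v for the monomials of p and q suffice, instead of leading monomials: all other
  pairs of monomials have a product strictly below \<open>u + v\<close>.\<close>

lemma lookup_mult_lead:
  fixes p q :: "('a::comm_ring_1) mpoly"
  assumes mo: "monomial_order V lt" and pq: "p \<in> polys V" "q \<in> polys V"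
    and u: "u \<in> monoms V" "\<And>m. m \<in> keys p \<Longrightarrow> m = u \<or> lt m u"
    and v: "v \<in> monoms V" "\<And>m. m \<in> keys q \<Longrightarrow> m = v \<or> lt m v"
  shows "lookup (p * q) (u + v) = lookup p u * lookup q v"
proof -
  have "p * q = (\<Sum>m\<in>keys p. single m (lookup p m) * q)"
    by (subst mpoly_eq_sum_monomials[of p]) (simp add: sum_distrib_right)
  then have "lookup (p * q) (u + v) = (\<Sum>m\<in>keys p. lookup (single m (lookup p m) * q) (u + v))"
    by (simp add: lookup_sum)
  also have "\<dots> = (\<Sum>m\<in>keys p. if m = u then lookup p m * lookup q v else 0)"
  proof (rule sum.cong)
    fix m assume m: "m \<in> keys p"
    show "lookup (single m (lookup p m) * q) (u + v) = (if m = u then lookup p m * lookup q v else 0)"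
    proof (cases "m = u")
      case False
      have "lookup (single m (lookup p m) * q) (u + v) = 0"
      proof (rule ccontr)
        assume "lookup (single m (lookup p m) * q) (u + v) \<noteq> 0"
        then have "u + v \<in> keys (single m (lookup p m) * q)" by (simp add: in_keys_iff)
        then obtain n where n: "n \<in> keys q" "u + v = m + n"
          using keys_mult[of "single m (lookup p m)" q] by (fastforce split: if_splits)
        have mn: "m \<in> monoms V" "n \<in> monoms V" using m n pq by (auto simp: polys_iff)
        have "m = u \<or> lt m u" "n = v \<or> lt n v" using u(2)[OF m] v(2)[OF n(1)] by auto
        from mo_add2[OF mo mn(1) u(1) mn(2) v(1) this] False have "lt (m + n) (u + v)" by simp
        then show False using n mo_irrefl[OF mo, of "m + n"] mn by simp
      qed
      then show ?thesis using False by simp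
    qed (simp add: lookup_single_mult)
  qed simp
  also have "\<dots> = lookup p u * lookup q v"
    by (auto simp: not_in_keys_iff_lookup_eq_zero)
  finally show ?thesis .
qed

lemma keys_mult_le:
  fixes p q :: "('a::comm_ring_1) mpoly"
  assumes mo: "monomial_order V lt" and pq: "p \<in> polys V" "q \<in> polys V"
    and u: "u \<in> monoms V" "\<And>m. m \<in> keys p \<Longrightarrow> m = u \<or> lt m u"
    and v: "v \<in> monoms V" "\<And>m. m \<in> keys q \<Longrightarrow> m = v \<or> lt m v"
    and m: "m \<in> keys (p * q)"
  shows "m = u + v \<or> lt m (u + v)"
proof -
  obtain a b where ab: "m = a + b" "a \<in> keys p" "b \<in> keys q"
    using m keys_mult[of p q] by blast
  then have "a \<in> monoms V" "b \<in> monoms V" using pq by (auto simp: polys_iff)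
  from mo_add2[OF mo this(1) u(1) this(2) v(1)] show ?thesis using u(2) v(2) ab by auto
qed

lemma is_lead_le: "is_lead lt u p \<Longrightarrow> m \<in> keys p \<Longrightarrow> m = u \<or> lt m u"
  by (auto simp: is_lead_def)

lemma is_lead_mult:
  fixes p q :: "('a::idom) mpoly"
  assumes mo: "monomial_order V lt" and pq: "p \<in> polys V" "q \<in> polys V"
    and u: "is_lead lt u p" and v: "is_lead lt v q"
  shows "is_lead lt (u + v) (p * q)"
proof -
  note uv = is_lead_monoms[OF u pq(1)] is_lead_monoms[OF v pq(2)]
  have "lookup (p * q) (u + v) = lookup p u * lookup q v"
    by (rule lookup_mult_lead[OF mo pq uv(1) _ uv(2)]) (use u v is_lead_le in auto)
  moreover have "m = u + v \<or> lt m (u + v)" if "m \<in> keys (p * q)" for m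
    by (rule keys_mult_le[OF mo pq uv(1) _ uv(2) _ that]) (use u v is_lead_le in auto)
  ultimately show ?thesis using u v by (auto simp: is_lead_def in_keys_iff)
qed

lemma is_lead_prod:
  fixes f :: "'i \<Rightarrow> ('a::idom) mpoly"
  assumes mo: "monomial_order V lt" and "finite A"
    and "\<And>i. i \<in> A \<Longrightarrow> f i \<in> polys V \<and> is_lead lt (u i) (f i)"
  shows "is_lead lt (\<Sum>i\<in>A. u i) (\<Prod>i\<in>A. f i)"
  using assms(2,3)
proof (induction A)
  case empty
  show ?case by (simp add: is_lead_def)
next
  case (insert a A)
  then show ?case by (auto intro!: is_lead_mult[OF mo])
qed

text \<open>Dickson's lemma: pass successively to subsequences along which one more exponent is
  nondecreasing.\<close>

lemma monotone_exponents_subseq: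
  fixes s :: "nat \<Rightarrow> monom"
  assumes "finite V"
  shows "\<exists>r :: nat \<Rightarrow> nat. strict_mono r \<and> (\<forall>v\<in>V. \<forall>i j. i \<le> j \<longrightarrow> lookup (s (r i)) v \<le> lookup (s (r j)) v)"
  using assms
proof (induction V)
  case empty
  show ?case by (intro exI[of _ id]) (auto simp: strict_mono_def)
next
  case (insert x V)
  then obtain r :: "nat \<Rightarrow> nat" where r: "strict_mono r"
    "\<And>v i j. v \<in> V \<Longrightarrow> i \<le> j \<Longrightarrow> lookup (s (r i)) v \<le> lookup (s (r j)) v" by blast
  define a where "a = (\<lambda>i. lookup (s (r i)) x)"
  define nxt where "nxt = (\<lambda>n. SOME m. m \<ge> n \<and> (\<forall>k\<ge>n. a m \<le> a k))"
  have nxt: "nxt n \<ge> n \<and> (\<forall>k\<ge>n. a (nxt n) \<le> a k)" for n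
  proof -
    have "\<exists>m. m \<ge> n \<and> (\<forall>k\<ge>n. a m \<le> a k)"
      using ex_has_least_nat[of "\<lambda>m. m \<ge> n" n a] by auto
    then show ?thesis unfolding nxt_def by (rule someI_ex)
  qed
  define t where "t = rec_nat (nxt 0) (\<lambda>_ p. nxt (Suc p))"
  have tS: "t (Suc n) = nxt (Suc (t n))" for n by (simp add: t_def)
  have mono: "strict_mono t"
    unfolding strict_mono_Suc_iff using nxt tS by (metis Suc_le_lessD)
  have step: "a (t i) \<le> a (t (Suc i))" for i
  proof (cases i)
    case 0
    then show ?thesis using nxt by (simp add: t_def)
  next
    case (Suc j)
    have "t (Suc i) \<ge> Suc (t j)" using mono Suc unfolding strict_mono_def by (simp add: Suc_leI)
    then show ?thesis using nxt[of "Suc (t j)"] tS Suc by metis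
  qed
  have at: "a (t i) \<le> a (t j)" if "i \<le> j" for i j
    using that step by (rule lift_Suc_mono_le[rotated])
  have tt: "t i \<le> t j" if "i \<le> j" for i j using mono that by (simp add: strict_mono_less_eq)
  show ?case
  proof (intro exI[of _ "\<lambda>i. r (t i)"] conjI ballI allI impI)
    show "strict_mono (\<lambda>i. r (t i))" using r(1) mono by (auto simp: strict_mono_def)
    fix v i j :: nat assume v: "v \<in> insert x V" and ij: "i \<le> j"
    show "lookup (s (r (t i))) v \<le> lookup (s (r (t j))) v"
    proof (cases "v = x")
      case True
      then show ?thesis using at[OF ij] by (simp add: a_def)
    next
      case False
      then show ?thesis using v r(2) tt[OF ij] by simp
    qed
  qed
qed

lemma dickson_pair:
  fixes s :: "nat \<Rightarrow> monom"
  assumes "finite V" "\<And>i. s i \<in> monoms V"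
  shows "\<exists>i j. i < j \<and> monom_dvd (s i) (s j)"
proof -
  obtain r :: "nat \<Rightarrow> nat" where r: "strict_mono r" "\<forall>v\<in>V. \<forall>i j. i \<le> j \<longrightarrow> lookup (s (r i)) v \<le> lookup (s (r j)) v"
    using monotone_exponents_subseq[OF assms(1)] by blast
  have "lookup (s (r 0)) v \<le> lookup (s (r 1)) v" for v
  proof (cases "v \<in> V")
    case True
    then show ?thesis using r(2) by simp
  next
    case False
    then have "v \<notin> keys (s (r 0))" using assms(2)[of "r 0"] by (auto simp: monoms_def)
    then show ?thesis by (simp add: in_keys_iff)
  qed
  moreover have "r 0 < r 1" using r(1) by (simp add: strict_mono_def)
  ultimately show ?thesis unfolding monom_dvd_def by blast
qed

lemma dickson_finite:
  assumes V: "finite V" and S: "S \<subseteq> monoms V"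
  shows "\<exists>F. finite F \<and> F \<subseteq> S \<and> (\<forall>m\<in>S. \<exists>u\<in>F. monom_dvd u m)"
proof (rule ccontr)
  assume no: "\<not> ?thesis"
  define pick where "pick = (\<lambda>F. SOME m. m \<in> S \<and> (\<forall>u\<in>F. \<not> monom_dvd u m))"
  have pick: "pick F \<in> S \<and> (\<forall>u\<in>F. \<not> monom_dvd u (pick F))" if "finite F" "F \<subseteq> S" for F
  proof -
    have "\<not> (finite F \<and> F \<subseteq> S \<and> (\<forall>m\<in>S. \<exists>u\<in>F. monom_dvd u m))"
      using no by (rule contrapos_nn) (rule exI)
    then have "\<not> (\<forall>m\<in>S. \<exists>u\<in>F. monom_dvd u m)" using that by simp
    then have "\<exists>m. m \<in> S \<and> (\<forall>u\<in>F. \<not> monom_dvd u m)" by simp blast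
    then show ?thesis unfolding pick_def by (rule someI_ex)
  qed
  define F where "F = rec_nat {} (\<lambda>_ F. insert (pick F) F)"
  have F0: "F 0 = {}" and FS: "F (Suc n) = insert (pick (F n)) (F n)" for n by (simp_all add: F_def)
  have F: "finite (F n) \<and> F n \<subseteq> S" for n
    by (induction n) (use pick in \<open>auto simp: F0 FS\<close>)
  have sub: "F (Suc i) \<subseteq> F j" if "i < j" for i j
    using lift_Suc_mono_le[of F "Suc i" j] that FS by auto
  have "pick (F n) \<in> monoms V" for n using pick[of "F n"] F S by auto
  from dickson_pair[OF V, of "\<lambda>n. pick (F n)", OF this]
  obtain i j where ij: "i < j" "monom_dvd (pick (F i)) (pick (F j))" by auto
  have "pick (F i) \<in> F j" using sub[OF ij(1)] FS by auto
  then show False using pick[of "F j"] F[of j] ij(2) by auto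
qed

lemma wf_monomial_order:
  assumes V: "finite V" and mo: "monomial_order V lt"
  shows "wf {(a, b). a \<in> monoms V \<and> b \<in> monoms V \<and> lt a b}" (is "wf ?R")
proof (rule ccontr)
  assume "\<not> wf ?R"
  then obtain s where s: "\<And>i. (s (Suc i), s i) \<in> ?R" unfolding wf_iff_no_infinite_down_chain by blast
  then have sm: "s i \<in> monoms V" for i by blast
  have dec: "lt (s j) (s i)" if "i < j" for i j
    using that
  proof (induction j)
    case (Suc j)
    show ?case
    proof (cases "i = j")
      case True
      then show ?thesis using s[of j] by simp
    next
      case False
      then have "lt (s j) (s i)" using Suc by simp
      then show ?thesis using s[of j] sm mo_trans[OF mo, of "s (Suc j)" "s j" "s i"] by simp
    qed
  qed simp
  obtain i j where "i < j" "monom_dvd (s i) (s j)" using dickson_pair[OF V sm] by blast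
  then have "s i = s j \<or> lt (s i) (s j)" using mo_dvd[OF mo] sm by blast
  then show False using dec[OF \<open>i < j\<close>] sm mo_irrefl[OF mo] mo_asym[OF mo] by metis
qed

text \<open>A Groebner basis with leading coefficients 1, in terms of divisibility of leading monomials.\<close>

definition monic_basis :: "nat set \<Rightarrow> monom_rel \<Rightarrow> ('a::comm_ring_1) mpoly set \<Rightarrow> 'a mpoly set \<Rightarrow> bool" where
  "monic_basis V lt I G \<longleftrightarrow> finite G \<and> G \<subseteq> I \<and>
     (\<forall>g\<in>G. \<exists>u. is_lead lt u g \<and> lookup g u = 1) \<and>
     (\<forall>h\<in>I. \<forall>v. is_lead lt v h \<longrightarrow> (\<exists>g\<in>G. \<exists>u. is_lead lt u g \<and> monom_dvd u v))"

lemma is_lead_scale: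
  fixes g :: "('a::field) mpoly"
  assumes "c \<noteq> 0" "is_lead lt u g"
  shows "is_lead lt u (single 0 c * g)"
proof -
  have "lookup (single 0 c * g) m = c * lookup g m" for m
    using lookup_single_mult[of 0 c g m] by simp
  then show ?thesis using assms by (auto simp: is_lead_def in_keys_iff)
qed

lemma monic_basis_exists:
  fixes I :: "('a::field) mpoly set"
  assumes V: "finite V" and mo: "monomial_order V lt" and I: "ideal I (mpoly_ring V)"
  obtains G where "monic_basis V lt I G"
proof -
  let ?S = "{u. \<exists>h\<in>I. is_lead lt u h}"
  have "?S \<subseteq> monoms V" using ideal_subset[OF I] is_lead_monoms by blast
  then obtain F where F: "finite F" "F \<subseteq> ?S" "\<forall>m\<in>?S. \<exists>u\<in>F. monom_dvd u m"
    using dickson_finite[OF V] by meson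
  have "\<exists>h\<in>I. is_lead lt u h \<and> lookup h u = 1" if u: "u \<in> F" for u
  proof -
    obtain h where h: "h \<in> I" "is_lead lt u h" using F u by blast
    then have nz: "lookup h u \<noteq> 0" by (auto simp: is_lead_def in_keys_iff)
    let ?h = "single 0 (inverse (lookup h u)) * h"
    have "?h \<in> I" using ideal_mult[OF I h(1)] by simp
    moreover have "is_lead lt u ?h" using is_lead_scale[OF _ h(2)] nz by simp
    moreover have "lookup ?h u = 1"
      using lookup_single_mult[of 0 "inverse (lookup h u)" h u] nz by simp
    ultimately show ?thesis by blast
  qed
  then obtain h where h: "\<And>u. u \<in> F \<Longrightarrow> h u \<in> I \<and> is_lead lt u (h u) \<and> lookup (h u) u = 1" by metis
  have "monic_basis V lt I (h ` F)"
    unfolding monic_basis_def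
  proof (intro conjI ballI allI impI)
    fix g v assume "g \<in> I" "is_lead lt v g"
    then obtain u where "u \<in> F" "monom_dvd u v" using F(3) by blast
    then show "\<exists>g\<in>h ` F. \<exists>u. is_lead lt u g \<and> monom_dvd u v" using h by blast
  qed (use F h in auto)
  then show thesis by (rule that)
qed

definition coeffs_in :: "'a set \<Rightarrow> ('a::comm_ring_1) mpoly set" where
  "coeffs_in N = {p. \<forall>m. lookup p m \<in> N}"

definition submodule :: "('a::comm_ring_1) set \<Rightarrow> 'a set \<Rightarrow> bool" where
  "submodule A N \<longleftrightarrow> 0 \<in> N \<and> (\<forall>x\<in>N. \<forall>y\<in>N. x + y \<in> N) \<and> (\<forall>x\<in>N. - x \<in> N) \<and>
     (\<forall>a\<in>A. \<forall>x\<in>N. a * x \<in> N)"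

lemma coeffs_in_add: "submodule A N \<Longrightarrow> p \<in> coeffs_in N \<Longrightarrow> q \<in> coeffs_in N \<Longrightarrow> p + q \<in> coeffs_in N"
  and coeffs_in_uminus: "submodule A N \<Longrightarrow> p \<in> coeffs_in N \<Longrightarrow> - p \<in> coeffs_in N"
  and coeffs_in_0: "submodule A N \<Longrightarrow> 0 \<in> coeffs_in N"
  and coeffs_in_single: "submodule A N \<Longrightarrow> c \<in> N \<Longrightarrow> single m c \<in> coeffs_in N"
  by (auto simp: coeffs_in_def submodule_def lookup_add lookup_single when_def)

lemma coeffs_in_diff: "submodule A N \<Longrightarrow> p \<in> coeffs_in N \<Longrightarrow> q \<in> coeffs_in N \<Longrightarrow> p - q \<in> coeffs_in N"
  using coeffs_in_add[of A N p "- q"] coeffs_in_uminus[of A N q] by simp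

lemma coeffs_in_sum:
  "submodule A N \<Longrightarrow> (\<And>i. i \<in> T \<Longrightarrow> f i \<in> coeffs_in N) \<Longrightarrow> sum f T \<in> coeffs_in N"
  by (induction T rule: infinite_finite_induct) (auto simp: coeffs_in_0 coeffs_in_add)

lemma coeffs_in_single_mult:
  assumes N: "submodule A N" and "a \<in> A" "p \<in> coeffs_in N"
  shows "single t a * p \<in> coeffs_in N"
  unfolding coeffs_in_def
proof (intro CollectI allI)
  fix m
  show "lookup (single t a * p) m \<in> N"
  proof (cases "\<exists>s. m = t + s")
    case True
    then show ?thesis using assms by (auto simp: lookup_single_mult coeffs_in_def submodule_def)
  next
    case False
    then show ?thesis using N lookup_single_mult_notin[of m t a p] by (simp add: submodule_def)
  qed
qed

lemma coeffs_in_mult: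
  assumes N: "submodule A N" and "p \<in> coeffs_in A" "q \<in> coeffs_in N"
  shows "p * q \<in> coeffs_in N"
proof -
  have "p * q = (\<Sum>m\<in>keys p. single m (lookup p m) * q)"
    by (subst mpoly_eq_sum_monomials[of p]) (simp add: sum_distrib_right)
  also have "\<dots> \<in> coeffs_in N"
    using assms by (intro coeffs_in_sum[OF N] coeffs_in_single_mult[OF N]) (auto simp: coeffs_in_def)
  finally show ?thesis .
qed

text \<open>Division by a monic basis needs no division of coefficients: if the coefficients of the basis
  lie in a set A and those of the dividend in a set N with \<open>A N \<subseteq> N\<close>, then the quotients
  have their coefficients in N. Taking for N a subring or an ideal of a subring is what controls the
  reduction of ideals modulo a prime.\<close>

lemma monic_division:
  fixes I :: "('a::comm_ring_1) mpoly set"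
  assumes V: "finite V" and mo: "monomial_order V lt" and I: "ideal I (mpoly_ring V)"
    and G: "monic_basis V lt I G" and GA: "G \<subseteq> coeffs_in A" and N: "submodule A N"
    and h: "h \<in> I" "h \<in> coeffs_in N"
  shows "\<exists>q. (\<forall>g\<in>G. q g \<in> polys V \<inter> coeffs_in N) \<and> h = (\<Sum>g\<in>G. q g * g)"
proof -
  have fin: "finite G" and GI: "G \<subseteq> I" using G by (auto simp: monic_basis_def)
  have main: "\<forall>h. h \<in> I \<longrightarrow> h \<in> coeffs_in N \<longrightarrow> is_lead lt v h \<longrightarrow>
     (\<exists>q. (\<forall>g\<in>G. q g \<in> polys V \<inter> coeffs_in N) \<and> h = (\<Sum>g\<in>G. q g * g))" for v
    using wf_monomial_order[OF V mo]
  proof (induction v rule: wf_induct_rule)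
    case (less v)
    show ?case
    proof (intro allI impI)
      fix h assume h: "h \<in> I" "h \<in> coeffs_in N" "is_lead lt v h"
      obtain g u where g: "g \<in> G" "is_lead lt u g" "monom_dvd u v"
        using G h(1,3) unfolding monic_basis_def by blast
      have vV: "v \<in> monoms V" using h ideal_subset[OF I] is_lead_monoms by blast
      have gV: "g \<in> polys V" using g GI ideal_subset[OF I] by blast
      obtain u' where u': "is_lead lt u' g" "lookup g u' = 1" using G g(1) unfolding monic_basis_def by blast
      have "u' = u"
        using lead_monom_eq[OF mo gV g(2)] lead_monom_eq[OF mo gV u'(1)] by simp
      then have gu: "lookup g u = 1" using u' by simp
      obtain w where w: "v = u + w" using g(3) by (rule monom_dvdE)
      have wV: "w \<in> monoms V" using vV w by simp
      define c where "c = lookup h v"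
      have cN: "c \<in> N" using h(2) by (simp add: coeffs_in_def c_def)
      define h' where "h' = h - single w c * g"
      have wg: "single w c * g \<in> I" using ideal_mult[OF I] g(1) GI wV by auto
      have h'I: "h' \<in> I" using ideal_diff[OF I h(1) wg] by (simp add: h'_def)
      have sc: "single w c \<in> coeffs_in N" by (rule coeffs_in_single[OF N cN])
      have "g * single w c \<in> coeffs_in N"
        by (rule coeffs_in_mult[OF N]) (use GA g sc in auto)
      then have h'N: "h' \<in> coeffs_in N"
        unfolding h'_def using coeffs_in_diff[OF N h(2)] by (simp add: mult.commute)
      have key: "lt m v" if m: "m \<in> keys h'" for m
      proof -
        have "lookup h' v = 0"
          using lookup_single_mult[of w c g u] gu by (simp add: h'_def lookup_minus w add.commute c_def)
        then have "m \<noteq> v" using m by (auto simp: in_keys_iff)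
        moreover have "m \<in> keys h \<or> m \<in> keys (single w c * g)"
          using m keys_diff[of h "single w c * g"] by (auto simp: h'_def)
        moreover have "m = v \<or> lt m v" if "m \<in> keys (single w c * g)"
        proof -
          have "m = w + u \<or> lt m (w + u)"
            by (rule keys_mult_le[OF mo _ gV wV _ is_lead_monoms[OF g(2) gV] _ that])
              (use wV g(2) is_lead_le in \<open>auto split: if_splits\<close>)
          then show ?thesis by (simp add: w add.commute)
        qed
        ultimately show ?thesis using h(3) by (auto simp: is_lead_def)
      qed
      have "\<exists>q. (\<forall>g\<in>G. q g \<in> polys V \<inter> coeffs_in N) \<and> h' = (\<Sum>g\<in>G. q g * g)"
      proof (cases "h' = 0")
        case True
        then show ?thesis using coeffs_in_0[OF N] by (intro exI[of _ "\<lambda>_. 0"]) auto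
      next
        case False
        have h'V: "h' \<in> polys V" using ideal_subset[OF I h'I] .
        obtain v' where v': "is_lead lt v' h'" using lead_exists[OF mo h'V False] .
        then have "lt v' v" "v' \<in> monoms V" using key is_lead_monoms[OF v' h'V] by (auto simp: is_lead_def)
        then show ?thesis using less v' h'I h'N vV by blast
      qed
      then obtain q where q: "\<forall>g\<in>G. q g \<in> polys V \<inter> coeffs_in N" "h' = (\<Sum>g\<in>G. q g * g)" by blast
      define q' where "q' = q(g := q g + single w c)"
      have "(\<Sum>g\<in>G. q' g * g) = (\<Sum>x\<in>G. q x * x + (if x = g then single w c * g else 0))"
        by (intro sum.cong) (auto simp: q'_def distrib_right)
      also have "\<dots> = h" using fin g(1) q(2)[symmetric] by (simp add: sum.distrib h'_def)
      finally have "h = (\<Sum>g\<in>G. q' g * g)" ..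
      moreover have "\<forall>g\<in>G. q' g \<in> polys V \<inter> coeffs_in N"
        using q(1) coeffs_in_add[OF N _ sc] wV by (auto simp: q'_def)
      ultimately show "\<exists>q. (\<forall>g\<in>G. q g \<in> polys V \<inter> coeffs_in N) \<and> h = (\<Sum>g\<in>G. q g * g)" by blast
    qed
  qed
  show ?thesis
  proof (cases "h = 0")
    case True
    then show ?thesis using coeffs_in_0[OF N] by (intro exI[of _ "\<lambda>_. 0"]) auto
  next
    case False
    obtain v where "is_lead lt v h" using lead_exists[OF mo ideal_subset[OF I h(1)] False] .
    then show ?thesis using main h by blast
  qed
qed

lemma coeffs_in_UNIV [simp]: "coeffs_in UNIV = UNIV"
  by (simp add: coeffs_in_def)

lemma ideal_finitely_generated:
  fixes I :: "('a::field) mpoly set"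
  assumes V: "finite V" and mo: "monomial_order V lt" and I: "ideal I (mpoly_ring V)"
  obtains G where "finite G" "G \<subseteq> I" "I = idl V G"
proof -
  obtain G where G: "monic_basis V lt I G" using monic_basis_exists[OF assms] .
  have GI: "finite G" "G \<subseteq> I" using G by (auto simp: monic_basis_def)
  have GV: "G \<subseteq> polys V" using GI ideal_subset[OF I] by blast
  have "h \<in> idl V G" if h: "h \<in> I" for h
  proof -
    have sub: "submodule UNIV (UNIV :: 'a set)" by (simp add: submodule_def)
    obtain q where q: "\<forall>g\<in>G. q g \<in> polys V" "h = (\<Sum>g\<in>G. q g * g)"
      using monic_division[OF V mo I G _ sub h] by auto
    show ?thesis unfolding q(2)
      using q(1) idl_incl[OF GV]
      by (intro ideal_sum[OF ideal_idl[OF GV]] ideal_mult[OF ideal_idl[OF GV]]) auto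
  qed
  then have "I = idl V G" using idl_least[OF I GI(2)] by blast
  then show thesis using that GI by blast
qed

section \<open>Finite residue fields of finitely generated subrings of a field\<close>

definition is_subring :: "'a::comm_ring_1 set \<Rightarrow> bool" where
  "is_subring B \<longleftrightarrow> 1 \<in> B \<and> (\<forall>x\<in>B. \<forall>y\<in>B. x - y \<in> B \<and> x * y \<in> B)"

lemma subring_closed:
  assumes "is_subring B"
  shows "1 \<in> B" "0 \<in> B" "x \<in> B \<Longrightarrow> y \<in> B \<Longrightarrow> x - y \<in> B" "x \<in> B \<Longrightarrow> y \<in> B \<Longrightarrow> x * y \<in> B"
    "x \<in> B \<Longrightarrow> - x \<in> B" "x \<in> B \<Longrightarrow> y \<in> B \<Longrightarrow> x + y \<in> B"
proof -
  show 1: "1 \<in> B" and d: "x \<in> B \<Longrightarrow> y \<in> B \<Longrightarrow> x - y \<in> B"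
    and "x \<in> B \<Longrightarrow> y \<in> B \<Longrightarrow> x * y \<in> B" for x y
    using assms unfolding is_subring_def by auto
  show 0: "0 \<in> B" using d[OF 1 1] by simp
  show n: "x \<in> B \<Longrightarrow> - x \<in> B" for x using d[OF 0, of x] by simp
  show "x \<in> B \<Longrightarrow> y \<in> B \<Longrightarrow> x + y \<in> B" using d[OF _ n, of x y] by simp
qed

lemma subring_power: "is_subring B \<Longrightarrow> x \<in> B \<Longrightarrow> x ^ n \<in> B"
  by (induction n) (simp_all add: subring_closed)

lemma subring_of_nat: "is_subring B \<Longrightarrow> of_nat n \<in> B"
  by (induction n) (simp_all add: subring_closed)

lemma subring_submodule: "is_subring B \<Longrightarrow> submodule B B"
  by (auto simp: submodule_def subring_closed)

lemma submodule_closed: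
  assumes "submodule A N"
  shows "0 \<in> N" "x \<in> N \<Longrightarrow> y \<in> N \<Longrightarrow> x + y \<in> N" "x \<in> N \<Longrightarrow> y \<in> N \<Longrightarrow> x - y \<in> N"
    "x \<in> N \<Longrightarrow> - x \<in> N" "a \<in> A \<Longrightarrow> x \<in> N \<Longrightarrow> a * x \<in> N" "a \<in> A \<Longrightarrow> x \<in> N \<Longrightarrow> x * a \<in> N"
proof -
  show "0 \<in> N" and a: "x \<in> N \<Longrightarrow> y \<in> N \<Longrightarrow> x + y \<in> N" and n: "x \<in> N \<Longrightarrow> - x \<in> N"
    and m: "a \<in> A \<Longrightarrow> x \<in> N \<Longrightarrow> a * x \<in> N" for x y a
    using assms unfolding submodule_def by auto
  show "x \<in> N \<Longrightarrow> y \<in> N \<Longrightarrow> x - y \<in> N" using a[OF _ n, of x y] by simp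
  show "a \<in> A \<Longrightarrow> x \<in> N \<Longrightarrow> x * a \<in> N" using m[of a x] by (simp add: mult.commute)
qed

lemma submodule_sum:
  "submodule A N \<Longrightarrow> (\<And>i. i \<in> T \<Longrightarrow> f i \<in> N) \<Longrightarrow> sum f T \<in> N"
  by (induction T rule: infinite_finite_induct) (auto simp: submodule_closed)

definition prime_in :: "'a::comm_ring_1 set \<Rightarrow> 'a set \<Rightarrow> bool" where
  "prime_in B M \<longleftrightarrow> M \<subseteq> B \<and> submodule B M \<and> 1 \<notin> M \<and>
     (\<forall>x\<in>B. \<forall>y\<in>B. x * y \<in> M \<longrightarrow> x \<in> M \<or> y \<in> M)"

definition finite_residue :: "'a::comm_ring_1 set \<Rightarrow> 'a set \<Rightarrow> bool" where
  "finite_residue B M \<longleftrightarrow> (\<exists>R. finite R \<and> R \<subseteq> B \<and> (\<forall>x\<in>B. \<exists>r\<in>R. x - r \<in> M))"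

lemma prime_in_power:
  assumes "is_subring B" "prime_in B M" "x \<in> B" "x ^ n \<in> M"
  shows "x \<in> M"
  using assms(4)
proof (induction n)
  case 0
  then show ?case using assms(2) by (simp add: prime_in_def)
next
  case (Suc n)
  then show ?case using assms subring_power[OF assms(1,3)] by (auto simp: prime_in_def)
qed

text \<open>Among \<open>card R + 1\<close> elements two are congruent. The bound on j does not depend on f, which gives a
  common exponent for all elements of B below.\<close>

lemma residue_pigeonhole:
  assumes M: "submodule B M" and R: "finite R" "\<forall>x\<in>B. \<exists>r\<in>R. x - r \<in> M"
    and f: "\<And>i. f i \<in> B"
  shows "\<exists>i j. i < j \<and> j \<le> card R \<and> f j - f i \<in> M"
proof -
  have "\<forall>i. \<exists>r. r \<in> R \<and> f i - r \<in> M" using R(2) f by blast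
  from choice[OF this] obtain r where r: "\<And>i. r i \<in> R \<and> f i - r i \<in> M" by blast
  have "card (r ` {..card R}) \<le> card R" using r R(1) by (intro card_mono) auto
  then have "\<not> inj_on r {..card R}" using card_image[of r "{..card R}"] by auto
  then obtain i j where ij: "i \<le> card R" "j \<le> card R" "i \<noteq> j" "r i = r j"
    unfolding inj_on_def by auto
  have d: "f b - f a \<in> M" if "r a = r b" for a b
  proof -
    have "f b - r b - (f a - r a) \<in> M" by (rule submodule_closed(3)[OF M]) (use r in auto)
    then show ?thesis using that by simp
  qed
  show ?thesis
  proof (cases "i < j")
    case True
    then show ?thesis using ij d[of i j] by blast
  next
    case False
    then have "j < i" using ij by simp
    then show ?thesis using ij d[of j i] by fastforce
  qed
qed

text \<open>A finite domain is a field: two powers of c are congruent, and c can be cancelled.\<close>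

lemma inverse_mod:
  assumes B: "is_subring B" and M: "prime_in B M" and fr: "finite_residue B M"
    and c: "c \<in> B" "c \<notin> M"
  shows "\<exists>e\<in>B. c * e - 1 \<in> M"
proof -
  have sM: "submodule B M" using M by (simp add: prime_in_def)
  obtain R where R: "finite R" "\<forall>x\<in>B. \<exists>r\<in>R. x - r \<in> M" using fr unfolding finite_residue_def by blast
  obtain i j where ij: "i < j" "c ^ j - c ^ i \<in> M"
    using residue_pigeonhole[OF sM R, of "\<lambda>i. c ^ i"] subring_power[OF B c(1)] by blast
  obtain k where k: "j = i + Suc k" using ij(1) by (metis add_Suc_right less_imp_Suc_add)
  have "c ^ j - c ^ i = c ^ i * (c * c ^ k - 1)" by (simp add: k power_add algebra_simps)
  then have "c ^ i \<in> M \<or> c * c ^ k - 1 \<in> M"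
    using ij(2) M c subring_power[OF B c(1)] subring_closed[OF B] unfolding prime_in_def by metis
  then have "c * c ^ k - 1 \<in> M" using prime_in_power[OF B M c(1)] c(2) by blast
  then show ?thesis using subring_power[OF B c(1)] by blast
qed

text \<open>A maximal element among the proper ideals above \<open>N0\<close> is prime.\<close>

lemma prime_extension:
  assumes C: "is_subring C" and N0: "submodule C N0" "N0 \<subseteq> C" "1 \<notin> N0"
  shows "\<exists>N. prime_in C N \<and> N0 \<subseteq> N"
proof -
  let ?A = "{N. N0 \<subseteq> N \<and> N \<subseteq> C \<and> submodule C N \<and> 1 \<notin> N}"
  have "\<exists>N\<in>?A. \<forall>X\<in>?A. N \<subseteq> X \<longrightarrow> X = N"
  proof (rule subset_Zorn_nonempty)
    show "?A \<noteq> {}" using N0 by auto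
    fix \<C> assume ne: "\<C> \<noteq> {}" and ch: "subset.chain ?A \<C>"
    have sub: "\<C> \<subseteq> ?A" and tot: "\<And>X Y. X \<in> \<C> \<Longrightarrow> Y \<in> \<C> \<Longrightarrow> X \<subseteq> Y \<or> Y \<subseteq> X"
      using ch by (auto simp: subset_chain_def)
    have "submodule C (\<Union>\<C>)"
      unfolding submodule_def
    proof (intro conjI ballI)
      show "0 \<in> \<Union>\<C>" using ne sub submodule_closed(1) by fastforce
    next
      fix x y assume "x \<in> \<Union>\<C>" "y \<in> \<Union>\<C>"
      then obtain X Y where XY: "X \<in> \<C>" "Y \<in> \<C>" "x \<in> X" "y \<in> Y" by auto
      then obtain Z where "Z \<in> \<C>" "x \<in> Z" "y \<in> Z" using tot[OF XY(1,2)] by auto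
      then show "x + y \<in> \<Union>\<C>" using sub submodule_closed(2)[of C Z x y] by auto
    next
      fix x assume "x \<in> \<Union>\<C>"
      then obtain X where X: "X \<in> \<C>" "x \<in> X" by auto
      then show "- x \<in> \<Union>\<C>" using sub submodule_closed(4)[of C X x] by auto
    next
      fix a x assume a: "a \<in> C" and "x \<in> \<Union>\<C>"
      then obtain X where X: "X \<in> \<C>" "x \<in> X" by auto
      then show "a * x \<in> \<Union>\<C>" using sub a submodule_closed(5)[of C X a x] by auto
    qed
    then show "\<Union>\<C> \<in> ?A" using ne sub by auto
  qed
  then obtain N where N: "N \<in> ?A" and max: "\<And>X. X \<in> ?A \<Longrightarrow> N \<subseteq> X \<Longrightarrow> X = N" by auto
  have sN: "submodule C N" using N by simp
  have ext: "\<exists>n\<in>N. \<exists>c\<in>C. 1 = n + x * c" if x: "x \<in> C" "x \<notin> N" for x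
  proof (rule ccontr)
    assume no: "\<not> ?thesis"
    let ?X = "{n + x * c |n c. n \<in> N \<and> c \<in> C}"
    have in_X: "n + x * c \<in> ?X" if "n \<in> N" "c \<in> C" for n c using that by auto
    have NX: "N \<subseteq> ?X" using in_X[OF _ subring_closed(2)[OF C]] by auto
    have "?X \<subseteq> C" using N x subring_closed[OF C] by auto
    moreover have "submodule C ?X"
      unfolding submodule_def
    proof (intro conjI ballI)
      show "0 \<in> ?X" using in_X[OF submodule_closed(1)[OF sN] subring_closed(2)[OF C]] by simp
    next
      fix u v assume "u \<in> ?X" "v \<in> ?X"
      then obtain n c m d where uv: "u = n + x * c" "v = m + x * d" "n \<in> N" "m \<in> N" "c \<in> C" "d \<in> C" by auto
      have "u + v = (n + m) + x * (c + d)" by (simp add: uv algebra_simps)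
      then show "u + v \<in> ?X"
        using in_X[OF submodule_closed(2)[OF sN uv(3,4)] subring_closed(6)[OF C uv(5,6)]] by simp
    next
      fix u assume "u \<in> ?X"
      then obtain n c where uv: "u = n + x * c" "n \<in> N" "c \<in> C" by auto
      have "- u = - n + x * (- c)" by (simp add: uv)
      then show "- u \<in> ?X"
        using in_X[OF submodule_closed(4)[OF sN uv(2)] subring_closed(5)[OF C uv(3)]] by simp
    next
      fix a u assume a: "a \<in> C" and "u \<in> ?X"
      then obtain n c where uv: "u = n + x * c" "n \<in> N" "c \<in> C" by auto
      have "a * u = a * n + x * (a * c)" by (simp add: uv algebra_simps)
      then show "a * u \<in> ?X"
        using in_X[OF submodule_closed(5)[OF sN a uv(2)] subring_closed(4)[OF C a uv(3)]] by simp
    qed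
    moreover have "1 \<notin> ?X" using no by auto
    ultimately have "?X \<in> ?A" using NX N by blast
    then have "?X = N" using max NX by blast
    moreover have "x \<in> ?X" using in_X[OF submodule_closed(1)[OF sN] subring_closed(1)[OF C]] by simp
    ultimately show False using x by simp
  qed
  have "x \<in> N \<or> y \<in> N" if xy: "x \<in> C" "y \<in> C" "x * y \<in> N" for x y
  proof (rule ccontr)
    assume "\<not> ?thesis"
    then obtain n c m d where e: "n \<in> N" "c \<in> C" "1 = n + x * c" "m \<in> N" "d \<in> C" "1 = m + y * d"
      using ext xy by metis
    have "1 = n + x * c * (m + y * d)" using e(3,6) by simp
    also have "\<dots> = n + (x * c) * m + (c * d) * (x * y)" by (simp add: algebra_simps)
    also have "\<dots> \<in> N"
      by (rule submodule_closed(2)[OF sN submodule_closed(2)[OF sN e(1)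
            submodule_closed(5)[OF sN _ e(4)]] submodule_closed(5)[OF sN _ xy(3)]])
        (use e xy subring_closed(4)[OF C] in auto)
    finally show False using N by simp
  qed
  then have "prime_in C N" using N by (auto simp: prime_in_def)
  then show ?thesis using N by auto
qed

definition polys_over :: "'a::comm_ring_1 set \<Rightarrow> 'a poly set" where
  "polys_over N = {p. \<forall>i. coeff p i \<in> N}"

lemma polys_over_closed:
  assumes N: "submodule B N"
  shows "0 \<in> polys_over N" "p \<in> polys_over N \<Longrightarrow> q \<in> polys_over N \<Longrightarrow> p + q \<in> polys_over N"
    "p \<in> polys_over N \<Longrightarrow> q \<in> polys_over N \<Longrightarrow> p - q \<in> polys_over N"
    "p \<in> polys_over N \<Longrightarrow> - p \<in> polys_over N"
    "c \<in> N \<Longrightarrow> monom c k \<in> polys_over N" "c \<in> B \<Longrightarrow> p \<in> polys_over N \<Longrightarrow> smult c p \<in> polys_over N"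
    "q \<in> polys_over B \<Longrightarrow> p \<in> polys_over N \<Longrightarrow> q * p \<in> polys_over N"
    "q \<in> polys_over B \<Longrightarrow> p \<in> polys_over N \<Longrightarrow> p * q \<in> polys_over N"
proof -
  show m: "q \<in> polys_over B \<Longrightarrow> p \<in> polys_over N \<Longrightarrow> q * p \<in> polys_over N" for p q
    by (auto simp: polys_over_def coeff_mult intro!: submodule_sum[OF N] submodule_closed(5)[OF N])
  show "q \<in> polys_over B \<Longrightarrow> p \<in> polys_over N \<Longrightarrow> p * q \<in> polys_over N"
    using m[of q p] by (simp add: mult.commute)
qed (auto simp: polys_over_def submodule_closed[OF N])

lemma polys_over_1: "is_subring B \<Longrightarrow> 1 \<in> polys_over B"
  by (auto simp: polys_over_def subring_closed coeff_1)

text \<open>The set N may be the subring itself or an ideal of it. In the second case quotient and remainder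
  stay in that ideal, which is how congruences between values at a are lifted to polynomials.\<close>

lemma pseudo_division:
  fixes P :: "('a::idom) poly"
  assumes B: "is_subring B" and N: "submodule B N" and P: "P \<in> polys_over B"
  shows "g \<in> polys_over N \<Longrightarrow> (\<And>i. i \<ge> k \<Longrightarrow> coeff g i = 0) \<Longrightarrow>
    \<exists>n q s. q \<in> polys_over N \<and> s \<in> polys_over N \<and> (\<forall>i\<ge>degree P. coeff s i = 0) \<and>
      smult (lead_coeff P ^ n) g = q * P + s"
proof (induction k arbitrary: g)
  case 0
  then have "g = 0" by (intro poly_eqI) simp
  then show ?case using polys_over_closed(1)[OF N] by (intro exI[of _ 0]) simp
next
  case (Suc k)
  show ?case
  proof (cases "k < degree P")
    case True
    then have "\<forall>i\<ge>degree P. coeff g i = 0" using Suc.prems(2) by auto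
    then show ?thesis using polys_over_closed(1)[OF N] Suc.prems(1)
      by (intro exI[of _ 0] exI[of _ "0 :: 'a poly"] exI[of _ g]) simp
  next
    case False
    let ?t = "monom (coeff g k) (k - degree P)"
    let ?g = "smult (lead_coeff P) g - ?t * P"
    have t: "?t \<in> polys_over N"
      using Suc.prems(1) by (intro polys_over_closed(5)[OF N]) (simp add: polys_over_def)
    have lc: "lead_coeff P \<in> B" using P by (simp add: polys_over_def)
    have g: "?g \<in> polys_over N"
      using polys_over_closed[OF N] lc t P Suc.prems(1) by auto
    have "coeff ?g i = 0" if i: "i \<ge> k" for i
    proof (cases "i = k")
      case True
      then show ?thesis using False by (simp add: coeff_monom_mult)
    next
      case False
      then have "coeff g i = 0" "i - (k - degree P) > degree P"
        using Suc.prems(2)[of i] i \<open>\<not> k < degree P\<close> by auto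
      then show ?thesis by (simp add: coeff_monom_mult coeff_eq_0)
    qed
    from Suc.IH[OF g this] obtain n q s where q: "q \<in> polys_over N" "s \<in> polys_over N"
      "\<forall>i\<ge>degree P. coeff s i = 0" "smult (lead_coeff P ^ n) ?g = q * P + s" by blast
    have lcn: "lead_coeff P ^ n \<in> B" using subring_power[OF B lc] .
    let ?q = "q + smult (lead_coeff P ^ n) ?t"
    have "smult (lead_coeff P ^ Suc n) g = smult (lead_coeff P ^ n) ?g + smult (lead_coeff P ^ n) (?t * P)"
      by (simp add: smult_diff_right mult.commute)
    also have "\<dots> = ?q * P + s" unfolding q(4) by (simp add: algebra_simps)
    finally have "smult (lead_coeff P ^ Suc n) g = ?q * P + s" .
    moreover have "?q \<in> polys_over N"
      using polys_over_closed(2)[OF N q(1) polys_over_closed(6)[OF N lcn t]] .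
    ultimately show ?thesis using q by blast
  qed
qed

lemma pseudo_division':
  fixes P :: "('a::idom) poly"
  assumes "is_subring B" "submodule B N" "P \<in> polys_over B" "g \<in> polys_over N"
  obtains n q s where "q \<in> polys_over N" "s \<in> polys_over N" "\<forall>i\<ge>degree P. coeff s i = 0"
    "smult (lead_coeff P ^ n) g = q * P + s"
  using pseudo_division[OF assms(1-4), of "Suc (degree g)"] by (auto simp: coeff_eq_0 Suc_le_eq)

definition adjoin :: "'a::comm_ring_1 set \<Rightarrow> 'a \<Rightarrow> 'a set" where
  "adjoin B a = (\<lambda>p. poly p a) ` polys_over B"

lemma adjoin_subring:
  assumes "is_subring B"
  shows "is_subring (adjoin B a)" "B \<subseteq> adjoin B a" "a \<in> adjoin B a"
proof -
  note sB = subring_submodule[OF assms]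
  have in_adj: "poly p a \<in> adjoin B a" if "p \<in> polys_over B" for p
    using that by (auto simp: adjoin_def)
  show "is_subring (adjoin B a)"
    unfolding is_subring_def
  proof (intro conjI ballI)
    show "1 \<in> adjoin B a" using in_adj[OF polys_over_1[OF assms]] by simp
  next
    fix x y assume "x \<in> adjoin B a" "y \<in> adjoin B a"
    then obtain p q where pq: "p \<in> polys_over B" "q \<in> polys_over B" "x = poly p a" "y = poly q a"
      by (auto simp: adjoin_def)
    show "x - y \<in> adjoin B a" using in_adj[OF polys_over_closed(3)[OF sB pq(1,2)]] pq by simp
    show "x * y \<in> adjoin B a" using in_adj[OF polys_over_closed(7)[OF sB pq(1,2)]] pq by simp
  qed
  have "b \<in> adjoin B a" if "b \<in> B" for b
    using in_adj[OF polys_over_closed(5)[OF sB that, of 0]] by (simp add: poly_monom)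
  then show "B \<subseteq> adjoin B a" by blast
  show "a \<in> adjoin B a"
    using in_adj[OF polys_over_closed(5)[OF sB subring_closed(1)[OF assms], of 1]] by (simp add: poly_monom)
qed

text \<open>A prime M of B with finite residue ring extends to one of \<open>B[a]\<close> as soon as
  it generates, together with the value at a of a polynomial P with leading coefficient outside M,
  a proper ideal: modulo a prime containing that ideal, a satisfies an equation whose
  leading coefficient is a unit.\<close>

lemma extend_prime:
  fixes B :: "('a::field) set"
  assumes B: "is_subring B" and M: "prime_in B M" and fr: "finite_residue B M"
    and P: "P \<in> polys_over B" "lead_coeff P \<notin> M"
    and proper: "\<And>m h. m \<in> polys_over M \<Longrightarrow> h \<in> polys_over B \<Longrightarrow> poly (m + P * h) a \<noteq> 1"
  shows "\<exists>N. prime_in (adjoin B a) N \<and> finite_residue (adjoin B a) N \<and> M \<subseteq> N \<and> poly P a \<in> N"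
proof -
  let ?C = "adjoin B a"
  note C = adjoin_subring[OF B, of a]
  have MB: "M \<subseteq> B" and sM: "submodule B M" using M by (auto simp: prime_in_def)
  note sB = subring_submodule[OF B]
  let ?N = "{poly (m + P * h) a |m h. m \<in> polys_over M \<and> h \<in> polys_over B}"
  have in_N: "poly (m + P * h) a \<in> ?N" if "m \<in> polys_over M" "h \<in> polys_over B" for m h
    using that by auto
  have MBp: "polys_over M \<subseteq> polys_over B" using MB by (auto simp: polys_over_def)
  have sN: "submodule ?C ?N"
    unfolding submodule_def
  proof (intro conjI ballI)
    show "0 \<in> ?N" using in_N[OF polys_over_closed(1)[OF sM] polys_over_closed(1)[OF sB]] by simp
  next
    fix x y assume "x \<in> ?N" "y \<in> ?N"
    then obtain m h m' h' where e: "x = poly (m + P * h) a" "y = poly (m' + P * h') a"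
      "m \<in> polys_over M" "h \<in> polys_over B" "m' \<in> polys_over M" "h' \<in> polys_over B" by auto
    have "x + y = poly ((m + m') + P * (h + h')) a" by (simp add: e algebra_simps)
    then show "x + y \<in> ?N"
      using in_N[OF polys_over_closed(2)[OF sM e(3,5)] polys_over_closed(2)[OF sB e(4,6)]] by simp
  next
    fix x assume "x \<in> ?N"
    then obtain m h where e: "x = poly (m + P * h) a" "m \<in> polys_over M" "h \<in> polys_over B" by auto
    have "- x = poly (- m + P * (- h)) a" by (simp add: e)
    then show "- x \<in> ?N"
      using in_N[OF polys_over_closed(4)[OF sM e(2)] polys_over_closed(4)[OF sB e(3)]] by simp
  next
    fix c x assume "c \<in> ?C" "x \<in> ?N"
    then obtain g m h where e: "c = poly g a" "g \<in> polys_over B" "x = poly (m + P * h) a"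
      "m \<in> polys_over M" "h \<in> polys_over B" by (auto simp: adjoin_def)
    have "c * x = poly (g * m + P * (g * h)) a" by (simp add: e algebra_simps)
    then show "c * x \<in> ?N"
      using in_N[OF polys_over_closed(7)[OF sM e(2,4)] polys_over_closed(7)[OF sB e(2,5)]] by simp
  qed
  have "?N \<subseteq> ?C"
  proof
    fix x assume "x \<in> ?N"
    then obtain m h where e: "x = poly (m + P * h) a" "m \<in> polys_over M" "h \<in> polys_over B" by auto
    have "m + P * h \<in> polys_over B"
      using e MBp polys_over_closed(2)[OF sB] polys_over_closed(7)[OF sB P(1)] by auto
    then show "x \<in> ?C" unfolding e(1) adjoin_def by blast
  qed
  moreover have "1 \<notin> ?N" 
  proof
    assume "1 \<in> ?N"
    then obtain m h where "m \<in> polys_over M" "h \<in> polys_over B" "1 = poly (m + P * h) a" by blast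
    then show False using proper[of m h] by simp
  qed
  ultimately obtain N where N: "prime_in ?C N" "?N \<subseteq> N" using prime_extension[OF C(1) sN] by blast
  have MN: "M \<subseteq> N"
  proof
    fix x assume "x \<in> M"
    from in_N[OF polys_over_closed(5)[OF sM this, of 0] polys_over_closed(1)[OF sB]]
    show "x \<in> N" using N(2) by (auto simp: poly_monom)
  qed
  have PN: "poly P a \<in> N"
    using in_N[OF polys_over_closed(1)[OF sM] polys_over_1[OF B]] N(2) by auto
  have sN: "submodule ?C N" using N(1) by (simp add: prime_in_def)
  obtain R where R: "finite R" "R \<subseteq> B" "\<forall>x\<in>B. \<exists>r\<in>R. x - r \<in> M"
    using fr unfolding finite_residue_def by blast
  let ?d = "degree P"
  let ?R = "(\<lambda>r. \<Sum>i<?d. r i * a ^ i) ` (PiE {..<?d} (\<lambda>_. R))"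
  have lc: "lead_coeff P \<in> B" using P by (simp add: polys_over_def)
  obtain e where e: "e \<in> B" "lead_coeff P * e - 1 \<in> M" using inverse_mod[OF B M fr lc P(2)] by blast
  have aC: "a ^ i \<in> ?C" for i using subring_power[OF C(1) C(3)] .
  have "\<exists>r\<in>?R. x - r \<in> N" if x: "x \<in> ?C" for x
  proof -
    obtain g where g: "g \<in> polys_over B" "x = poly g a" using x by (auto simp: adjoin_def)
    obtain n q s where q: "q \<in> polys_over B" "s \<in> polys_over B" "\<forall>i\<ge>?d. coeff s i = 0"
      "smult (lead_coeff P ^ n) g = q * P + s" by (rule pseudo_division'[OF B sB P(1) g(1)])
    have ev: "lead_coeff P ^ n * x = poly q a * poly P a + poly s a"
      using arg_cong[OF q(4), of "\<lambda>p. poly p a"] by (simp add: g)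
    have e1: "(lead_coeff P * e) ^ n - 1 \<in> M"
    proof (induction n)
      case 0
      show ?case using submodule_closed(1)[OF sM] by simp
    next
      case (Suc n)
      have "(lead_coeff P * e) ^ Suc n - 1
          = (lead_coeff P * e) * ((lead_coeff P * e) ^ n - 1) + (lead_coeff P * e - 1)"
        by (simp add: algebra_simps)
      then show ?case
        using submodule_closed(2)[OF sM submodule_closed(5)[OF sM subring_closed(4)[OF B lc e(1)] Suc] e(2)]
        by argo
    qed
    have 1: "x - e ^ n * poly s a \<in> N"
    proof -
      have "x - e ^ n * poly s a = - (x * ((lead_coeff P * e) ^ n - 1)) + e ^ n * poly q a * poly P a"
      proof -
        have "e ^ n * (lead_coeff P ^ n * x) = e ^ n * (poly q a * poly P a + poly s a)"
          using ev by simp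
        then show ?thesis by (simp add: power_mult_distrib algebra_simps)
      qed
      moreover have "x * ((lead_coeff P * e) ^ n - 1) \<in> N"
        using submodule_closed(5)[OF sN x] e1 MN by blast
      moreover have "e ^ n * poly q a \<in> ?C"
      proof (rule subring_closed(4)[OF C(1)])
        show "e ^ n \<in> ?C" using subring_power[OF B e(1)] C(2) by blast
        show "poly q a \<in> ?C" using q(1) by (simp add: adjoin_def)
      qed
      ultimately show ?thesis using submodule_closed[OF sN] PN by simp
    qed
    have "\<forall>i. \<exists>r\<in>R. e ^ n * coeff s i - r \<in> M"
    proof
      fix i
      have "e ^ n * coeff s i \<in> B"
        using subring_closed(4)[OF B subring_power[OF B e(1)]] q(2) by (simp add: polys_over_def)
      then show "\<exists>r\<in>R. e ^ n * coeff s i - r \<in> M" using R(3) by blast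
    qed
    then obtain r where r: "\<And>i. r i \<in> R \<and> e ^ n * coeff s i - r i \<in> M" by metis
    have ps: "poly s a = (\<Sum>i<?d. coeff s i * a ^ i)"
    proof -
      have "poly s a = (\<Sum>i\<le>degree s + ?d. coeff s i * a ^ i)"
        unfolding poly_altdef by (intro sum.mono_neutral_left) (auto simp: coeff_eq_0)
      also have "\<dots> = (\<Sum>i<?d. coeff s i * a ^ i)"
        by (intro sum.mono_neutral_right) (use q(3) in auto)
      finally show ?thesis .
    qed
    have "e ^ n * poly s a - (\<Sum>i<?d. r i * a ^ i) = (\<Sum>i<?d. a ^ i * (e ^ n * coeff s i - r i))"
      unfolding ps by (simp add: sum_distrib_left sum_subtractf algebra_simps)
    also have "\<dots> \<in> N"
      using r MN aC by (intro submodule_sum[OF sN] submodule_closed(5)[OF sN]) auto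
    finally have 2: "e ^ n * poly s a - (\<Sum>i<?d. r i * a ^ i) \<in> N" .
    have 3: "x - (\<Sum>i<?d. r i * a ^ i) \<in> N" using submodule_closed(2)[OF sN 1 2] by simp
    have "(\<Sum>i<?d. r i * a ^ i) \<in> ?R"
    proof (rule image_eqI)
      show "(\<Sum>i<?d. r i * a ^ i) = (\<Sum>i<?d. restrict r {..<?d} i * a ^ i)"
        by (intro sum.cong) auto
      show "restrict r {..<?d} \<in> PiE {..<?d} (\<lambda>_. R)" using r by auto
    qed
    then show ?thesis using 3 by blast
  qed
  moreover have "finite ?R" using R(1) by (intro finite_imageI finite_PiE) auto
  moreover have "?R \<subseteq> ?C"
  proof
    fix x assume "x \<in> ?R"
    then obtain r where r: "r \<in> PiE {..<?d} (\<lambda>_. R)" "x = (\<Sum>i<?d. r i * a ^ i)" by auto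
    have "r i \<in> ?C" if "i < ?d" for i using r(1) that R(2) C(2) by (auto simp: PiE_def Pi_def)
    then show "x \<in> ?C" unfolding r(2)
      by (intro submodule_sum[OF subring_submodule[OF C(1)]] subring_closed(4)[OF C(1) _ aC]) simp
  qed
  ultimately have "finite_residue ?C N" unfolding finite_residue_def by blast
  then show ?thesis using N MN PN by blast
qed


text \<open>The property that passes from B to \<open>B[a]\<close>. The existence of a single prime with finite residue ring
  would not, since the prime has to avoid the leading coefficient of an equation for a.\<close>

definition avoiding :: "('a::field) set \<Rightarrow> bool" where
  "avoiding B \<longleftrightarrow> is_subring B \<and>
     (\<forall>b\<in>B - {0}. \<exists>M. prime_in B M \<and> finite_residue B M \<and> b \<notin> M)"

text \<open>Modulo a prime that contains \<open>a c + 1\<close>, the element c is a unit. For transcendental a this polynomial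
  in a generates a proper ideal together with any prime of B that avoids its leading coefficient.\<close>

lemma adjoin_avoiding_transcendental:
  fixes B :: "('a::field) set"
  assumes B: "avoiding B" and tr: "\<And>p. p \<in> polys_over B \<Longrightarrow> poly p a = 0 \<Longrightarrow> p = 0"
    and c: "c \<in> adjoin B a" "c \<noteq> 0"
  shows "\<exists>N. prime_in (adjoin B a) N \<and> finite_residue (adjoin B a) N \<and> c \<notin> N"
proof -
  have sr: "is_subring B" using B by (simp add: avoiding_def)
  note sB = subring_submodule[OF sr]
  obtain g where g: "g \<in> polys_over B" "c = poly g a" using c by (auto simp: adjoin_def)
  have g0: "g \<noteq> 0" using c g by auto
  obtain M where M: "prime_in B M" "finite_residue B M" "lead_coeff g \<notin> M"
  proof -
    have "lead_coeff g \<in> B - {0}" using g g0 by (auto simp: polys_over_def)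
    then show ?thesis using B that unfolding avoiding_def by blast
  qed
  have sM: "submodule B M" and M1: "1 \<notin> M" using M(1) by (auto simp: prime_in_def)
  let ?P = "monom 1 1 * g + 1"
  let ?e = "degree g"
  have Pc: "coeff ?P (Suc i) = coeff g i" for i by (simp add: coeff_monom_mult)
  have dP: "degree ?P = Suc ?e"
  proof (rule antisym)
    show "degree ?P \<le> Suc ?e"
    proof (rule degree_le, intro allI impI)
      fix i assume "Suc ?e < i"
      then show "coeff ?P i = 0" using Pc[of "i - 1"] by (cases i) (auto simp: coeff_eq_0)
    qed
    show "Suc ?e \<le> degree ?P" using g0 Pc[of ?e] by (intro le_degree) simp
  qed
  have P: "?P \<in> polys_over B"
    using polys_over_closed(2)[OF sB polys_over_closed(7)[OF sB polys_over_closed(5)[OF sB] g(1)] polys_over_1[OF sr]]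
      subring_closed(1)[OF sr] by blast
  have lcP: "lead_coeff ?P = lead_coeff g" using Pc[of ?e] dP by simp
  have "poly (m + ?P * h) a \<noteq> 1" if m: "m \<in> polys_over M" and h: "h \<in> polys_over B" for m h
  proof
    assume "poly (m + ?P * h) a = 1"
    then have "poly (m + ?P * h - 1) a = 0" by simp
    moreover have "m \<in> polys_over B" using m M(1) by (auto simp: prime_in_def polys_over_def)
    ultimately have eq: "m + ?P * h - 1 = 0"
      using tr polys_over_closed(2,3)[OF sB] polys_over_closed(7)[OF sB P h] polys_over_1[OF sr] by blast
    define S where "S = {j. coeff h j \<notin> M}"
    have fS: "finite S"
    proof (rule finite_subset)
      show "S \<subseteq> {..degree h}"
        using submodule_closed(1)[OF sM] coeff_eq_0[of h] by (fastforce simp: S_def not_le[symmetric])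
    qed simp
    show False
    proof (cases "S = {}")
      case True
      then have "h \<in> polys_over M" by (auto simp: S_def polys_over_def)
      then have "m + ?P * h \<in> polys_over M"
        using polys_over_closed(2)[OF sM m] polys_over_closed(7)[OF sM P] by blast
      then have "coeff (m + ?P * h) 0 \<in> M" unfolding polys_over_def by blast
      moreover have one: "m + ?P * h = 1" using eq by simp
      ultimately have "coeff (1 :: 'a poly) 0 \<in> M" unfolding one by blast
      then show False using M1 by simp
    next
      case False
      define j where "j = Max S"
      have j: "coeff h j \<notin> M" "\<And>i. i > j \<Longrightarrow> coeff h i \<in> M"
        using Max_in[OF fS False] Max_ge[OF fS] by (auto simp: j_def S_def not_le[symmetric])
      \<comment> \<open>The coefficient of degree \<open>j + degree P\<close> is, modulo M, the product of two elements outside M.\<close>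
      have "coeff (?P * h) (Suc ?e + j) \<in> M"
      proof -
        have "?P * h = 1 - m" using eq by (simp add: algebra_simps)
        then have "coeff (?P * h) (Suc ?e + j) = - coeff m (Suc ?e + j)" by simp
        then show ?thesis using m submodule_closed(4)[OF sM] by (simp add: polys_over_def)
      qed
      moreover have "coeff (?P * h) (Suc ?e + j) - coeff ?P (Suc ?e) * coeff h j \<in> M"
      proof -
        have "coeff (?P * h) (Suc ?e + j)
            = (\<Sum>i\<le>Suc ?e + j. coeff ?P i * coeff h (Suc ?e + j - i))" by (rule coeff_mult)
        also have "\<dots> = coeff ?P (Suc ?e) * coeff h j
            + (\<Sum>i\<in>{..Suc ?e + j} - {Suc ?e}. coeff ?P i * coeff h (Suc ?e + j - i))"
          by (subst sum.remove[of _ "Suc ?e"]) auto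
        finally have "coeff (?P * h) (Suc ?e + j) - coeff ?P (Suc ?e) * coeff h j
            = (\<Sum>i\<in>{..Suc ?e + j} - {Suc ?e}. coeff ?P i * coeff h (Suc ?e + j - i))" by simp
        also have "\<dots> \<in> M"
        proof (rule submodule_sum[OF sM])
          fix i assume i: "i \<in> {..Suc ?e + j} - {Suc ?e}"
          show "coeff ?P i * coeff h (Suc ?e + j - i) \<in> M"
          proof (cases "i < Suc ?e")
            case True
            then have "coeff h (Suc ?e + j - i) \<in> M" by (intro j(2)) simp
            moreover have "coeff ?P i \<in> B" using P unfolding polys_over_def by blast
            ultimately show ?thesis using submodule_closed(5)[OF sM] by blast
          next
            case False
            then have "coeff ?P i = 0" using i dP by (intro coeff_eq_0) auto
            then show ?thesis using submodule_closed(1)[OF sM] by simp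
          qed
        qed
        finally show ?thesis .
      qed
      ultimately have "coeff ?P (Suc ?e) * coeff h j \<in> M"
        using submodule_closed(3)[OF sM] by fastforce
      moreover have "coeff ?P (Suc ?e) \<in> B" "coeff h j \<in> B" using P h unfolding polys_over_def by blast+
      ultimately show False using M(1,3) j(1) Pc[of ?e] unfolding prime_in_def by metis
    qed
  qed
  from extend_prime[OF sr M(1,2) P _ this] lcP M(3)
  obtain N where N: "prime_in (adjoin B a) N" "finite_residue (adjoin B a) N" "poly ?P a \<in> N" by auto
  have sN: "submodule (adjoin B a) N" and N1: "1 \<notin> N" using N(1) by (auto simp: prime_in_def)
  have "c \<notin> N"
  proof
    assume "c \<in> N"
    then have "a * c \<in> N" using submodule_closed(5)[OF sN adjoin_subring(3)[OF sr]] by blast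
    then have "poly ?P a - a * c \<in> N" using submodule_closed(3)[OF sN N(3)] by blast
    then show False using N1 g by (simp add: poly_monom)
  qed
  then show ?thesis using N by blast
qed

text \<open>Lying over: a prime of B that avoids the leading coefficient of a minimal equation of a generates a
  proper ideal of \<open>B[a]\<close>. The element c divides a nonzero element of B, and it suffices to
  avoid that one as well.\<close>

lemma adjoin_avoiding_algebraic:
  fixes B :: "('a::field) set"
  assumes B: "avoiding B" and alg: "p0 \<in> polys_over B" "p0 \<noteq> 0" "poly p0 a = 0"
    and c: "c \<in> adjoin B a" "c \<noteq> 0"
  shows "\<exists>N. prime_in (adjoin B a) N \<and> finite_residue (adjoin B a) N \<and> c \<notin> N"
proof -
  have sr: "is_subring B" using B by (simp add: avoiding_def)
  note sB = subring_submodule[OF sr]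
  obtain p where p: "p \<in> polys_over B" "p \<noteq> 0" "poly p a = 0"
    and pmin: "\<And>q. q \<in> polys_over B \<Longrightarrow> q \<noteq> 0 \<Longrightarrow> poly q a = 0 \<Longrightarrow> degree p \<le> degree q"
  proof -
    let ?Q = "\<lambda>p. p \<in> polys_over B \<and> p \<noteq> 0 \<and> poly p a = 0"
    have "?Q p0" using alg by simp
    from ex_has_least_nat[of ?Q, OF this, of degree] show thesis using that by blast
  qed
  have lcp: "lead_coeff p \<in> B" "lead_coeff p \<noteq> 0" using p by (auto simp: polys_over_def)
  have small: "coeff s i = 0"
    if s: "s \<in> polys_over B" "poly s a = 0" "\<forall>i\<ge>degree p. coeff s i = 0" for s i
  proof (rule ccontr)
    assume nz: "coeff s i \<noteq> 0"
    then have s0: "s \<noteq> 0" by auto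
    then have "degree p \<le> degree s" using pmin s by blast
    then have "lead_coeff s = 0" using s(3) by simp
    then show False using s0 by simp
  qed
  obtain g where g: "g \<in> polys_over B" "c = poly g a" using c by (auto simp: adjoin_def)
  \<comment> \<open>A nonzero combination of g and p of least degree is constant: it divides both up to
    constants, and p is a minimal equation for a while g does not vanish at a.\<close>
  let ?D = "\<lambda>r. r \<noteq> 0 \<and> (\<exists>u\<in>polys_over B. \<exists>v\<in>polys_over B. r = u * g + v * p)"
  have "p = 0 * g + 1 * p" by simp
  then have "?D p" using p polys_over_1[OF sr] polys_over_closed(1)[OF sB] by blast
  from ex_has_least_nat[of ?D, OF this, of degree]
  obtain r where r: "?D r" "\<And>s. ?D s \<Longrightarrow> degree r \<le> degree s" by blast
  then obtain u v where uv: "u \<in> polys_over B" "v \<in> polys_over B" "r = u * g + v * p" by blast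
  have r0: "r \<noteq> 0" using r by blast
  have rB: "r \<in> polys_over B"
    unfolding uv(3) using polys_over_closed(2)[OF sB] polys_over_closed(7)[OF sB] uv g p by blast
  have div: "\<exists>n q. q \<in> polys_over B \<and> smult (lead_coeff r ^ n) f = q * r"
    if f: "f = u' * g + v' * p" "u' \<in> polys_over B" "v' \<in> polys_over B" for f u' v'
  proof -
    have fB: "f \<in> polys_over B"
      unfolding f(1) using polys_over_closed(2)[OF sB] polys_over_closed(7)[OF sB] f g p by blast
    obtain n q s where q: "q \<in> polys_over B" "s \<in> polys_over B" "\<forall>i\<ge>degree r. coeff s i = 0"
      "smult (lead_coeff r ^ n) f = q * r + s" by (rule pseudo_division'[OF sr sB rB fB])
    have lc: "lead_coeff r ^ n \<in> B" using rB subring_power[OF sr] by (simp add: polys_over_def)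
    have "s = smult (lead_coeff r ^ n) f - q * r" using q(4) by simp
    also have "\<dots> = (smult (lead_coeff r ^ n) u' - q * u) * g + (smult (lead_coeff r ^ n) v' - q * v) * p"
      unfolding f(1) uv(3) by (simp add: algebra_simps smult_add_right)
    finally have s: "s = (smult (lead_coeff r ^ n) u' - q * u) * g + (smult (lead_coeff r ^ n) v' - q * v) * p" .
    moreover have "smult (lead_coeff r ^ n) u' - q * u \<in> polys_over B"
      "smult (lead_coeff r ^ n) v' - q * v \<in> polys_over B"
      using polys_over_closed(3)[OF sB] polys_over_closed(6)[OF sB lc] polys_over_closed(7)[OF sB q(1)]
        f(2,3) uv(1,2) by blast+
    ultimately have "?D s" if "s \<noteq> 0" using that by blast
    then have "degree r \<le> degree s" if "s \<noteq> 0" using r(2) that by blast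
    then have "s = 0" using q(3) leading_coeff_0_iff[of s] by blast
    then show ?thesis using q by auto
  qed
  have lr: "lead_coeff r ^ n \<noteq> 0" for n using r0 by simp
  have "g = 1 * g + 0 * p" "p = 0 * g + 1 * p" by simp_all
  from div[OF this(1) polys_over_1[OF sr] polys_over_closed(1)[OF sB]]
    div[OF this(2) polys_over_closed(1)[OF sB] polys_over_1[OF sr]]
  obtain n q n' q' where q: "q \<in> polys_over B" "smult (lead_coeff r ^ n) g = q * r"
    and q': "q' \<in> polys_over B" "smult (lead_coeff r ^ n') p = q' * r" by blast
  have "degree r = 0"
  proof (rule ccontr)
    assume dr: "degree r \<noteq> 0"
    have "lead_coeff r ^ n * c = poly q a * poly r a"
      using arg_cong[OF q(2), of "\<lambda>p. poly p a"] g by simp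
    then have "poly r a \<noteq> 0" using c(2) lr[of n] by (metis mult_eq_0_iff)
    moreover have "0 = poly q' a * poly r a"
      using arg_cong[OF q'(2), of "\<lambda>p. poly p a"] p by simp
    ultimately have q'a: "poly q' a = 0" by simp
    have q'0: "q' \<noteq> 0" using q'(2) p(2) lr[of n'] by auto
    have "degree p = degree q' + degree r"
      using arg_cong[OF q'(2), of degree] lr[of n'] degree_mult_eq[OF q'0 r0]
      by (simp only: degree_smult_eq if_False)
    then show False using pmin[OF q'(1) q'0 q'a] dr by simp
  qed
  then obtain \<beta> where \<beta>: "r = [:\<beta>:]" by (rule degree_eq_zeroE)
  have \<beta>B: "\<beta> \<in> B" "\<beta> \<noteq> 0"
    using rB r0 \<beta> by (auto simp: polys_over_def dest: spec[of _ 0])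
  have \<beta>c: "\<beta> = poly u a * c"
    using arg_cong[OF uv(3), of "\<lambda>p. poly p a"] p g by (simp add: \<beta>)
  have "lead_coeff p * \<beta> \<in> B - {0}" using lcp \<beta>B subring_closed(4)[OF sr] by auto
  then obtain M where M: "prime_in B M" "finite_residue B M" "lead_coeff p * \<beta> \<notin> M"
    using B unfolding avoiding_def by blast
  have sM: "submodule B M" and M1: "1 \<notin> M" and MB: "M \<subseteq> B" using M(1) by (auto simp: prime_in_def)
  have lcM: "lead_coeff p \<notin> M" and \<beta>M: "\<beta> \<notin> M"
    using M(3) submodule_closed(5,6)[OF sM] lcp \<beta>B by blast+
  have "poly (m + p * h) a \<noteq> 1" if m: "m \<in> polys_over M" and h: "h \<in> polys_over B" for m h
  proof
    assume one: "poly (m + p * h) a = 1"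
    obtain n q s where q: "q \<in> polys_over M" "s \<in> polys_over M" "\<forall>i\<ge>degree p. coeff s i = 0"
      "smult (lead_coeff p ^ n) m = q * p + s" by (rule pseudo_division'[OF sr sM p(1) m])
    have ev: "poly s a = lead_coeff p ^ n"
      using arg_cong[OF q(4), of "\<lambda>p. poly p a"] one p by simp
    let ?s = "s - [:lead_coeff p ^ n:]"
    have lcn: "lead_coeff p ^ n \<in> B" using subring_power[OF sr lcp(1)] .
    have "[:lead_coeff p ^ n:] \<in> polys_over B"
      using lcn subring_closed(2)[OF sr] by (auto simp: polys_over_def coeff_pCons split: nat.split)
    moreover have "s \<in> polys_over B" using q(2) MB by (auto simp: polys_over_def)
    ultimately have sB': "?s \<in> polys_over B" using polys_over_closed(3)[OF sB] by blast
    have dp: "degree p \<noteq> 0"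
    proof
      assume "degree p = 0"
      then obtain x where "p = [:x:]" by (rule degree_eq_zeroE)
      then show False using p by simp
    qed
    have "coeff ?s 0 = 0"
      by (rule small[OF sB']) (use ev q(3) dp in \<open>auto simp: coeff_pCons split: nat.split\<close>)
    then have "lead_coeff p ^ n \<in> M" using q(2) by (simp add: polys_over_def) metis
    then show False using prime_in_power[OF sr M(1) lcp(1)] lcM by blast
  qed
  from extend_prime[OF sr M(1,2) p(1) lcM this]
  obtain N where N: "prime_in (adjoin B a) N" "finite_residue (adjoin B a) N" "M \<subseteq> N" by blast
  have sN: "submodule (adjoin B a) N" and N1: "1 \<notin> N" using N(1) by (auto simp: prime_in_def)
  have "c \<notin> N"
  proof
    assume "c \<in> N"
    moreover have "poly u a \<in> adjoin B a" using uv(1) by (auto simp: adjoin_def)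
    ultimately have \<beta>N: "\<beta> \<in> N" using \<beta>c submodule_closed(5)[OF sN] by blast
    obtain e where e: "e \<in> B" "\<beta> * e - 1 \<in> M" using inverse_mod[OF sr M(1,2) \<beta>B(1) \<beta>M] by blast
    have "\<beta> * e \<in> N" using submodule_closed(6)[OF sN _ \<beta>N] adjoin_subring(2)[OF sr] e(1) by blast
    then have "\<beta> * e - (\<beta> * e - 1) \<in> N" using submodule_closed(3)[OF sN] e(2) N(3) by blast
    then show False using N1 by simp
  qed
  then show ?thesis using N by blast
qed

lemma adjoin_avoiding:
  fixes B :: "('a::field) set"
  assumes "avoiding B"
  shows "avoiding (adjoin B a)"
proof -
  have "is_subring (adjoin B a)" using adjoin_subring assms by (auto simp: avoiding_def)
  moreover have "\<exists>N. prime_in (adjoin B a) N \<and> finite_residue (adjoin B a) N \<and> c \<notin> N"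
    if c: "c \<in> adjoin B a" "c \<noteq> 0" for c
  proof (cases "\<exists>p\<in>polys_over B. p \<noteq> 0 \<and> poly p a = 0")
    case True
    then obtain p where "p \<in> polys_over B" "p \<noteq> 0" "poly p a = 0" by blast
    from adjoin_avoiding_algebraic[OF assms this c] show ?thesis .
  next
    case False
    then show ?thesis using adjoin_avoiding_transcendental[OF assms _ c] by blast
  qed
  ultimately show ?thesis unfolding avoiding_def by blast
qed

text \<open>The prime ring is finite in positive characteristic, and otherwise it is the ring of integers, where
  all sufficiently large prime numbers will do.\<close>

lemma prime_subring_avoiding: "avoiding (range of_int :: ('a::field) set)"
proof -
  let ?Z = "range of_int :: 'a set"
  have Z: "is_subring ?Z"
    unfolding is_subring_def
    by (auto simp flip: of_int_diff of_int_mult intro: image_eqI[of 1 of_int 1])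
  have "\<exists>M. prime_in ?Z M \<and> finite_residue ?Z M \<and> b \<notin> M" if b: "b \<in> ?Z - {0}" for b
  proof (cases "\<exists>n>0. of_nat n = (0 :: 'a)")
    case True
    then obtain n where n: "n > 0" "of_nat n = (0 :: 'a)" by blast
    have "prime_in ?Z {0}"
      using subring_closed(2)[OF Z] by (auto simp: prime_in_def submodule_def)
    moreover have "finite_residue ?Z {0}"
      unfolding finite_residue_def
    proof (intro exI conjI ballI)
      show "finite (of_int ` {0..<int n} :: 'a set)" by simp
      show "of_int ` {0..<int n} \<subseteq> ?Z" by auto
      fix x :: 'a assume "x \<in> ?Z"
      then obtain z where z: "x = of_int z" by auto
      have "of_int z = (of_int (int n * (z div int n) + z mod int n) :: 'a)" by simp
      also have "\<dots> = of_int (z mod int n)" using n(2) by (simp only: of_int_add of_int_mult of_int_of_nat_eq) simp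
      finally have "x - of_int (z mod int n) \<in> {0}" by (simp add: z)
      then show "\<exists>r\<in>of_int ` {0..<int n}. x - r \<in> {0}" using n(1) by force
    qed
    ultimately show ?thesis using b by blast
  next
    case False
    have inj: "of_int z = (0 :: 'a) \<longleftrightarrow> z = 0" for z
    proof
      assume z: "of_int z = (0 :: 'a)"
      have "of_nat (nat \<bar>z\<bar>) = (of_int \<bar>z\<bar> :: 'a)" by simp
      also have "\<dots> = 0" using z by (simp add: abs_if)
      finally have "of_nat (nat \<bar>z\<bar>) = (0 :: 'a)" .
      then have "\<not> nat \<bar>z\<bar> > 0" using False by metis
      then show "z = 0" by simp
    qed simp
    obtain z where z1: "b = of_int z" using b by auto
    have z2: "z \<noteq> 0" using b z1 by auto
    note z = z1 z2
    obtain p where p: "prime p" "nat \<bar>z\<bar> < p" using bigger_prime by blast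
    let ?M = "(\<lambda>w. of_int (int p * w)) ` UNIV :: 'a set"
    have memM: "of_int x \<in> ?M \<longleftrightarrow> int p dvd x" for x
    proof
      assume "of_int x \<in> ?M"
      then obtain w where "of_int x = (of_int (int p * w) :: 'a)" by auto
      then have "of_int (x - int p * w) = (0 :: 'a)" by simp
      then have "x - int p * w = 0" using inj by blast
      then show "int p dvd x" by simp
    qed (auto simp: dvd_def)
    have MZ: "?M \<subseteq> ?Z" by (intro image_subsetI rangeI)
    have sM: "submodule ?Z ?M"
      unfolding submodule_def
    proof (intro conjI ballI)
      show "0 \<in> ?M" using memM[of 0] by simp
    next
      fix x y assume xy: "x \<in> ?M" "y \<in> ?M"
      then obtain a b where ab: "x = of_int a" "y = of_int b" using MZ by blast
      then show "x + y \<in> ?M" using xy memM[of a] memM[of b] memM[of "a + b"] by simp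
    next
      fix x assume xy: "x \<in> ?M"
      then obtain a where ab: "x = of_int a" using MZ by blast
      then show "- x \<in> ?M" using xy memM[of a] memM[of "- a"] by simp
    next
      fix c x assume cx: "c \<in> ?Z" "x \<in> ?M"
      then obtain a d where ab: "x = of_int a" "c = of_int d" using MZ by blast
      then show "c * x \<in> ?M" using cx memM[of a] memM[of "d * a"] by simp
    qed
    have "prime_in ?Z ?M"
      unfolding prime_in_def
    proof (intro conjI ballI impI)
      show "1 \<notin> ?M" using memM[of 1] p(1) by (auto dest: not_prime_unit)
      fix x y assume xy: "x \<in> ?Z" "y \<in> ?Z" "x * y \<in> ?M"
      then obtain a d where ab: "x = of_int a" "y = of_int d" by blast
      then have "int p dvd a * d" using xy memM[of "a * d"] by simp
      then have "int p dvd a \<or> int p dvd d" using p(1) prime_dvd_mult_iff[of "int p" a d] by simp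
      then show "x \<in> ?M \<or> y \<in> ?M" using ab memM by simp
    qed (use sM MZ in auto)
    moreover have "finite_residue ?Z ?M"
      unfolding finite_residue_def
    proof (intro exI conjI ballI)
      show "finite (of_int ` {0..<int p} :: 'a set)" by simp
      show "of_int ` {0..<int p} \<subseteq> ?Z" by auto
      fix x :: 'a assume "x \<in> ?Z"
      then obtain z where z: "x = of_int z" by auto
      have "x - of_int (z mod int p) \<in> ?M"
        using memM[of "z - z mod int p"] by (simp add: z)
      moreover have "z mod int p \<in> {0..<int p}" using prime_gt_0_nat[OF p(1)] by simp
      ultimately show "\<exists>r\<in>of_int ` {0..<int p}. x - r \<in> ?M" by blast
    qed
    moreover have "b \<notin> ?M"
    proof
      assume "b \<in> ?M"
      then have "int p dvd z" using memM z by simp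
      then have "int p \<le> \<bar>z\<bar>" using z(2) dvd_imp_le_int[of z "int p"] by simp
      then show False using p(2) by linarith
    qed
    ultimately show ?thesis by blast
  qed
  then show ?thesis using Z unfolding avoiding_def by blast
qed

lemma finite_subset_avoiding:
  fixes S :: "('a::field) set"
  assumes "finite S"
  shows "\<exists>B. avoiding B \<and> S \<subseteq> B"
  using assms
proof (induction S)
  case empty
  then show ?case using prime_subring_avoiding by blast
next
  case (insert a S)
  then obtain B where B: "avoiding B" "S \<subseteq> B" by blast
  then have "is_subring B" by (simp add: avoiding_def)
  then show ?case using adjoin_avoiding[OF B(1), of a] adjoin_subring[of B a] B(2) by blast
qed

lemma binomial_prime:
  fixes x y :: "'a::comm_ring_1"
  assumes p: "prime p"
  shows "(x + y) ^ p = x ^ p + y ^ p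
    + of_nat p * (\<Sum>k\<in>{1..<p}. of_nat ((p choose k) div p) * (x ^ k * y ^ (p - k)))"
proof -
  have p1: "p > 1" using prime_gt_1_nat[OF p] .
  have set: "{..p} = insert 0 (insert p {1..<p})" using p1 by auto
  have "(x + y) ^ p = (\<Sum>k\<le>p. of_nat (p choose k) * x ^ k * y ^ (p - k))" by (rule binomial_ring)
  also have "\<dots> = x ^ p + y ^ p + (\<Sum>k\<in>{1..<p}. of_nat (p choose k) * x ^ k * y ^ (p - k))"
    unfolding set using p1 by simp
  also have "(\<Sum>k\<in>{1..<p}. of_nat (p choose k) * x ^ k * y ^ (p - k))
      = (\<Sum>k\<in>{1..<p}. of_nat p * (of_nat ((p choose k) div p) * (x ^ k * y ^ (p - k))))"
  proof (rule sum.cong)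
    fix k assume k: "k \<in> {1..<p}"
    have "p dvd (p choose k)" using k p by (intro dvd_choose_prime) auto
    then have "of_nat (p choose k) = (of_nat p * of_nat ((p choose k) div p) :: 'a)"
      by (simp flip: of_nat_mult)
    then show "of_nat (p choose k) * x ^ k * y ^ (p - k)
        = of_nat p * (of_nat ((p choose k) div p) * (x ^ k * y ^ (p - k)))" by (simp add: mult.assoc)
  qed simp
  finally show ?thesis by (simp add: sum_distrib_left)
qed

text \<open>What is needed of a reduction to the field with \<open>p ^ N\<close> elements: in the residue ring \<open>A / M\<close> the
  N-th iterate of the Frobenius map is the identity.\<close>

definition frobenius_place :: "('a::comm_ring_1) set \<Rightarrow> 'a set \<Rightarrow> nat \<Rightarrow> nat \<Rightarrow> bool" where
  "frobenius_place A M p N \<longleftrightarrow> is_subring A \<and> M \<subseteq> A \<and> submodule A M \<and> 1 \<notin> M \<and>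
     prime p \<and> of_nat p \<in> M \<and> (\<forall>a\<in>A. a ^ (p ^ N) - a \<in> M)"

lemma submodule_power_diff:
  assumes B: "is_subring B" and M: "submodule B M" and xy: "x \<in> B" "y \<in> B" "x - y \<in> M"
  shows "x ^ n - y ^ n \<in> M"
proof (induction n)
  case 0
  then show ?case using submodule_closed(1)[OF M] by simp
next
  case (Suc n)
  have "x ^ Suc n - y ^ Suc n = x * (x ^ n - y ^ n) + y ^ n * (x - y)" by (simp add: algebra_simps)
  then show ?case
    using submodule_closed(2)[OF M submodule_closed(5)[OF M xy(1) Suc]
        submodule_closed(5)[OF M subring_power[OF B xy(2)] xy(3)]] by simp
qed

lemma prime_in_frobenius_injective:
  assumes B: "is_subring B" and M: "prime_in B M" and p: "prime p" "of_nat p \<in> M"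
    and xy: "x \<in> B" "y \<in> B" "x ^ (p ^ i) - y ^ (p ^ i) \<in> M"
  shows "x - y \<in> M"
  using xy
proof (induction i arbitrary: x y)
  case (Suc i)
  have sM: "submodule B M" using M by (simp add: prime_in_def)
  have step: "x - y \<in> M" if xy: "x \<in> B" "y \<in> B" "x ^ p - y ^ p \<in> M" for x y
  proof -
    let ?s = "\<Sum>k\<in>{1..<p}. of_nat ((p choose k) div p) * ((x - y) ^ k * y ^ (p - k))"
    have d: "x - y \<in> B" using xy subring_closed[OF B] by blast
    have "?s \<in> B"
      by (intro submodule_sum[OF subring_submodule[OF B]] subring_closed(4)[OF B] subring_of_nat[OF B]
          subring_power[OF B] d xy)
    then have "of_nat p * ?s \<in> M" using submodule_closed(6)[OF sM _ p(2)] by blast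
    moreover have "(x - y) ^ p = (x ^ p - y ^ p) - of_nat p * ?s"
      using binomial_prime[OF p(1), of "x - y" y] by simp
    ultimately have "(x - y) ^ p \<in> M" using submodule_closed(3)[OF sM xy(3)] by simp
    then show ?thesis using prime_in_power[OF B M d] by blast
  qed
  have "(x ^ p ^ i) ^ p - (y ^ p ^ i) ^ p \<in> M" using Suc.prems(3) by (simp add: power_mult[symmetric] mult.commute)
  then have "x ^ p ^ i - y ^ p ^ i \<in> M"
    using step Suc.prems(1,2) subring_power[OF B] by blast
  then show ?case using Suc.IH Suc.prems(1,2) by blast
qed simp

lemma residue_char:
  assumes B: "is_subring B" and M: "prime_in B M" and fr: "finite_residue B M"
  shows "\<exists>p. prime p \<and> of_nat p \<in> M"
proof -
  have sM: "submodule B M" and M1: "1 \<notin> M" using M by (auto simp: prime_in_def)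
  obtain R where R: "finite R" "\<forall>x\<in>B. \<exists>r\<in>R. x - r \<in> M" using fr unfolding finite_residue_def by blast
  obtain i j where ij: "i < j" "of_nat j - of_nat i \<in> M"
    using residue_pigeonhole[OF sM R, of of_nat] subring_of_nat[OF B] by blast
  then have "0 < j - i \<and> of_nat (j - i) \<in> M" by (simp add: of_nat_diff)
  from ex_has_least_nat[of "\<lambda>n. 0 < n \<and> of_nat n \<in> M", OF this, of id]
  obtain n where n: "0 < n" "of_nat n \<in> M" and least: "\<And>k. 0 < k \<Longrightarrow> of_nat k \<in> M \<Longrightarrow> n \<le> k" by auto
  have "n \<noteq> 1" using n(2) M1 by auto
  obtain q where q: "prime q" "q dvd n" using prime_factor_nat[OF \<open>n \<noteq> 1\<close>] by blast
  then obtain m where m: "n = q * m" by (elim dvdE)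
  have "of_nat q * of_nat m \<in> M" using n(2) by (simp add: m)
  then have "of_nat q \<in> M \<or> of_nat m \<in> M"
    using M subring_of_nat[OF B] unfolding prime_in_def by blast
  moreover have "of_nat m \<notin> M"
  proof
    assume "of_nat m \<in> M"
    moreover have "0 < m" using n(1) m by simp
    ultimately have "n \<le> m" using least by blast
    then show False using m prime_gt_1_nat[OF q(1)] \<open>0 < m\<close> by simp
  qed
  ultimately show ?thesis using q(1) by blast
qed

text \<open>Modulo a prime with finite residue ring, iterating the injective map \<open>x \<mapsto> x ^ p\<close> as often as a
  multiple of all numbers up to the number of residues yields the identity.\<close>

theorem frobenius_place_exists:
  fixes S :: "('a::field) set"
  assumes S: "finite S"
  shows "\<exists>A M p N. frobenius_place A M p N \<and> S \<subseteq> A \<and> inverse ` S \<subseteq> A \<and> t \<le> p ^ N"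
proof -
  have "finite (S \<union> inverse ` S)" using S by simp
  from finite_subset_avoiding[OF this] obtain B where B: "avoiding B" "S \<union> inverse ` S \<subseteq> B" by blast
  have sr: "is_subring B" using B(1) by (simp add: avoiding_def)
  have "(1 :: 'a) \<in> B - {0}" using subring_closed(1)[OF sr] by simp
  then obtain M where M: "prime_in B M" "finite_residue B M"
    using B(1) unfolding avoiding_def by blast
  have sM: "submodule B M" "1 \<notin> M" "M \<subseteq> B" using M by (auto simp: prime_in_def)
  obtain p where p: "prime p" "of_nat p \<in> M" using residue_char[OF sr M] by blast
  obtain R where R: "finite R" "\<forall>x\<in>B. \<exists>r\<in>R. x - r \<in> M"
    using M(2) unfolding finite_residue_def by blast
  define N where "N = fact (card R) * Suc t"
  have main: "x ^ (p ^ N) - x \<in> M" if x: "x \<in> B" for x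
  proof -
    have xB: "x ^ n \<in> B" for n using subring_power[OF sr x] .
    from residue_pigeonhole[OF sM(1) R, of "\<lambda>i. x ^ (p ^ i)", OF xB]
    obtain i j where ij: "i < j" "j \<le> card R" "x ^ p ^ j - x ^ p ^ i \<in> M" by blast
    define d where "d = j - i"
    have "(x ^ p ^ d) ^ p ^ i - x ^ p ^ i \<in> M"
      using ij(1,3) by (simp add: d_def flip: power_mult power_add)
    then have d: "x ^ p ^ d - x \<in> M"
      using prime_in_frobenius_injective[OF sr M(1) p xB x] by blast
    have it: "x ^ p ^ (d * k) - x \<in> M" for k
    proof (induction k)
      case 0
      then show ?case using submodule_closed(1)[OF sM(1)] by simp
    next
      case (Suc k)
      have "(x ^ p ^ (d * k)) ^ p ^ d - x ^ p ^ d \<in> M"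
        by (rule submodule_power_diff[OF sr sM(1) xB x Suc])
      from submodule_closed(2)[OF sM(1) this d] show ?case
        by (simp add: power_add mult.commute flip: power_mult)
    qed
    have "d dvd fact (card R)" using ij by (intro dvd_fact) (auto simp: d_def)
    then have "d dvd N" by (simp add: N_def)
    then show ?thesis using it by auto
  qed
  have "1 * Suc t \<le> N" unfolding N_def by (intro mult_right_mono) (simp_all add: fact_ge_1)
  then have "Suc t \<le> N" by simp
  moreover have "N < p ^ N" using prime_gt_1_nat[OF p(1)] by (intro power_gt_expt) auto
  ultimately have "t \<le> p ^ N" by linarith
  then show ?thesis using main B(2) sr sM p unfolding frobenius_place_def by blast
qed

section \<open>Reduction of Knutson ideals modulo a prime\<close>

primrec mscale :: "nat \<Rightarrow> monom \<Rightarrow> monom" where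
  "mscale 0 a = 0"
| "mscale (Suc n) a = a + mscale n a"

lemma lookup_mscale [simp]: "lookup (mscale n a) i = n * lookup a i"
  by (induction n) (simp_all add: lookup_add)

lemma mscale_add: "mscale n (a + b) = mscale n a + mscale n b"
  by (intro poly_mapping_eqI) (simp add: lookup_add algebra_simps)

lemma mscale_monoms: "a \<in> monoms V \<Longrightarrow> mscale n a \<in> monoms V"
  by (induction n) auto

lemma mscale_monoms_iff: "0 < n \<Longrightarrow> mscale n a \<in> monoms V \<longleftrightarrow> a \<in> monoms V"
  using mscale_monoms[of a V n] by (cases n) auto

definition ones :: "nat set \<Rightarrow> monom" where
  "ones V = (\<Sum>i\<in>V. single i 1)"

lemma lookup_ones: "finite V \<Longrightarrow> lookup (ones V) i = (if i \<in> V then 1 else 0)"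
  by (simp add: ones_def lookup_sum lookup_single when_def)

lemma ones_monoms [simp]: "ones V \<in> monoms V"
proof (cases "finite V")
  case True
  then show ?thesis by (auto simp: monoms_def in_keys_iff lookup_ones split: if_splits)
qed (simp add: ones_def)

definition trace_exp :: "nat set \<Rightarrow> nat \<Rightarrow> monom \<Rightarrow> monom" where
  "trace_exp V q a = mscale q a + mscale (q - 1) (ones V)"

text \<open>The linear map that sends \<open>x\<^bsup>qa + (q-1)(1,\<dots>,1)\<^esup>\<close> to \<open>x\<^bsup>a\<^esup>\<close> and kills all other monomials.
  Over a field with q elements it generates the dual of the ring as a module over itself by
  the q-power Frobenius map. It is defined here over any ring, so that it can be applied before reduction.\<close>

definition frob_trace :: "nat set \<Rightarrow> nat \<Rightarrow> ('a::comm_ring_1) mpoly \<Rightarrow> 'a mpoly" where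
  "frob_trace V q h = Poly_Mapping.map_key (trace_exp V q) h"

context
  fixes V :: "nat set" and q :: nat
  assumes q: "0 < q" and finV: "finite V"
begin

lemma inj_trace_exp: "inj (trace_exp V q)"
proof (rule injI)
  fix a b assume "trace_exp V q a = trace_exp V q b"
  then have "mscale q a = mscale q b" by (simp add: trace_exp_def)
  then have "q * lookup a i = q * lookup b i" for i by (metis lookup_mscale)
  then show "a = b" using q by (intro poly_mapping_eqI) simp
qed

lemma lookup_frob_trace: "lookup (frob_trace V q h) a = lookup h (trace_exp V q a)"
  unfolding frob_trace_def using inj_trace_exp by (simp add: map_key.rep_eq)

lemma frob_trace_add: "frob_trace V q (g + h) = frob_trace V q g + frob_trace V q h"
  by (intro poly_mapping_eqI) (simp add: lookup_frob_trace lookup_add)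

lemma frob_trace_0: "frob_trace V q (0 :: ('a::comm_ring_1) mpoly) = 0"
  by (intro poly_mapping_eqI) (simp add: lookup_frob_trace)

lemma frob_trace_coeffs_in: "h \<in> coeffs_in N \<Longrightarrow> frob_trace V q h \<in> coeffs_in N"
  by (simp add: coeffs_in_def lookup_frob_trace)

lemma frob_trace_polys:
  assumes "h \<in> polys V"
  shows "frob_trace V q h \<in> polys V"
  unfolding polys_iff
proof
  fix a assume "a \<in> keys (frob_trace V q h)"
  then have "trace_exp V q a \<in> monoms V"
    using assms by (auto simp: in_keys_iff lookup_frob_trace polys_iff)
  then show "a \<in> monoms V" by (simp add: trace_exp_def mscale_monoms_iff[OF q])
qed

lemma frob_trace_linear:
  fixes h :: "('a::comm_ring_1) mpoly"
  assumes m: "m \<in> monoms V"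
  shows "frob_trace V q (single (mscale q m) c * h) = single m c * frob_trace V q h"
proof (rule poly_mapping_eqI)
  fix a
  show "lookup (frob_trace V q (single (mscale q m) c * h)) a = lookup (single m c * frob_trace V q h) a"
  proof (cases "monom_dvd m a")
    case True
    then obtain s where s: "a = m + s" by (rule monom_dvdE)
    have "trace_exp V q a = mscale q m + trace_exp V q s"
      by (simp add: trace_exp_def s mscale_add add.assoc)
    then show ?thesis by (simp add: lookup_frob_trace lookup_single_mult s)
  next
    case False
    have "lookup (single m c * frob_trace V q h) a = 0"
      by (rule lookup_single_mult_notin) (use False monom_dvd_add in blast)
    moreover have "lookup (single (mscale q m) c * h) (trace_exp V q a) = 0"
    proof (rule lookup_single_mult_notin)
      fix s
      show "trace_exp V q a \<noteq> mscale q m + s"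
      proof
        assume eq: "trace_exp V q a = mscale q m + s"
        obtain i where i: "lookup a i < lookup m i"
          using False by (auto simp: monom_dvd_def not_le)
        then have "i \<in> keys m" by (simp add: in_keys_iff)
        then have "i \<in> V" using m by (auto simp: monoms_def)
        then have "q * lookup a i + (q - 1) = q * lookup m i + lookup s i"
          using arg_cong[OF eq, of "\<lambda>b. lookup b i"] finV
          by (simp add: trace_exp_def lookup_add lookup_ones)
        moreover have "q * Suc (lookup a i) \<le> q * lookup m i" using i by (intro mult_le_mono2) simp
        ultimately show False using q by simp
      qed
    qed
    ultimately show ?thesis by (simp add: lookup_frob_trace)
  qed
qed

end

lemma coeffs_in_subring:
  assumes "is_subring A"
  shows "is_subring (coeffs_in A :: ('a::comm_ring_1) mpoly set)"
proof -
  note s = subring_submodule[OF assms]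
  have "single 0 1 \<in> coeffs_in A" by (rule coeffs_in_single[OF s subring_closed(1)[OF assms]])
  then show ?thesis unfolding is_subring_def
    using coeffs_in_diff[OF s] coeffs_in_mult[OF s] by simp
qed

lemma coeffs_in_submodule:
  assumes "submodule A M"
  shows "submodule (coeffs_in A) (coeffs_in M :: ('a::comm_ring_1) mpoly set)"
  unfolding submodule_def
  using coeffs_in_0[OF assms] coeffs_in_add[OF assms] coeffs_in_uminus[OF assms] coeffs_in_mult[OF assms]
  by blast

lemma coeffs_in_mono: "M \<subseteq> A \<Longrightarrow> coeffs_in M \<subseteq> coeffs_in A"
  by (auto simp: coeffs_in_def)

lemma power_prime_power_add_mod:
  fixes x y :: "'a::comm_ring_1"
  assumes B: "is_subring B" and M: "submodule B M" and p: "prime p" "of_nat p \<in> M"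
    and xy: "x \<in> B" "y \<in> B"
  shows "(x + y) ^ (p ^ i) - (x ^ (p ^ i) + y ^ (p ^ i)) \<in> M"
proof (induction i)
  case 0
  then show ?case using submodule_closed(1)[OF M] by simp
next
  case (Suc i)
  let ?u = "x ^ (p ^ i)" and ?v = "y ^ (p ^ i)"
  have uv: "?u \<in> B" "?v \<in> B" "(x + y) ^ (p ^ i) \<in> B"
    using subring_power[OF B] subring_closed(6)[OF B] xy by auto
  have 1: "((x + y) ^ (p ^ i)) ^ p - (?u + ?v) ^ p \<in> M"
    by (rule submodule_power_diff[OF B M uv(3) subring_closed(6)[OF B uv(1,2)] Suc])
  let ?s = "\<Sum>k\<in>{1..<p}. of_nat ((p choose k) div p) * (?u ^ k * ?v ^ (p - k))"
  have "?s \<in> B"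
    by (intro submodule_sum[OF subring_submodule[OF B]] subring_closed(4)[OF B] subring_of_nat[OF B]
        subring_power[OF B] xy)
  then have "of_nat p * ?s \<in> M" using submodule_closed(6)[OF M _ p(2)] by blast
  then have "(?u + ?v) ^ p - (?u ^ p + ?v ^ p) \<in> M" using binomial_prime[OF p(1), of ?u ?v] by simp
  moreover have "a - b + (b - c) = a - c" for a b c :: 'a by simp
  ultimately have "((x + y) ^ (p ^ i)) ^ p - (?u ^ p + ?v ^ p) \<in> M"
    using submodule_closed(2)[OF M 1] by metis
  then show ?case by (simp only: power_mult[symmetric] power_Suc2)
qed

lemma single_power: "single m c ^ n = (single (mscale n m) (c ^ n) :: ('a::comm_ring_1) mpoly)"
  by (induction n) (simp_all add: mult_single)

text \<open>Modulo M, raising a polynomial to the power q replaces its variables by their powers, so q-th powers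
  can be taken out of the trace.\<close>

lemma frob_trace_power_mod:
  fixes g h :: "('a::comm_ring_1) mpoly"
  assumes V: "finite V" and pl: "frobenius_place A M p N"
    and g: "g \<in> polys V \<inter> coeffs_in A" and h: "h \<in> coeffs_in A"
  shows "frob_trace V (p ^ N) (g ^ (p ^ N) * h) - g * frob_trace V (p ^ N) h \<in> coeffs_in M"
proof -
  define q where "q = p ^ N"
  have A: "is_subring A" and sM: "submodule A M" and p: "prime p" "of_nat p \<in> M"
    and fr: "\<And>a. a \<in> A \<Longrightarrow> a ^ q - a \<in> M"
    using pl by (auto simp: frobenius_place_def q_def)
  have q0: "0 < q" using p(1) by (simp add: q_def prime_gt_0_nat)
  note T = lookup_frob_trace[OF q0 V] frob_trace_add[OF q0 V]
  note cA = coeffs_in_subring[OF A] and cM = coeffs_in_submodule[OF sM]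
  have pM: "(of_nat p :: 'a mpoly) \<in> coeffs_in M"
    using coeffs_in_single[OF sM p(2), of 0] by simp
  note sA = subring_submodule[OF A]
  have tM: "frob_trace V q x \<in> coeffs_in M" if "x \<in> coeffs_in M" for x :: "'a mpoly"
    by (rule frob_trace_coeffs_in[OF q0 V that])
  have "g' \<in> coeffs_in A \<and> frob_trace V q (g' ^ q * h) - g' * frob_trace V q h \<in> coeffs_in M"
    if "g' = g" for g'
    unfolding that
  proof (induction g rule: mpoly_additive_induct)
    case zero
    then show ?case using coeffs_in_0[OF sM] coeffs_in_0[OF sA] q0
      by (simp add: frob_trace_0[OF q0 V] zero_power)
  next
    case (add m r)
    let ?s = "single m (lookup g m)"
    have mV: "m \<in> monoms V" using add.hyps g by (auto simp: polys_iff)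
    have cA': "lookup g m \<in> A" using g by (simp add: coeffs_in_def)
    have sr: "?s \<in> coeffs_in A" "r \<in> coeffs_in A"
      using coeffs_in_single[OF sA cA'] add.IH by auto
    define e where "e = (?s + r) ^ q - (?s ^ q + r ^ q)"
    have e: "e \<in> coeffs_in M"
      unfolding e_def q_def by (rule power_prime_power_add_mod[OF cA cM p(1) pM sr])
    define d where "d = lookup g m ^ q - lookup g m"
    have d: "d \<in> M" using fr[OF cA'] by (simp add: d_def)
    have sq: "?s ^ q = single (mscale q m) (lookup g m) + single (mscale q m) d"
      by (simp add: single_power d_def flip: single_add)
    have "(?s + r) ^ q * h = single (mscale q m) (lookup g m) * h
        + (r ^ q * h + (single (mscale q m) d * h + e * h))"
    proof -
      have "(?s + r) ^ q = ?s ^ q + r ^ q + e" by (simp add: e_def)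
      then show ?thesis unfolding sq by (simp add: algebra_simps)
    qed
    then have "frob_trace V q ((?s + r) ^ q * h) = ?s * frob_trace V q h
        + (frob_trace V q (r ^ q * h) + frob_trace V q (single (mscale q m) d * h + e * h))"
      by (simp only: T(2) frob_trace_linear[OF q0 V mV])
    then have "frob_trace V q ((?s + r) ^ q * h) - (?s + r) * frob_trace V q h
        = (frob_trace V q (r ^ q * h) - r * frob_trace V q h)
          + frob_trace V q (single (mscale q m) d * h + e * h)"
      by (simp add: distrib_right)
    moreover have "single (mscale q m) d * h + e * h \<in> coeffs_in M"
      using coeffs_in_single[OF sM d] e h by (intro submodule_closed(2)[OF cM] submodule_closed(6)[OF cM])
    ultimately show ?case
      using submodule_closed(2)[OF cM] add.IH tM coeffs_in_add[OF sA sr] by simp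
  qed
  then show ?thesis by (simp add: q_def)
qed

definition coeff_set :: "('a::comm_ring_1) mpoly \<Rightarrow> 'a set" where
  "coeff_set p = insert 0 (lookup p ` keys p)"

lemma finite_coeff_set [simp]: "finite (coeff_set p)"
  by (simp add: coeff_set_def)

lemma coeff_set_subset: "coeff_set p \<subseteq> A \<Longrightarrow> p \<in> coeffs_in A"
  unfolding coeffs_in_def coeff_set_def by (auto simp: in_keys_iff) (metis image_eqI in_keys_iff insertCI subset_iff)

lemma division_generic:
  fixes I :: "('a::field) mpoly set"
  assumes V: "finite V" and mo: "monomial_order V lt" and I: "ideal I (mpoly_ring V)"
  shows "\<exists>G S. finite G \<and> G \<subseteq> I \<and> finite S \<and>
    (\<forall>A N h. S \<subseteq> A \<longrightarrow> submodule A N \<longrightarrow> h \<in> I \<longrightarrow> h \<in> coeffs_in N \<longrightarrow>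
       (\<exists>q. (\<forall>g\<in>G. q g \<in> polys V \<inter> coeffs_in N) \<and> h = (\<Sum>g\<in>G. q g * g)))"
proof -
  obtain G where G: "monic_basis V lt I G" using monic_basis_exists[OF V mo I] .
  then have GI: "finite G" "G \<subseteq> I" by (auto simp: monic_basis_def)
  show ?thesis
  proof (intro exI[of _ G] exI[of _ "\<Union>(coeff_set ` G)"] conjI allI impI GI)
    show "finite (\<Union>(coeff_set ` G))" using GI by auto
    fix A N h assume "\<Union>(coeff_set ` G) \<subseteq> A" and N: "submodule A N" "h \<in> I" "h \<in> coeffs_in N"
    then have "G \<subseteq> coeffs_in A" using coeff_set_subset by blast
    from monic_division[OF V mo I G this N]
    show "\<exists>q. (\<forall>g\<in>G. q g \<in> polys V \<inter> coeffs_in N) \<and> h = (\<Sum>g\<in>G. q g * g)" .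
  qed
qed

text \<open>Sums of ideals specialise well: a decomposition over the field of an element with
  coefficients in N can be replaced by one with coefficients in N, whenever N is a
  module over a ring that contains finitely many elements, which depend on the ideals alone.\<close>

lemma sum_generic:
  fixes I J :: "('a::field) mpoly set"
  assumes V: "finite V" and mo: "monomial_order V lt"
    and I: "ideal I (mpoly_ring V)" and J: "ideal J (mpoly_ring V)"
  shows "\<exists>S. finite S \<and>
    (\<forall>A N h. S \<subseteq> A \<longrightarrow> submodule A N \<longrightarrow> h \<in> I <+>\<^bsub>mpoly_ring V\<^esub> J \<longrightarrow> h \<in> coeffs_in N \<longrightarrow>
       (\<exists>i\<in>I \<inter> coeffs_in N. \<exists>j\<in>J \<inter> coeffs_in N. h = i + j))"
proof -
  obtain G S where GS: "finite G" "G \<subseteq> I <+>\<^bsub>mpoly_ring V\<^esub> J" "finite S"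
    and "\<forall>A N h. S \<subseteq> A \<longrightarrow> submodule A N \<longrightarrow> h \<in> I <+>\<^bsub>mpoly_ring V\<^esub> J \<longrightarrow> h \<in> coeffs_in N \<longrightarrow>
       (\<exists>q. (\<forall>g\<in>G. q g \<in> polys V \<inter> coeffs_in N) \<and> h = (\<Sum>g\<in>G. q g * g))"
    using division_generic[OF V mo ideal_set_add[OF I J]] by (elim exE conjE)
  note div = this(4)[rule_format]
  have "\<forall>g\<in>G. \<exists>ab. fst ab \<in> I \<and> snd ab \<in> J \<and> g = fst ab + snd ab"
    using GS(2) by (fastforce simp: set_add_mpoly_ring)
  from bchoice[OF this] obtain ab where ab: "\<forall>g\<in>G. fst (ab g) \<in> I \<and> snd (ab g) \<in> J \<and> g = fst (ab g) + snd (ab g)" ..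
  let ?S = "S \<union> (\<Union>g\<in>G. coeff_set (fst (ab g)) \<union> coeff_set (snd (ab g)))"
  show ?thesis
  proof (intro exI[of _ ?S] conjI allI impI)
    show "finite ?S" using GS by auto
    fix A N h assume A: "?S \<subseteq> A" and N: "submodule A N" and h: "h \<in> I <+>\<^bsub>mpoly_ring V\<^esub> J" "h \<in> coeffs_in N"
    have "S \<subseteq> A" using A by blast
    from div[OF this N h] obtain q where q: "\<forall>g\<in>G. q g \<in> polys V \<inter> coeffs_in N" "h = (\<Sum>g\<in>G. q g * g)"
      by blast
    have c: "fst (ab g) \<in> coeffs_in A" "snd (ab g) \<in> coeffs_in A" if "g \<in> G" for g
      using A that coeff_set_subset[of _ A] by auto
    let ?i = "\<Sum>g\<in>G. q g * fst (ab g)" and ?j = "\<Sum>g\<in>G. q g * snd (ab g)"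
    have "?i \<in> I" using q ab by (intro ideal_sum[OF I] ideal_mult[OF I]) auto
    moreover have "?j \<in> J" using q ab by (intro ideal_sum[OF J] ideal_mult[OF J]) auto
    moreover have "?i \<in> coeffs_in N" "?j \<in> coeffs_in N"
      using q c by (auto intro!: coeffs_in_sum[OF N] submodule_closed(6)[OF coeffs_in_submodule[OF N]])
    moreover have "h = ?i + ?j"
    proof -
      have "h = (\<Sum>g\<in>G. q g * (fst (ab g) + snd (ab g)))" unfolding q(2) using ab by (intro sum.cong) auto
      then show ?thesis by (simp add: distrib_left sum.distrib)
    qed
    ultimately show "\<exists>i\<in>I \<inter> coeffs_in N. \<exists>j\<in>J \<inter> coeffs_in N. h = i + j" by blast
  qed
qed

lemma sum_principal_generic:
  fixes I :: "('a::field) mpoly set"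
  assumes V: "finite V" and mo: "monomial_order V lt"
    and I: "ideal I (mpoly_ring V)" and j: "j \<in> polys V"
  shows "\<exists>S. finite S \<and>
    (\<forall>A N i r. S \<subseteq> A \<longrightarrow> submodule A N \<longrightarrow> i \<in> I \<longrightarrow> r \<in> polys V \<longrightarrow> i + r * j \<in> coeffs_in N \<longrightarrow>
       (\<exists>i'\<in>I. \<exists>r'\<in>polys V \<inter> coeffs_in N. i + r * j = i' + r' * j))"
proof -
  let ?J = "I <+>\<^bsub>mpoly_ring V\<^esub> idl V {j}"
  have ij: "ideal (idl V {j}) (mpoly_ring V)" using j by (intro ideal_idl) simp
  obtain G S where GS: "finite G" "G \<subseteq> ?J" "finite S"
    and "\<forall>A N h. S \<subseteq> A \<longrightarrow> submodule A N \<longrightarrow> h \<in> ?J \<longrightarrow> h \<in> coeffs_in N \<longrightarrow>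
       (\<exists>q. (\<forall>g\<in>G. q g \<in> polys V \<inter> coeffs_in N) \<and> h = (\<Sum>g\<in>G. q g * g))"
    using division_generic[OF V mo ideal_set_add[OF I ij]] by (elim exE conjE)
  note div = this(4)[rule_format]
  have J: "?J = {a + r * j |a r. a \<in> I \<and> r \<in> polys V}"
    unfolding set_add_mpoly_ring idl_singleton[OF j] by blast
  have "\<forall>g\<in>G. \<exists>ab. fst ab \<in> I \<and> snd ab \<in> polys V \<and> g = fst ab + snd ab * j"
    using GS(2) unfolding J by fastforce
  from bchoice[OF this] obtain ab
    where ab: "\<forall>g\<in>G. fst (ab g) \<in> I \<and> snd (ab g) \<in> polys V \<and> g = fst (ab g) + snd (ab g) * j" ..
  let ?S = "S \<union> (\<Union>g\<in>G. coeff_set (snd (ab g)))"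
  show ?thesis
  proof (intro exI[of _ ?S] conjI allI impI)
    show "finite ?S" using GS by auto
    fix A N i r assume A: "?S \<subseteq> A" and N: "submodule A N" and h: "i \<in> I" "r \<in> polys V" "i + r * j \<in> coeffs_in N"
    have "S \<subseteq> A" using A by blast
    moreover have "i + r * j \<in> ?J" using h unfolding J by blast
    ultimately obtain q where q: "\<forall>g\<in>G. q g \<in> polys V \<inter> coeffs_in N" "i + r * j = (\<Sum>g\<in>G. q g * g)"
      using div[OF _ N _ h(3)] by blast
    have c: "snd (ab g) \<in> coeffs_in A" if "g \<in> G" for g
      using A that coeff_set_subset[of _ A] by auto
    let ?i = "\<Sum>g\<in>G. q g * fst (ab g)" and ?r = "\<Sum>g\<in>G. q g * snd (ab g)"
    have "?i \<in> I" using q ab by (intro ideal_sum[OF I] ideal_mult[OF I]) auto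
    moreover have "?r \<in> polys V" using q ab by (intro polys_sum polys_mult) auto
    moreover have "?r \<in> coeffs_in N"
      using q c by (auto intro!: coeffs_in_sum[OF N] submodule_closed(6)[OF coeffs_in_submodule[OF N]])
    moreover have "i + r * j = ?i + ?r * j"
    proof -
      have "i + r * j = (\<Sum>g\<in>G. q g * (fst (ab g) + snd (ab g) * j))"
        unfolding q(2) using ab by (intro sum.cong) auto
      then show ?thesis by (simp add: distrib_left sum.distrib sum_distrib_right mult.assoc)
    qed
    ultimately show "\<exists>i'\<in>I. \<exists>r'\<in>polys V \<inter> coeffs_in N. i + r * j = i' + r' * j" by blast
  qed
qed


text \<open>The reduction of I modulo M is mapped into itself by \<open>h \<mapsto> Tr (E\<^bsup>q-1\<^esup> h)\<close>. This is the property of Knutson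
  ideals to be proved by induction, for all places at which finitely many elements of the field
  are units. There is no single map Tr over the field itself, so an ideal is compared
  with its reductions throughout.\<close>

definition compatible_at ::
    "nat set \<Rightarrow> ('a::field) mpoly \<Rightarrow> 'a mpoly set \<Rightarrow> 'a set \<Rightarrow> 'a set \<Rightarrow> nat \<Rightarrow> bool" where
  "compatible_at V E I A M q \<longleftrightarrow> (\<forall>h\<in>I \<inter> coeffs_in A. \<exists>i\<in>I \<inter> coeffs_in A.
     frob_trace V q (E ^ (q - 1) * h) - i \<in> coeffs_in M)"

definition generically_compatible :: "nat set \<Rightarrow> ('a::field) mpoly \<Rightarrow> 'a mpoly set \<Rightarrow> bool" where
  "generically_compatible V E I \<longleftrightarrow> (\<exists>S. finite S \<and>
     (\<forall>A M p N. frobenius_place A M p N \<longrightarrow> S \<union> inverse ` S \<subseteq> A \<longrightarrow> compatible_at V E I A M (p ^ N)))"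

lemma generically_compatibleI:
  fixes I :: "('a::field) mpoly set"
  assumes "finite S" "\<And>A M p N. frobenius_place A M p N \<Longrightarrow> S \<subseteq> A \<Longrightarrow> inverse ` S \<subseteq> A \<Longrightarrow>
    compatible_at V E I A M (p ^ N)"
  shows "generically_compatible V E I"
  using assms unfolding generically_compatible_def by (intro exI[of _ S]) auto

lemma compatible_sum:
  fixes I J :: "('a::field) mpoly set"
  assumes V: "finite V" and mo: "monomial_order V lt"
    and I: "ideal I (mpoly_ring V)" "generically_compatible V E I"
    and J: "ideal J (mpoly_ring V)" "generically_compatible V E J"
  shows "generically_compatible V E (I <+>\<^bsub>mpoly_ring V\<^esub> J)"
proof -
  obtain S1 where S1: "finite S1" "\<forall>A M p N. frobenius_place A M p N \<longrightarrow> S1 \<union> inverse ` S1 \<subseteq> A \<longrightarrow>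
    compatible_at V E I A M (p ^ N)" using I(2) unfolding generically_compatible_def by (elim exE conjE)
  obtain S2 where S2: "finite S2" "\<forall>A M p N. frobenius_place A M p N \<longrightarrow> S2 \<union> inverse ` S2 \<subseteq> A \<longrightarrow>
    compatible_at V E J A M (p ^ N)" using J(2) unfolding generically_compatible_def by (elim exE conjE)
  obtain S3 where S3: "finite S3"
    "\<forall>A N h. S3 \<subseteq> A \<longrightarrow> submodule A N \<longrightarrow> h \<in> I <+>\<^bsub>mpoly_ring V\<^esub> J \<longrightarrow> h \<in> coeffs_in N \<longrightarrow>
       (\<exists>i\<in>I \<inter> coeffs_in N. \<exists>j\<in>J \<inter> coeffs_in N. h = i + j)"
    using sum_generic[OF V mo I(1) J(1)] by (elim exE conjE)
  show ?thesis
  proof (rule generically_compatibleI[of "S1 \<union> S2 \<union> S3"])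
    fix A M p N
    assume pl: "frobenius_place A M p N" and SA: "S1 \<union> S2 \<union> S3 \<subseteq> A" "inverse ` (S1 \<union> S2 \<union> S3) \<subseteq> A"
    have A: "is_subring A" and sM: "submodule A M" and q: "0 < p ^ N"
      using pl by (auto simp: frobenius_place_def prime_gt_0_nat)
    let ?q = "p ^ N"
    let ?\<phi> = "\<lambda>h. frob_trace V ?q (E ^ (?q - 1) * h)"
    have cI: "compatible_at V E I A M ?q" using S1(2) pl SA by blast
    have cJ: "compatible_at V E J A M ?q" using S2(2) pl SA by blast
    show "compatible_at V E (I <+>\<^bsub>mpoly_ring V\<^esub> J) A M ?q"
      unfolding compatible_at_def
    proof
      fix h assume h: "h \<in> (I <+>\<^bsub>mpoly_ring V\<^esub> J) \<inter> coeffs_in A"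
      have "\<exists>i\<in>I \<inter> coeffs_in A. \<exists>j\<in>J \<inter> coeffs_in A. h = i + j"
        using S3(2)[rule_format, OF _ subring_submodule[OF A], of h] SA h by blast
      then obtain i j where ij: "i \<in> I \<inter> coeffs_in A" "j \<in> J \<inter> coeffs_in A" "h = i + j" by blast
      obtain i' where i': "i' \<in> I \<inter> coeffs_in A" "?\<phi> i - i' \<in> coeffs_in M"
        using cI ij(1) unfolding compatible_at_def by blast
      obtain j' where j': "j' \<in> J \<inter> coeffs_in A" "?\<phi> j - j' \<in> coeffs_in M"
        using cJ ij(2) unfolding compatible_at_def by blast
      have "?\<phi> h - (i' + j') = (?\<phi> i - i') + (?\<phi> j - j')"
        unfolding ij(3) distrib_left frob_trace_add[OF q V] by simp
      then have "?\<phi> h - (i' + j') \<in> coeffs_in M" using coeffs_in_add[OF sM i'(2) j'(2)] by (simp only:)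
      moreover have "i' + j' \<in> I <+>\<^bsub>mpoly_ring V\<^esub> J" using i' j' by (auto simp: set_add_mpoly_ring)
      moreover have "i' + j' \<in> coeffs_in A" using coeffs_in_add[OF subring_submodule[OF A]] i' j' by blast
      ultimately show "\<exists>i\<in>(I <+>\<^bsub>mpoly_ring V\<^esub> J) \<inter> coeffs_in A. ?\<phi> h - i \<in> coeffs_in M" by blast
    qed
  qed (use S1 S2 S3 in auto)
qed

text \<open>The difference of two approximations of \<open>\<phi> h\<close>, one in I and one in J, lies in the sum of I and J and has
  coefficients in M. Decomposing it with coefficients in M corrects both to a common element.\<close>

lemma compatible_inter:
  fixes I J :: "('a::field) mpoly set"
  assumes V: "finite V" and mo: "monomial_order V lt"
    and I: "ideal I (mpoly_ring V)" "generically_compatible V E I"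
    and J: "ideal J (mpoly_ring V)" "generically_compatible V E J"
  shows "generically_compatible V E (I \<inter> J)"
proof -
  obtain S1 where S1: "finite S1" "\<forall>A M p N. frobenius_place A M p N \<longrightarrow> S1 \<union> inverse ` S1 \<subseteq> A \<longrightarrow>
    compatible_at V E I A M (p ^ N)" using I(2) unfolding generically_compatible_def by (elim exE conjE)
  obtain S2 where S2: "finite S2" "\<forall>A M p N. frobenius_place A M p N \<longrightarrow> S2 \<union> inverse ` S2 \<subseteq> A \<longrightarrow>
    compatible_at V E J A M (p ^ N)" using J(2) unfolding generically_compatible_def by (elim exE conjE)
  obtain S3 where S3: "finite S3"
    "\<forall>A N h. S3 \<subseteq> A \<longrightarrow> submodule A N \<longrightarrow> h \<in> I <+>\<^bsub>mpoly_ring V\<^esub> J \<longrightarrow> h \<in> coeffs_in N \<longrightarrow>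
       (\<exists>i\<in>I \<inter> coeffs_in N. \<exists>j\<in>J \<inter> coeffs_in N. h = i + j)"
    using sum_generic[OF V mo I(1) J(1)] by (elim exE conjE)
  show ?thesis
  proof (rule generically_compatibleI[of "S1 \<union> S2 \<union> S3"])
    fix A M p N
    assume pl: "frobenius_place A M p N" and SA: "S1 \<union> S2 \<union> S3 \<subseteq> A" "inverse ` (S1 \<union> S2 \<union> S3) \<subseteq> A"
    have A: "is_subring A" and sM: "submodule A M" and MA: "M \<subseteq> A"
      using pl by (auto simp: frobenius_place_def)
    let ?q = "p ^ N"
    let ?\<phi> = "\<lambda>h. frob_trace V ?q (E ^ (?q - 1) * h)"
    have cI: "compatible_at V E I A M ?q" using S1(2) pl SA by blast
    have cJ: "compatible_at V E J A M ?q" using S2(2) pl SA by blast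
    show "compatible_at V E (I \<inter> J) A M ?q"
      unfolding compatible_at_def
    proof
      fix h assume h: "h \<in> I \<inter> J \<inter> coeffs_in A"
      obtain i where i: "i \<in> I \<inter> coeffs_in A" "?\<phi> h - i \<in> coeffs_in M"
        using cI h unfolding compatible_at_def by blast
      obtain j where j: "j \<in> J \<inter> coeffs_in A" "?\<phi> h - j \<in> coeffs_in M"
        using cJ h unfolding compatible_at_def by blast
      have "(?\<phi> h - j) - (?\<phi> h - i) \<in> coeffs_in M" by (rule coeffs_in_diff[OF sM j(2) i(2)])
      then have "i + - j \<in> coeffs_in M" by simp
      moreover have "i + - j \<in> I <+>\<^bsub>mpoly_ring V\<^esub> J"
        using i j ideal_uminus[OF J(1)] unfolding set_add_mpoly_ring by blast
      ultimately have "\<exists>i'\<in>I \<inter> coeffs_in M. \<exists>j'\<in>J \<inter> coeffs_in M. i + - j = i' + j'"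
        using S3(2)[rule_format, OF _ sM] SA by blast
      then obtain i' j' where ij: "i' \<in> I \<inter> coeffs_in M" "j' \<in> J \<inter> coeffs_in M" "i - j = i' + j'" by auto
      have "i - i' = j + j'" using ij(3) by (simp add: algebra_simps)
      then have "i - i' \<in> I \<inter> J" using i j ij ideal_diff[OF I(1)] ideal_add[OF J(1)] by (metis IntD1 IntI)
      moreover have "i - i' \<in> coeffs_in A"
        using i ij coeffs_in_mono[OF MA] coeffs_in_diff[OF subring_submodule[OF A]] by blast
      moreover have "?\<phi> h - (i - i') \<in> coeffs_in M"
      proof -
        have "(?\<phi> h - i) + i' \<in> coeffs_in M" using coeffs_in_add[OF sM i(2)] ij(1) by blast
        then show ?thesis by (simp add: algebra_simps)
      qed
      ultimately show "\<exists>i\<in>I \<inter> J \<inter> coeffs_in A. ?\<phi> h - i \<in> coeffs_in M" by blast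
    qed
  qed (use S1 S2 S3 in auto)
qed

lemma ideal_colon:
  assumes I: "ideal I (mpoly_ring V)" and J: "J \<subseteq> polys V"
  shows "ideal (colon (mpoly_ring V) I J) (mpoly_ring V)"
  unfolding ideal_mpoly_ring_iff colon_def
  using I J by (auto simp: ideal_0 distrib_right mult.assoc intro: ideal_add ideal_mult)

lemma compatible_polys:
  fixes E :: "('a::field) mpoly"
  assumes V: "finite V" and E: "E \<in> polys V"
  shows "generically_compatible V E (polys V)"
proof (rule generically_compatibleI[of "coeff_set E"])
  fix A M p N
  assume pl: "frobenius_place A M p N" and SA: "coeff_set E \<subseteq> A"
  have A: "is_subring A" and sM: "submodule A M" and q: "0 < p ^ N"
    using pl by (auto simp: frobenius_place_def prime_gt_0_nat)
  have EA: "E \<in> coeffs_in A" using coeff_set_subset[OF SA] .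
  let ?\<phi> = "\<lambda>h. frob_trace V (p ^ N) (E ^ (p ^ N - 1) * h)"
  have "?\<phi> h \<in> polys V \<inter> coeffs_in A" if "h \<in> polys V \<inter> coeffs_in A" for h
    using that E EA subring_closed(4)[OF coeffs_in_subring[OF A]] subring_power[OF coeffs_in_subring[OF A]]
    by (auto intro!: frob_trace_polys[OF q V] frob_trace_coeffs_in[OF q V])
  moreover have "?\<phi> h - ?\<phi> h \<in> coeffs_in M" for h using coeffs_in_0[OF sM] by simp
  ultimately show "compatible_at V E (polys V) A M (p ^ N)"
    unfolding compatible_at_def by blast
qed simp

text \<open>Modulo M the trace is linear over q-th powers, so \<open>j \<phi>(h)\<close> is congruent to \<open>\<phi>(h j\<^bsup>q\<^esup>)\<close>, where \<open>h j\<^bsup>q\<^esup>\<close> lies in I.\<close>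

lemma compatible_colon_element:
  fixes I :: "('a::field) mpoly set"
  assumes V: "finite V" and mo: "monomial_order V lt" and E: "E \<in> polys V"
    and I: "ideal I (mpoly_ring V)" "generically_compatible V E I" and j: "j \<in> polys V"
  shows "generically_compatible V E (colon (mpoly_ring V) I {j})"
proof -
  obtain S1 where S1: "finite S1" "\<forall>A M p N. frobenius_place A M p N \<longrightarrow> S1 \<union> inverse ` S1 \<subseteq> A \<longrightarrow>
    compatible_at V E I A M (p ^ N)" using I(2) unfolding generically_compatible_def by (elim exE conjE)
  obtain S2 where S2: "finite S2" "\<forall>A N i r. S2 \<subseteq> A \<longrightarrow> submodule A N \<longrightarrow> i \<in> I \<longrightarrow> r \<in> polys V \<longrightarrow>
       i + r * j \<in> coeffs_in N \<longrightarrow>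
       (\<exists>i'\<in>I. \<exists>r'\<in>polys V \<inter> coeffs_in N. i + r * j = i' + r' * j)"
    using sum_principal_generic[OF V mo I(1) j] by (elim exE conjE)
  let ?S = "S1 \<union> S2 \<union> coeff_set j \<union> coeff_set E"
  show ?thesis
  proof (rule generically_compatibleI[of ?S])
    fix A M p N
    assume pl: "frobenius_place A M p N" and SA: "?S \<subseteq> A" "inverse ` ?S \<subseteq> A"
    have A: "is_subring A" and sM: "submodule A M" and MA: "M \<subseteq> A" and q: "0 < p ^ N"
      using pl by (auto simp: frobenius_place_def prime_gt_0_nat)
    let ?q = "p ^ N"
    let ?\<phi> = "\<lambda>h. frob_trace V ?q (E ^ (?q - 1) * h)"
    note cA = coeffs_in_subring[OF A]
    have cI: "compatible_at V E I A M ?q" using S1(2) pl SA by blast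
    have jA: "j \<in> coeffs_in A" and EA: "E \<in> coeffs_in A" using SA by (auto intro!: coeff_set_subset)
    show "compatible_at V E (colon (mpoly_ring V) I {j}) A M ?q"
      unfolding compatible_at_def
    proof
      fix h assume h: "h \<in> colon (mpoly_ring V) I {j} \<inter> coeffs_in A"
      then have hV: "h \<in> polys V" and hj: "h * j \<in> I" and hA: "h \<in> coeffs_in A" by (auto simp: colon_def)
      have EhA: "E ^ (?q - 1) * h \<in> coeffs_in A"
        using subring_closed(4)[OF cA subring_power[OF cA EA] hA] .
      have \<phi>h: "?\<phi> h \<in> polys V" "?\<phi> h \<in> coeffs_in A"
        by (rule frob_trace_polys[OF q V polys_mult[OF polys_power[OF E] hV]])
          (rule frob_trace_coeffs_in[OF q V EhA])
      have hjq: "h * j ^ ?q \<in> I \<inter> coeffs_in A"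
      proof
        obtain t where t: "?q = Suc t" using q by (cases ?q) auto
        have "h * j ^ ?q = j ^ t * (h * j)" unfolding t by (simp add: mult_ac)
        then show "h * j ^ ?q \<in> I" using ideal_mult[OF I(1) hj polys_power[OF j, of t]] by (simp only:)
        show "h * j ^ ?q \<in> coeffs_in A" using subring_closed(4)[OF cA hA subring_power[OF cA jA]] .
      qed
      then obtain i where i: "i \<in> I \<inter> coeffs_in A" "?\<phi> (h * j ^ ?q) - i \<in> coeffs_in M"
        using cI unfolding compatible_at_def by blast
      have "frob_trace V ?q (j ^ ?q * (E ^ (?q - 1) * h)) - j * ?\<phi> h \<in> coeffs_in M"
        by (rule frob_trace_power_mod[OF V pl _ EhA]) (use j jA in auto)
      moreover have "j ^ ?q * (E ^ (?q - 1) * h) = E ^ (?q - 1) * (h * j ^ ?q)" by (simp add: mult_ac)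
      ultimately have "?\<phi> (h * j ^ ?q) - j * ?\<phi> h \<in> coeffs_in M" by (simp only:)
      from coeffs_in_diff[OF sM i(2) this] have m: "- i + ?\<phi> h * j \<in> coeffs_in M" by (simp add: mult.commute)
      have "\<exists>i'\<in>I. \<exists>r'\<in>polys V \<inter> coeffs_in M. - i + ?\<phi> h * j = i' + r' * j"
        by (rule S2(2)[rule_format, OF _ sM _ \<phi>h(1) m]) (use SA i ideal_uminus[OF I(1)] in auto)
      then obtain i' r' where r': "i' \<in> I" "r' \<in> polys V \<inter> coeffs_in M" "- i + ?\<phi> h * j = i' + r' * j" by blast
      have "(?\<phi> h - r') * j = i' + i" using r'(3) by (simp add: algebra_simps)
      then have "(?\<phi> h - r') * j \<in> I" using ideal_add[OF I(1) r'(1)] i by simp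
      then have "?\<phi> h - r' \<in> colon (mpoly_ring V) I {j}" using \<phi>h r' by (auto simp: colon_def)
      moreover have "?\<phi> h - r' \<in> coeffs_in A"
        using \<phi>h r' coeffs_in_mono[OF MA] coeffs_in_diff[OF subring_submodule[OF A]] by blast
      moreover have "?\<phi> h - (?\<phi> h - r') \<in> coeffs_in M" using r' by simp
      ultimately show "\<exists>i\<in>colon (mpoly_ring V) I {j} \<inter> coeffs_in A. ?\<phi> h - i \<in> coeffs_in M" by blast
    qed
  qed (use S1 S2 in auto)
qed

lemma colon_idl:
  assumes I: "ideal I (mpoly_ring V)" and G: "finite G" "G \<subseteq> polys V"
  shows "colon (mpoly_ring V) I (idl V G) = {r \<in> polys V. \<forall>g\<in>G. r * g \<in> I}"
proof (intro equalityI subsetI)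
  fix r assume "r \<in> colon (mpoly_ring V) I (idl V G)"
  then show "r \<in> {r \<in> polys V. \<forall>g\<in>G. r * g \<in> I}"
    using idl_incl[OF G(2)] by (auto simp: colon_def)
next
  fix r assume r: "r \<in> {r \<in> polys V. \<forall>g\<in>G. r * g \<in> I}"
  have "r * j \<in> I" if j: "j \<in> idl V G" for j
  proof -
    obtain c where c: "\<forall>g\<in>G. c g \<in> polys V" "j = (\<Sum>g\<in>G. c g * g)"
      using idl_finite[OF G j] by blast
    have "r * j = (\<Sum>g\<in>G. c g * (r * g))" by (simp add: c(2) sum_distrib_left mult_ac)
    also have "\<dots> \<in> I"
    proof (rule ideal_sum[OF I])
      fix g assume "g \<in> G"
      then show "c g * (r * g) \<in> I" using c(1) r ideal_mult[OF I, of "r * g" "c g"] by blast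
    qed
    finally show ?thesis .
  qed
  then show "r \<in> colon (mpoly_ring V) I (idl V G)" using r by (auto simp: colon_def)
qed

lemma compatible_colon:
  fixes I :: "('a::field) mpoly set"
  assumes V: "finite V" and mo: "monomial_order V lt" and E: "E \<in> polys V"
    and I: "ideal I (mpoly_ring V)" "generically_compatible V E I" and J: "ideal J (mpoly_ring V)"
  shows "generically_compatible V E (colon (mpoly_ring V) I J)"
proof -
  obtain G where G: "finite G" "G \<subseteq> J" "J = idl V G" using ideal_finitely_generated[OF V mo J] .
  have GV: "G \<subseteq> polys V" using G ideal_subset[OF J] by blast
  let ?K = "\<lambda>G. {r \<in> polys V. \<forall>g\<in>G. r * g \<in> I}"
  have "ideal (?K G) (mpoly_ring V) \<and> generically_compatible V E (?K G)"
    using G(1) GV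
  proof (induction G)
    case empty
    then show ?case using compatible_polys[OF V E] ideal_polys by simp
  next
    case (insert g G)
    have g: "g \<in> polys V" using insert by simp
    have eq: "?K (insert g G) = colon (mpoly_ring V) I {g} \<inter> ?K G" by (auto simp: colon_def)
    have ig: "ideal (colon (mpoly_ring V) I {g}) (mpoly_ring V)" using ideal_colon[OF I(1)] g by simp
    have iK: "ideal (?K G) (mpoly_ring V)" "generically_compatible V E (?K G)" using insert by auto
    have "ideal (\<Inter>{colon (mpoly_ring V) I {g}, ?K G}) (mpoly_ring V)"
      by (rule ideal_Inter_polys) (use ig iK in auto)
    then show ?case unfolding eq
      using compatible_inter[OF V mo ig compatible_colon_element[OF V mo E I g] iK] by simp
  qed
  then show ?thesis unfolding G(3) colon_idl[OF I(1) G(1) GV] by blast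
qed

text \<open>For \<open>h = r f\<close> the product \<open>(e f)\<^bsup>q-1\<^esup> h\<close> is a multiple of \<open>f\<^bsup>q\<^esup>\<close>, from which the trace takes out a factor f.
  The factor e makes room for completing the leading monomial of f to the product of all variables.\<close>

lemma compatible_principal:
  fixes f :: "('a::field) mpoly"
  assumes V: "finite V" and mo: "monomial_order V lt" and f: "f \<in> polys V" and e: "e \<in> polys V"
  shows "generically_compatible V (e * f) (idl V {f})"
proof -
  have z: "ideal {0} (mpoly_ring V)" using ideal_idl[of "{}" V] by simp
  obtain S where S: "finite S" "\<forall>A N i r. S \<subseteq> A \<longrightarrow> submodule A N \<longrightarrow> i \<in> {0} \<longrightarrow> r \<in> polys V \<longrightarrow>
       i + r * f \<in> coeffs_in N \<longrightarrow>
       (\<exists>i'\<in>{0}. \<exists>r'\<in>polys V \<inter> coeffs_in N. i + r * f = i' + r' * f)"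
    using sum_principal_generic[OF V mo z f] by (elim exE conjE)
  let ?S = "S \<union> coeff_set f \<union> coeff_set e"
  show ?thesis
  proof (rule generically_compatibleI[of ?S])
    fix A M p N
    assume pl: "frobenius_place A M p N" and SA: "?S \<subseteq> A" "inverse ` ?S \<subseteq> A"
    have A: "is_subring A" and sM: "submodule A M" and q: "0 < p ^ N"
      using pl by (auto simp: frobenius_place_def prime_gt_0_nat)
    let ?q = "p ^ N"
    note cA = coeffs_in_subring[OF A]
    have fA: "f \<in> coeffs_in A" and eA: "e \<in> coeffs_in A" using SA by (auto intro!: coeff_set_subset)
    show "compatible_at V (e * f) (idl V {f}) A M ?q"
      unfolding compatible_at_def
    proof
      fix h assume h: "h \<in> idl V {f} \<inter> coeffs_in A"
      then obtain r where "r \<in> polys V" "h = r * f" using idl_singleton[OF f] by auto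
      then have "\<exists>i'\<in>{0}. \<exists>r'\<in>polys V \<inter> coeffs_in A. 0 + r * f = i' + r' * f"
        using S(2)[rule_format, of A A 0 r] SA subring_submodule[OF A] h by auto
      then obtain r' where r': "r' \<in> polys V" "r' \<in> coeffs_in A" "h = r' * f"
        using \<open>h = r * f\<close> by auto
      let ?g = "e ^ (?q - 1) * r'"
      have gA: "?g \<in> coeffs_in A"
        using subring_closed(4)[OF cA subring_power[OF cA eA] r'(2)] .
      have gV: "?g \<in> polys V" using e r' by auto
      obtain t where t: "?q = Suc t" using q by (cases ?q) auto
      have "(e * f) ^ (?q - 1) * h = f ^ ?q * ?g" by (simp add: t r'(3) power_mult_distrib mult_ac)
      moreover have "frob_trace V ?q (f ^ ?q * ?g) - f * frob_trace V ?q ?g \<in> coeffs_in M"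
        by (rule frob_trace_power_mod[OF V pl _ gA]) (use f fA in auto)
      moreover have "f * frob_trace V ?q ?g \<in> idl V {f}"
      proof -
        have "f \<in> idl V {f}" using idl_incl[of "{f}" V f] f by simp
        moreover have "ideal (idl V {f}) (mpoly_ring V)" using f by (intro ideal_idl) simp
        ultimately show ?thesis
          using ideal_mult[of "idl V {f}" V f "frob_trace V ?q ?g"] frob_trace_polys[OF q V gV]
          by (simp add: mult.commute)
      qed
      moreover have "f * frob_trace V ?q ?g \<in> coeffs_in A"
        using subring_closed(4)[OF cA fA frob_trace_coeffs_in[OF q V gA]] .
      ultimately show "\<exists>i\<in>idl V {f} \<inter> coeffs_in A. frob_trace V ?q ((e * f) ^ (?q - 1) * h) - i \<in> coeffs_in M"
        by auto
    qed
  qed (use S in auto)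
qed

lemma knutson_set_ideal:
  assumes "f \<in> polys V" "I \<in> knutson_set V f"
  shows "ideal I (mpoly_ring V)"
  using assms(2)
proof (induction rule: knutson_set.induct)
  case principal
  show ?case using assms(1) by (intro ideal_idl) simp
next
  case (colon I J)
  then show ?case using ideal_colon ideal_subset by blast
next
  case (sum I J)
  then show ?case using ideal_set_add by blast
next
  case (inter I J)
  have "ideal (\<Inter>{I, J}) (mpoly_ring V)"
    by (rule ideal_Inter_polys) (use inter in auto)
  then show ?case by simp
qed

lemma knutson_set_compatible:
  fixes f :: "('a::field) mpoly"
  assumes V: "finite V" and mo: "monomial_order V lt" and f: "f \<in> polys V" and e: "e \<in> polys V"
    and I: "I \<in> knutson_set V f"
  shows "generically_compatible V (e * f) I"
  using I
proof (induction rule: knutson_set.induct)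
  case principal
  show ?case by (rule compatible_principal[OF V mo f e])
next
  case (colon I J)
  show ?case
    by (rule compatible_colon[OF V mo polys_mult[OF e f] knutson_set_ideal[OF f colon.hyps(1)] colon.IH
          colon.hyps(2)])
next
  case (sum I J)
  show ?case
    by (rule compatible_sum[OF V mo knutson_set_ideal[OF f sum.hyps(1)] sum.IH(1)
          knutson_set_ideal[OF f sum.hyps(2)] sum.IH(2)])
next
  case (inter I J)
  show ?case
    by (rule compatible_inter[OF V mo knutson_set_ideal[OF f inter.hyps(1)] inter.IH(1)
          knutson_set_ideal[OF f inter.hyps(2)] inter.IH(2)])
qed

definition squarefree_part :: "monom \<Rightarrow> monom" where
  "squarefree_part u = (\<Sum>i\<in>keys u. single i 1)"

lemma lookup_squarefree_part: "lookup (squarefree_part u) i = (if i \<in> keys u then 1 else 0)"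
  by (simp add: squarefree_part_def lookup_sum lookup_single when_def)

text \<open>Knutson's theorem that the initial ideals are squarefree, in the weak form needed here. If \<open>x\<^bsup>u\<^esup>\<close> is
  the leading monomial of g and q is large, multiply g by a monomial to make \<open>x\<^bsup>qv\<^esup>\<close> its leading
  monomial, where \<open>x\<^bsup>v\<^esup>\<close> is the squarefree part of \<open>x\<^bsup>u\<^esup>\<close>. The leading monomial of
  \<open>E\<^bsup>q-1\<^esup> g\<close> is then the one that the trace maps to \<open>x\<^bsup>v\<^esup>\<close>, and its coefficient is
  a unit at the place.\<close>

theorem knutson_squarefree_initial:
  fixes f :: "('a::field) mpoly"
  assumes V: "finite V" and mo: "monomial_order V lt" and f: "f \<in> polys V"
    and lead: "is_lead lt e f" and sqf: "squarefree_monom e" and I: "I \<in> knutson_set V f"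
    and g: "g \<in> I" "is_lead lt u g"
  shows "\<exists>h\<in>I. lookup h (squarefree_part u) \<noteq> 0"
proof -
  note idI = knutson_set_ideal[OF f I]
  have gV: "g \<in> polys V" using ideal_subset[OF idI g(1)] .
  have eV: "e \<in> monoms V" and uV: "u \<in> monoms V" using is_lead_monoms lead f g gV by blast+
  define v where "v = squarefree_part u"
  have vV: "v \<in> monoms V" using uV by (auto simp: v_def monoms_def in_keys_iff lookup_squarefree_part split: if_splits)
  define e' where "e' = ones V - e"
  have ee: "e + e' = ones V"
    unfolding e'_def
  proof (rule monom_add_diff)
    fix i
    have "lookup e i = 0" if "i \<notin> V"
    proof -
      have "i \<notin> keys e" using eV that by (auto simp: monoms_def)
      then show ?thesis by (simp add: in_keys_iff)
    qed
    then show "lookup e i \<le> lookup (ones V) i" using sqf V by (auto simp: lookup_ones squarefree_monom_def)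
  qed
  have "e + e' \<in> monoms V" unfolding ee by simp
  then have e'V: "e' \<in> monoms V" by simp
  define E where "E = single e' 1 * f"
  have EV: "E \<in> polys V" using e'V f by (auto simp: E_def)
  have leadE: "is_lead lt (ones V) E"
  proof -
    have "is_lead lt (e' + e) (single e' 1 * f)"
      by (rule is_lead_mult[OF mo _ f _ lead]) (use e'V in \<open>auto simp: is_lead_def\<close>)
    then show ?thesis using ee by (simp add: E_def add.commute)
  qed
  have "generically_compatible V E I"
    unfolding E_def by (rule knutson_set_compatible[OF V mo f _ I]) (use e'V in simp)
  then obtain S where S: "finite S" "\<forall>A M p N. frobenius_place A M p N \<longrightarrow> S \<union> inverse ` S \<subseteq> A \<longrightarrow>
    compatible_at V E I A M (p ^ N)" unfolding generically_compatible_def by (elim exE conjE)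
  let ?S = "S \<union> coeff_set g \<union> coeff_set E"
  define t where "t = (\<Sum>i\<in>keys u. lookup u i)"
  have "finite ?S" using S(1) by simp
  from frobenius_place_exists[OF this, of t] obtain A M p N where
    pl: "frobenius_place A M p N" and SA: "?S \<subseteq> A" "inverse ` ?S \<subseteq> A" and tq: "t \<le> p ^ N" by blast
  define q where "q = p ^ N"
  have A: "is_subring A" and sM: "submodule A M" and M1: "1 \<notin> M" and q: "0 < q"
    using pl by (auto simp: frobenius_place_def prime_gt_0_nat q_def)
  have comp: "compatible_at V E I A M q" using S(2) pl SA unfolding q_def by blast
  have gA: "g \<in> coeffs_in A" using SA coeff_set_subset[of g A] by blast
  define w where "w = mscale q v - u"
  have uw: "u + w = mscale q v"
    unfolding w_def
  proof (rule monom_add_diff)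
    fix i
    show "lookup u i \<le> lookup (mscale q v) i"
    proof (cases "i \<in> keys u")
      case True
      then have "lookup u i \<le> t" unfolding t_def by (intro member_le_sum) auto
      then show ?thesis using tq True by (simp add: v_def lookup_squarefree_part q_def)
    next
      case False
      then show ?thesis by (simp add: in_keys_iff)
    qed
  qed
  have "u + w \<in> monoms V" unfolding uw using mscale_monoms[OF vV] .
  then have wV: "w \<in> monoms V" by simp
  define g' where "g' = single w 1 * g"
  have g'I: "g' \<in> I" using ideal_mult[OF idI g(1)] wV by (simp add: g'_def)
  have g'A: "g' \<in> coeffs_in A"
    unfolding g'_def by (rule coeffs_in_single_mult[OF subring_submodule[OF A] subring_closed(1)[OF A] gA])
  have lead': "is_lead lt (mscale q v) g'"
  proof -
    have "is_lead lt (w + u) (single w 1 * g)"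
      by (rule is_lead_mult[OF mo _ gV _ g(2)]) (use wV in \<open>auto simp: is_lead_def\<close>)
    then show ?thesis using uw by (simp add: g'_def add.commute)
  qed
  have powE: "is_lead lt (mscale n (ones V)) (E ^ n) \<and> lookup (E ^ n) (mscale n (ones V)) = lookup E (ones V) ^ n" for n
  proof (induction n)
    case 0
    show ?case by (simp add: is_lead_def lookup_one)
  next
    case (Suc n)
    have En: "E ^ n \<in> polys V" using EV by auto
    have "is_lead lt (ones V + mscale n (ones V)) (E * E ^ n)"
      using is_lead_mult[OF mo EV En leadE] Suc by blast
    moreover have "lookup (E * E ^ n) (ones V + mscale n (ones V)) = lookup E (ones V) * lookup (E ^ n) (mscale n (ones V))"
      by (rule lookup_mult_lead[OF mo EV En ones_monoms is_lead_le[OF leadE] mscale_monoms[OF ones_monoms]])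
        (use Suc is_lead_le in blast)+
    ultimately show ?case using Suc by simp
  qed
  define h where "h = E ^ (q - 1) * g'"
  have EqV: "E ^ (q - 1) \<in> polys V" using EV by auto
  have g'V: "g' \<in> polys V" using ideal_subset[OF idI g'I] .
  have "lookup h (mscale (q - 1) (ones V) + mscale q v)
      = lookup (E ^ (q - 1)) (mscale (q - 1) (ones V)) * lookup g' (mscale q v)"
    unfolding h_def
    by (rule lookup_mult_lead[OF mo EqV g'V mscale_monoms[OF ones_monoms] is_lead_le[OF conjunct1[OF powE]]
          mscale_monoms[OF vV] is_lead_le[OF lead']])
  moreover have "lookup g' (mscale q v) = lookup g u"
    using lookup_single_mult[of w 1 g u] uw by (simp add: g'_def add.commute)
  ultimately have coeff: "lookup (frob_trace V q h) v = lookup E (ones V) ^ (q - 1) * lookup g u"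
    using powE[of "q - 1"] by (simp add: lookup_frob_trace[OF q V] trace_exp_def add.commute)
  let ?c = "lookup E (ones V) ^ (q - 1) * lookup g u"
  have inv: "inverse (lookup E (ones V)) \<in> A" "inverse (lookup g u) \<in> A"
    using SA(2) leadE g(2) by (auto simp: coeff_set_def is_lead_def)
  have cM: "?c \<notin> M"
  proof
    assume "?c \<in> M"
    then have "inverse (lookup E (ones V)) ^ (q - 1) * inverse (lookup g u) * ?c \<in> M"
      using submodule_closed(5)[OF sM] subring_closed(4)[OF A subring_power[OF A inv(1)] inv(2)] by blast
    moreover have "inverse (lookup E (ones V)) ^ (q - 1) * inverse (lookup g u) * ?c = 1"
    proof -
      have "lookup E (ones V) \<noteq> 0" "lookup g u \<noteq> 0"
        using leadE g(2) by (auto simp: is_lead_def in_keys_iff)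
      then show ?thesis by (simp add: power_inverse field_simps)
    qed
    ultimately show False using M1 by simp
  qed
  obtain i where i: "i \<in> I \<inter> coeffs_in A" "frob_trace V q h - i \<in> coeffs_in M"
    using comp g'I g'A unfolding compatible_at_def h_def by blast
  have "lookup (frob_trace V q h - i) v \<in> M" using i(2) by (simp add: coeffs_in_def)
  then have "lookup i v \<noteq> 0" using cM coeff by (auto simp: lookup_minus)
  then show ?thesis using i(1) unfolding v_def by blast
qed

section \<open>Substitution homomorphisms\<close>

definition monom_eval :: "(nat \<Rightarrow> ('a::comm_ring_1) mpoly) \<Rightarrow> monom \<Rightarrow> 'a mpoly" where
  "monom_eval \<phi> m = (\<Prod>i\<in>keys m. \<phi> i ^ lookup m i)"

definition subst_mpoly :: "(nat \<Rightarrow> ('a::comm_ring_1) mpoly) \<Rightarrow> 'a mpoly \<Rightarrow> 'a mpoly" where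
  "subst_mpoly \<phi> p = (\<Sum>m\<in>keys p. single 0 (lookup p m) * monom_eval \<phi> m)"

lemma monom_eval_superset:
  assumes "finite A" "keys m \<subseteq> A"
  shows "monom_eval \<phi> m = (\<Prod>i\<in>A. \<phi> i ^ lookup m i)"
  unfolding monom_eval_def
  by (rule prod.mono_neutral_left) (use assms in \<open>auto simp: in_keys_iff\<close>)

lemma monom_eval_add: "monom_eval \<phi> (m + m') = monom_eval \<phi> m * monom_eval \<phi> m'"
proof -
  let ?A = "keys m \<union> keys m'"
  have "keys (m + m') \<subseteq> ?A" by (rule keys_add)
  then have "monom_eval \<phi> (m + m') = (\<Prod>i\<in>?A. \<phi> i ^ lookup (m + m') i)"
    by (intro monom_eval_superset) auto
  then show ?thesis
    using monom_eval_superset[of ?A m \<phi>] monom_eval_superset[of ?A m' \<phi>]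
    by (simp add: lookup_add power_add prod.distrib)
qed

lemma monom_eval_0 [simp]: "monom_eval \<phi> 0 = 1"
  by (simp add: monom_eval_def)

lemma monom_eval_single [simp]: "monom_eval \<phi> (single i n) = \<phi> i ^ n"
  by (simp add: monom_eval_def)

lemma subst_single: "subst_mpoly \<phi> (single m c) = single 0 c * monom_eval \<phi> m"
  by (simp add: subst_mpoly_def)

lemma subst_0 [simp]: "subst_mpoly \<phi> 0 = 0"
  by (simp add: subst_mpoly_def)

lemma subst_1 [simp]: "subst_mpoly \<phi> 1 = 1"
  using subst_single[of \<phi> 0 1] by simp

lemma subst_add: "subst_mpoly \<phi> (p + q) = subst_mpoly \<phi> p + subst_mpoly \<phi> q"
  unfolding subst_mpoly_def
  by (rule setsum_keys_plus_distrib) (simp_all add: single_add distrib_right)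

lemma subst_uminus: "subst_mpoly \<phi> (- p) = - subst_mpoly \<phi> p"
  using subst_add[of \<phi> p "- p"] by (simp add: eq_neg_iff_add_eq_0 add.commute)

lemma subst_diff: "subst_mpoly \<phi> (p - q) = subst_mpoly \<phi> p - subst_mpoly \<phi> q"
  using subst_add[of \<phi> p "- q"] by (simp add: subst_uminus)

lemma subst_sum: "subst_mpoly \<phi> (sum f A) = (\<Sum>i\<in>A. subst_mpoly \<phi> (f i))"
  by (induction A rule: infinite_finite_induct) (simp_all add: subst_add)

lemma subst_mult:
  fixes p q :: "('a::comm_ring_1) mpoly"
  shows "subst_mpoly \<phi> (p * q) = subst_mpoly \<phi> p * subst_mpoly \<phi> q"
proof (induction p rule: mpoly_additive_induct)
  case (add m r)
  have "subst_mpoly \<phi> (single m c * q) = subst_mpoly \<phi> (single m c) * subst_mpoly \<phi> q" for c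
  proof (induction q rule: mpoly_additive_induct)
    case (add n s)
    let ?d = "lookup q n"
    have "subst_mpoly \<phi> (single m c * single n ?d)
        = single 0 (c * ?d) * (monom_eval \<phi> m * monom_eval \<phi> n)"
      by (simp only: mult_single[of m c n ?d] subst_single monom_eval_add)
    also have "single 0 (c * ?d) = (single 0 c * single 0 ?d :: 'a mpoly)"
      by (simp add: mult_single)
    also have "\<dots> * (monom_eval \<phi> m * monom_eval \<phi> n)
        = subst_mpoly \<phi> (single m c) * subst_mpoly \<phi> (single n ?d)"
      by (simp only: subst_single mult_ac)
    finally have "subst_mpoly \<phi> (single m c * single n ?d)
        = subst_mpoly \<phi> (single m c) * subst_mpoly \<phi> (single n ?d)" .
    then show ?case using add.IH by (simp add: distrib_left subst_add)
  qed simp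
  then show ?case using add by (simp add: distrib_right subst_add)
qed simp

lemma subst_power: "subst_mpoly \<phi> (p ^ n) = subst_mpoly \<phi> p ^ n"
  by (induction n) (simp_all add: subst_mult)

lemma subst_prod: "subst_mpoly \<phi> (prod f A) = (\<Prod>i\<in>A. subst_mpoly \<phi> (f i))"
  by (induction A rule: infinite_finite_induct) (simp_all add: subst_mult)

lemma subst_Var [simp]: "subst_mpoly \<phi> (Var i) = \<phi> i"
  by (simp add: Var_def subst_single)

lemma subst_const [simp]: "subst_mpoly \<phi> (single 0 c) = single 0 c"
  by (simp add: subst_single)

lemma monom_eval_Var: "monom_eval Var m = single m (1 :: 'a::comm_ring_1)"
proof -
  have p: "Var i ^ n = (single (single i n) 1 :: 'a mpoly)" for i n
    by (induction n) (simp_all add: Var_def mult_single flip: single_add)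
  have "monom_eval Var m = single (\<Sum>i\<in>A. single i (lookup m i)) (1 :: 'a)" if "A = keys m" for A
  proof -
    have "(\<Prod>i\<in>B. Var i ^ lookup m i) = single (\<Sum>i\<in>B. single i (lookup m i)) (1 :: 'a)" if "finite B" for B
      using that by (induction B) (simp_all add: p mult_single)
    then show ?thesis using that by (simp add: monom_eval_def)
  qed
  moreover have "(\<Sum>i\<in>keys m. single i (lookup m i)) = m"
    by (rule poly_mapping_eqI) (simp add: lookup_sum lookup_single when_def not_in_keys_iff_lookup_eq_zero)
  ultimately show ?thesis by simp
qed

lemma subst_Var_id: "subst_mpoly Var p = p"
  unfolding subst_mpoly_def monom_eval_Var
  by (subst (3) mpoly_eq_sum_monomials[of p]) (simp add: mult_single)

lemma monom_eval_cong: "m \<in> monoms V \<Longrightarrow> (\<And>i. i \<in> V \<Longrightarrow> \<phi> i = \<psi> i) \<Longrightarrow> monom_eval \<phi> m = monom_eval \<psi> m"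
  unfolding monom_eval_def monoms_def by (intro prod.cong) auto

lemma subst_cong:
  "p \<in> polys V \<Longrightarrow> (\<And>i. i \<in> V \<Longrightarrow> \<phi> i = \<psi> i) \<Longrightarrow> subst_mpoly \<phi> p = subst_mpoly \<psi> p"
  unfolding subst_mpoly_def polys_iff
  by (intro sum.cong) (auto intro!: arg_cong2[of _ _ _ _ "(*)"] monom_eval_cong[of _ V])

lemma subst_subst: "subst_mpoly \<psi> (subst_mpoly \<phi> p) = subst_mpoly (\<lambda>i. subst_mpoly \<psi> (\<phi> i)) p"
  unfolding subst_mpoly_def[of \<phi>] subst_mpoly_def[of "\<lambda>i. subst_mpoly \<psi> (\<phi> i)"] subst_sum
  by (intro sum.cong) (simp_all add: subst_mult monom_eval_def subst_prod subst_power)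

lemma Var_polys [simp]: "i \<in> V \<Longrightarrow> Var i \<in> polys V"
  by (simp add: Var_def)

lemma const_polys [simp]: "single 0 c \<in> polys V"
  by simp

lemma subst_polys:
  assumes "p \<in> polys V" "\<And>i. i \<in> V \<Longrightarrow> \<phi> i \<in> polys W"
  shows "subst_mpoly \<phi> p \<in> polys W"
proof -
  have "\<phi> i \<in> polys W" if "m \<in> keys p" "i \<in> keys m" for m i
  proof -
    have "i \<in> V" using that assms(1) by (auto simp: polys_iff monoms_def)
    then show ?thesis by (rule assms(2))
  qed
  then show ?thesis
    unfolding subst_mpoly_def monom_eval_def
    by (intro polys_sum polys_mult const_polys polys_prod polys_power) blast
qed

lemma prod_diff_mem_ideal:
  fixes a b :: "'i \<Rightarrow> ('a::comm_ring_1) mpoly"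
  assumes I: "ideal I (mpoly_ring V)" and "finite A"
    and "\<And>i. i \<in> A \<Longrightarrow> a i \<in> polys V \<and> b i \<in> polys V \<and> a i - b i \<in> I"
  shows "prod a A - prod b A \<in> I"
  using assms(2,3)
proof (induction A)
  case empty
  then show ?case using ideal_0[OF I] by simp
next
  case (insert x A)
  have eq: "prod a (insert x A) - prod b (insert x A)
      = a x * (prod a A - prod b A) + prod b A * (a x - b x)"
    using insert.hyps by (simp add: algebra_simps)
  have "prod b A \<in> polys V" using insert.prems by (intro polys_prod) auto
  then show ?case unfolding eq
    using insert by (intro ideal_add[OF I] ideal_mult[OF I]) auto
qed

lemma polys_subring: "is_subring (polys V)"
  by (auto simp: is_subring_def)

lemma ideal_submodule: "ideal I (mpoly_ring V) \<Longrightarrow> submodule (polys V) I"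
  by (auto simp: submodule_def ideal_0 ideal_add ideal_uminus ideal_mult)

text \<open>Products of congruent factors are congruent, so that only the images of the variables matter.\<close>

lemma subst_diff_mem_ideal:
  fixes I :: "('a::comm_ring_1) mpoly set"
  assumes I: "ideal I (mpoly_ring V)" and p: "p \<in> polys V"
    and \<phi>: "\<And>i. i \<in> V \<Longrightarrow> \<phi> i \<in> polys V \<and> \<phi> i - Var i \<in> I"
  shows "subst_mpoly \<phi> p - p \<in> I"
proof -
  have "monom_eval \<phi> m - monom_eval Var m \<in> I" if m: "m \<in> monoms V" for m
    unfolding monom_eval_def
  proof (rule prod_diff_mem_ideal[OF I])
    fix i assume "i \<in> keys m"
    then have i: "i \<in> V" using m by (auto simp: monoms_def)
    show "\<phi> i ^ lookup m i \<in> polys V \<and> Var i ^ lookup m i \<in> polys V \<and> \<phi> i ^ lookup m i - Var i ^ lookup m i \<in> I"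
      using \<phi>[OF i] i submodule_power_diff[OF polys_subring ideal_submodule[OF I], of "\<phi> i" "Var i"]
      by (auto intro: polys_power)
  qed simp
  then have "(\<Sum>m\<in>keys p. single 0 (lookup p m) * (monom_eval \<phi> m - monom_eval Var m)) \<in> I"
    using p by (intro ideal_sum[OF I] ideal_mult[OF I]) (auto simp: polys_iff)
  then have "subst_mpoly \<phi> p - subst_mpoly Var p \<in> I"
    by (simp add: subst_mpoly_def right_diff_distrib sum_subtractf)
  then show ?thesis by (simp add: subst_Var_id)
qed

section \<open>Degrees and linear forms\<close>

definition mdeg :: "monom \<Rightarrow> nat" where
  "mdeg m = (\<Sum>i\<in>keys m. lookup m i)"

lemma mdeg_add: "mdeg (m + m') = mdeg m + mdeg m'"
  unfolding mdeg_def by (rule setsum_keys_plus_distrib) simp_all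

lemma mdeg_0 [simp]: "mdeg 0 = 0" and mdeg_single [simp]: "mdeg (single i n) = n"
  by (simp_all add: mdeg_def)

lemma mdeg_eq_0_iff [simp]: "mdeg m = 0 \<longleftrightarrow> m = 0"
proof
  assume "mdeg m = 0"
  then have "lookup m i = 0" for i
    by (cases "i \<in> keys m") (auto simp: mdeg_def not_in_keys_iff_lookup_eq_zero)
  then show "m = 0" by (intro poly_mapping_eqI) simp
qed simp

definition hcomp :: "nat \<Rightarrow> ('a::comm_ring_1) mpoly \<Rightarrow> 'a mpoly" where
  "hcomp e p = Poly_Mapping.mapp (\<lambda>m c. if mdeg m = e then c else 0) p"

lemma lookup_hcomp: "lookup (hcomp e p) m = (if mdeg m = e then lookup p m else 0)"
  by (simp add: hcomp_def lookup_mapp in_keys_iff when_def)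

lemma hcomp_0 [simp]: "hcomp e 0 = 0"
  by (intro poly_mapping_eqI) (simp add: lookup_hcomp)

lemma hcomp_add: "hcomp e (p + q) = hcomp e p + hcomp e q"
  by (intro poly_mapping_eqI) (simp add: lookup_hcomp lookup_add)

lemma hcomp_sum: "hcomp e (sum f A) = (\<Sum>i\<in>A. hcomp e (f i))"
  by (induction A rule: infinite_finite_induct) (simp_all add: hcomp_add)

lemma hcomp_polys: "p \<in> polys V \<Longrightarrow> hcomp e p \<in> polys V"
  by (auto simp: polys_iff in_keys_iff lookup_hcomp split: if_splits)

definition homogeneous :: "nat \<Rightarrow> ('a::comm_ring_1) mpoly \<Rightarrow> bool" where
  "homogeneous e p \<longleftrightarrow> (\<forall>m\<in>keys p. mdeg m = e)"

lemma homogeneous_hcomp: "homogeneous e (hcomp e p)"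
  by (auto simp: homogeneous_def in_keys_iff lookup_hcomp split: if_splits)

lemma hcomp_homogeneous: "homogeneous d p \<Longrightarrow> hcomp e p = (if e = d then p else 0)"
  by (intro poly_mapping_eqI) (auto simp: lookup_hcomp homogeneous_def in_keys_iff)

lemma homogeneous_mult: "homogeneous d p \<Longrightarrow> homogeneous e q \<Longrightarrow> homogeneous (d + e) (p * q)"
  using keys_mult[of p q] by (fastforce simp: homogeneous_def mdeg_add)

lemma homogeneous_linear_form: "L \<in> linear_forms V \<Longrightarrow> homogeneous 1 L"
  by (auto simp: linear_forms_def homogeneous_def)

lemma homogeneous_prod:
  "finite A \<Longrightarrow> (\<And>i. i \<in> A \<Longrightarrow> homogeneous 1 (f i)) \<Longrightarrow> homogeneous (card A) (prod f A)"
proof (induction A rule: finite_induct)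
  case empty
  then show ?case by (simp add: homogeneous_def)
next
  case (insert x A)
  then show ?case using homogeneous_mult[of 1 "f x" "card A" "prod f A"] by simp
qed

lemma hcomp_mult_homogeneous:
  fixes p L :: "('a::comm_ring_1) mpoly"
  assumes L: "homogeneous d L"
  shows "hcomp (e + d) (p * L) = hcomp e p * L"
proof (induction p rule: mpoly_additive_induct)
  case (add m r)
  have s: "homogeneous (mdeg m) (single m (lookup p m))" by (auto simp: homogeneous_def)
  have "hcomp (e + d) (single m (lookup p m) * L) = hcomp e (single m (lookup p m)) * L"
    using hcomp_homogeneous[OF homogeneous_mult[OF s L], of "e + d"] hcomp_homogeneous[OF s, of e] by simp
  then show ?case using add by (simp add: distrib_right hcomp_add)
qed simp

lemma hcomp_mult_homogeneous_less:
  fixes p L :: "('a::comm_ring_1) mpoly"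
  assumes L: "homogeneous d L" and e: "e < d"
  shows "hcomp e (p * L) = 0"
proof (induction p rule: mpoly_additive_induct)
  case (add m r)
  have s: "homogeneous (mdeg m) (single m (lookup p m))" by (auto simp: homogeneous_def)
  show ?case using add hcomp_homogeneous[OF homogeneous_mult[OF s L], of e] e
    by (simp add: distrib_right hcomp_add)
qed simp

lemma linear_forms_polys: "L \<in> linear_forms V \<Longrightarrow> L \<in> polys V"
  by (fastforce simp: linear_forms_def polys_iff)

lemma linear_forms_subset_polys: "F \<subseteq> linear_forms V \<Longrightarrow> F \<subseteq> polys V"
  using linear_forms_polys by blast

lemma linear_forms_mono: "V \<subseteq> W \<Longrightarrow> L \<in> linear_forms V \<Longrightarrow> L \<in> linear_forms W"
  by (fastforce simp: linear_forms_def)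

lemma linear_forms_diff: "L \<in> linear_forms V \<Longrightarrow> L' \<in> linear_forms V \<Longrightarrow> L - L' \<in> linear_forms V"
  using keys_diff[of L L'] by (fastforce simp: linear_forms_def)

lemma lookup_const_mult [simp]:
  fixes p :: "('a::comm_ring_1) mpoly"
  shows "lookup (single 0 c * p) m = c * lookup p m"
  using lookup_single_mult[of 0 c p m] by simp

lemma linear_forms_scale: "L \<in> linear_forms V \<Longrightarrow> single 0 c * L \<in> linear_forms V"
  by (auto simp: linear_forms_def in_keys_iff)

lemma linear_forms_Diff_iff:
  "L \<in> linear_forms (V - {y}) \<longleftrightarrow> L \<in> linear_forms V \<and> lookup L (single y 1) = 0"
proof
  assume L: "L \<in> linear_forms (V - {y})"
  have "single y 1 \<notin> keys L"
  proof
    assume "single y (1 :: nat) \<in> keys L"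
    then obtain i where "i \<in> V - {y}" "single y (1 :: nat) = single i 1"
      using L by (auto simp: linear_forms_def)
    then have "lookup (single y (1 :: nat)) i = 1" "y \<noteq> i" by auto
    then show False by (simp add: lookup_single when_def)
  qed
  then show "L \<in> linear_forms V \<and> lookup L (single y 1) = 0"
    using linear_forms_mono[OF _ L, of V] by (auto simp: in_keys_iff)
next
  assume L: "L \<in> linear_forms V \<and> lookup L (single y 1) = 0"
  show "L \<in> linear_forms (V - {y})"
    unfolding linear_forms_def
  proof (intro CollectI ballI)
    fix m assume m: "m \<in> keys L"
    then obtain i where i: "i \<in> V" "m = single i 1" using L unfolding linear_forms_def by blast
    have "i \<noteq> y" using m i L by (auto simp: in_keys_iff)
    then show "\<exists>i\<in>V - {y}. m = single i 1" using i by blast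
  qed
qed

lemma linear_form_has_variable:
  assumes "L \<in> linear_forms V" "L \<noteq> 0"
  obtains y where "y \<in> V" "lookup L (single y 1) \<noteq> 0"
proof -
  have "keys L \<noteq> {}" using assms(2) by simp
  then obtain m where m: "m \<in> keys L" by blast
  then obtain i where "i \<in> V" "m = single i 1" using assms(1) unfolding linear_forms_def by blast
  then show thesis using that m by (simp add: in_keys_iff)
qed

lemma linear_ideal_homogeneous:
  assumes F: "finite F" "F \<subseteq> linear_forms V" and x: "x \<in> idl V F"
  shows "hcomp e x \<in> idl V F"
proof -
  note FV = linear_forms_subset_polys[OF F(2)]
  obtain q where q: "\<forall>g\<in>F. q g \<in> polys V" "x = (\<Sum>g\<in>F. q g * g)"
    using idl_finite[OF F(1) FV x] by blast
  show ?thesis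
  proof (cases e)
    case 0
    have "hcomp e (q g * g) = 0" if "g \<in> F" for g
      using hcomp_mult_homogeneous_less[OF homogeneous_linear_form] that F 0 by blast
    then show ?thesis using ideal_0[OF ideal_idl[OF FV]] by (simp add: q(2) hcomp_sum)
  next
    case (Suc e')
    have "hcomp e (q g * g) = hcomp e' (q g) * g" if "g \<in> F" for g
      using hcomp_mult_homogeneous[OF homogeneous_linear_form, of g V e' "q g"] that F Suc by auto
    then have e: "hcomp e x = (\<Sum>g\<in>F. hcomp e' (q g) * g)" by (simp add: q(2) hcomp_sum)
    show ?thesis
      unfolding e using q(1) idl_incl[OF FV] hcomp_polys
      by (intro ideal_sum[OF ideal_idl[OF FV]] ideal_mult[OF ideal_idl[OF FV]]) blast+
  qed
qed

definition lin_indep :: "('a::comm_ring_1) mpoly set \<Rightarrow> bool" where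
  "lin_indep F \<longleftrightarrow> (\<forall>u. (\<Sum>g\<in>F. single 0 (u g) * g) = 0 \<longrightarrow> (\<forall>g\<in>F. u g = 0))"

lemma lin_indep_iff_independent:
  fixes F :: "('a::field) mpoly set"
  assumes "finite F"
  shows "lin_indep F \<longleftrightarrow> \<not> module.dependent scale_mpoly F"
proof -
  interpret vector_space "scale_mpoly :: 'a \<Rightarrow> 'a mpoly \<Rightarrow> 'a mpoly" by (rule vector_space_scale_mpoly)
  show ?thesis unfolding dependent_finite[OF assms] lin_indep_def scale_mpoly_def by blast
qed

text \<open>The component of degree 1 of a combination of F with polynomial coefficients is a combination with
  constant ones.\<close>

lemma linear_form_notin_ideal:
  assumes F: "finite F" "insert L F \<subseteq> linear_forms V" "L \<notin> F" and ind: "lin_indep (insert L F)"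
  shows "(L :: ('a::field) mpoly) \<notin> idl V F"
proof
  assume L: "L \<in> idl V F"
  have FV: "F \<subseteq> polys V" using linear_forms_subset_polys F by blast
  obtain q where q: "\<forall>g\<in>F. q g \<in> polys V" "L = (\<Sum>g\<in>F. q g * g)"
    using idl_finite[OF F(1) FV L] by blast
  have h0: "hcomp 0 p = single 0 (lookup p 0)" for p :: "'a mpoly"
    by (rule poly_mapping_eqI) (simp add: lookup_hcomp lookup_single when_def)
  have "L = hcomp 1 L" using hcomp_homogeneous[OF homogeneous_linear_form[of L V], of 1] F by simp
  also have "\<dots> = (\<Sum>g\<in>F. hcomp 1 (q g * g))" by (subst q(2)) (simp add: hcomp_sum)
  also have "\<dots> = (\<Sum>g\<in>F. single 0 (lookup (q g) 0) * g)"
  proof (rule sum.cong)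
    fix g assume "g \<in> F"
    then have "homogeneous 1 g" using homogeneous_linear_form F by blast
    from hcomp_mult_homogeneous[OF this, of 0 "q g"]
    show "hcomp 1 (q g * g) = single 0 (lookup (q g) 0) * g" by (simp add: h0)
  qed simp
  finally have e: "L = (\<Sum>g\<in>F. single 0 (lookup (q g) 0) * g)" .
  define u where "u = (\<lambda>g. if g = L then - 1 else lookup (q g) 0)"
  have "(\<Sum>g\<in>F. single 0 (u g) * g) = (\<Sum>g\<in>F. single 0 (lookup (q g) 0) * g)"
    using F(3) by (intro sum.cong) (auto simp: u_def)
  then have "(\<Sum>g\<in>insert L F. single 0 (u g) * g) = 0"
    using F(1,3) e[symmetric] by (simp add: u_def single_uminus)
  then have "u L = 0" using ind unfolding lin_indep_def by blast
  then show False by (simp add: u_def)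
qed

section \<open>Triangular sets of linear forms\<close>

text \<open>Each step adds a form with a new pivot. The forms of F live in the polynomial ring without the pivot, as
  the ideals of a vertex decomposition do.\<close>

inductive triangular :: "nat set \<Rightarrow> ('a::comm_ring_1) mpoly set \<Rightarrow> bool" where
  empty: "triangular V {}"
| insert: "y \<in> V \<Longrightarrow> triangular (V - {y}) F \<Longrightarrow> M \<in> linear_forms V \<Longrightarrow>
    lookup M (single y 1) \<noteq> 0 \<Longrightarrow> triangular V (insert M F)"

lemma triangular_linear_forms: "triangular V F \<Longrightarrow> finite F \<and> F \<subseteq> linear_forms V"
proof (induction rule: triangular.induct)
  case (insert y V F M)
  then show ?case using linear_forms_mono[of "V - {y}" V] by auto
qed simp

lemma triangular_mono: "triangular V F \<Longrightarrow> V \<subseteq> W \<Longrightarrow> triangular W F"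
proof (induction arbitrary: W rule: triangular.induct)
  case (insert y V F M)
  then have "triangular (W - {y}) F" by blast
  then show ?case using insert linear_forms_mono[of V W M] by (intro triangular.insert[of y]) auto
qed (rule triangular.empty)

lemma triangular_step_notin:
  assumes "triangular (V - {y}) F" "lookup M (single y 1) \<noteq> 0"
  shows "M \<notin> F"
  using triangular_linear_forms[OF assms(1)] assms(2) linear_forms_Diff_iff[of M V y] by blast

lemma triangular_subset: "triangular V F \<Longrightarrow> J \<subseteq> F \<Longrightarrow> triangular V J"
proof (induction arbitrary: J rule: triangular.induct)
  case (empty V)
  then show ?case by (simp add: triangular.empty)
next
  case (insert y V F M)
  show ?case
  proof (cases "M \<in> J")
    case True
    have "triangular (V - {y}) (J - {M})" using insert by blast
    then have "triangular V (insert M (J - {M}))" using insert by (intro triangular.insert[of y])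
    then show ?thesis using True by (simp add: insert_absorb)
  next
    case False
    then have "triangular (V - {y}) J" using insert by blast
    then show ?thesis by (rule triangular_mono) blast
  qed
qed

lemma idl_extend_vars:
  assumes "W \<subseteq> V" "B \<subseteq> polys W"
  shows "idl W B \<subseteq> idl V B"
proof -
  have BV: "B \<subseteq> polys V" using assms polys_mono by blast
  have i: "ideal (idl V B) (mpoly_ring V)" by (rule ideal_idl[OF BV])
  have "ideal (idl V B \<inter> polys W) (mpoly_ring W)"
    unfolding ideal_mpoly_ring_iff
  proof (intro conjI ballI)
    show "0 \<in> idl V B \<inter> polys W" using ideal_0[OF i] by simp
  next
    fix a b assume "a \<in> idl V B \<inter> polys W" "b \<in> idl V B \<inter> polys W"
    then show "a + b \<in> idl V B \<inter> polys W" using ideal_add[OF i] by auto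
  next
    fix r a :: "'a mpoly" assume "r \<in> polys W" "a \<in> idl V B \<inter> polys W"
    then show "r * a \<in> idl V B \<inter> polys W" using ideal_mult[OF i] polys_mono[OF assms(1)] by auto
  qed simp
  then show ?thesis using idl_least[of "idl V B \<inter> polys W" W B] idl_incl[OF BV] assms by blast
qed

lemma idl_eq_extend_vars:
  assumes "W \<subseteq> V" "A \<subseteq> polys W" "B \<subseteq> polys W" "idl W A = idl W B"
  shows "idl V A = idl V B"
proof -
  have AV: "A \<subseteq> polys V" and BV: "B \<subseteq> polys V"
    using assms(2,3) polys_mono[OF assms(1)] by auto
  have "A \<subseteq> idl W A" "B \<subseteq> idl W B" using idl_incl assms(2,3) by auto
  then have "A \<subseteq> idl V B" "B \<subseteq> idl V A"
    using idl_extend_vars[OF assms(1,2)] idl_extend_vars[OF assms(1,3)] assms(4) by auto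
  then show ?thesis using idl_least[OF ideal_idl[OF AV]] idl_least[OF ideal_idl[OF BV]] by blast
qed

text \<open>Gaussian elimination: the pivot y is removed from all other forms, whose ideal in the
  remaining variables is treated in the same way.\<close>

lemma echelon_form:
  fixes F :: "('a::field) mpoly set"
  assumes "finite F" "F \<subseteq> linear_forms V" "lin_indep F"
  shows "\<exists>F'. triangular V F' \<and> card F' = card F \<and> idl V F' = idl V F"
  using assms
proof (induction "card F" arbitrary: F V)
  case 0
  then have "F = {}" by simp
  then show ?case using triangular.empty by blast
next
  case (Suc n)
  then have "F \<noteq> {}" by auto
  then obtain M where M: "M \<in> F" by blast
  define F0 where "F0 = F - {M}"
  have F: "F = insert M F0" "M \<notin> F0" "finite F0" using M Suc.prems by (auto simp: F0_def)
  have Mlin: "M \<in> linear_forms V" using M Suc.prems by blast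
  have ind: "\<And>u g. (\<Sum>g\<in>F. single 0 (u g) * g) = 0 \<Longrightarrow> g \<in> F \<Longrightarrow> u g = 0"
    using Suc.prems(3) unfolding lin_indep_def by blast
  have "M \<noteq> 0"
  proof
    assume "M = 0"
    define u :: "'a mpoly \<Rightarrow> 'a" where "u = (\<lambda>g. if g = M then 1 else 0)"
    have "(\<Sum>g\<in>F. single 0 (u g) * g) = 0"
      using \<open>M = 0\<close> by (intro sum.neutral) (auto simp: u_def)
    from ind[OF this M] show False by (simp add: u_def)
  qed
  then obtain y where y: "y \<in> V" "lookup M (single y 1) \<noteq> 0" using linear_form_has_variable[OF Mlin] by blast
  define c where "c = (\<lambda>g :: 'a mpoly. lookup g (single y 1) / lookup M (single y 1))"
  define \<tau> where "\<tau> = (\<lambda>g. g - single 0 (c g) * M)"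
  have \<tau>L: "\<tau> g \<in> linear_forms (V - {y})" if "g \<in> linear_forms V" for g
    unfolding linear_forms_Diff_iff
    using linear_forms_diff[OF that linear_forms_scale[OF Mlin]] y by (simp add: \<tau>_def lookup_minus c_def)
  \<comment> \<open>A relation between the reduced forms is one between the original forms.\<close>
  have rel: "\<forall>g\<in>F0. u g = 0" if "(\<Sum>g\<in>F0. single 0 (u g) * \<tau> g) = 0" for u
  proof -
    define w where "w = (\<lambda>g. if g = M then - (\<Sum>g\<in>F0. u g * c g) else u g)"
    have "(\<Sum>g\<in>F0. single 0 (w g) * g) = (\<Sum>g\<in>F0. single 0 (u g) * g)"
      using F(2) by (intro sum.cong) (auto simp: w_def)
    then have "(\<Sum>g\<in>F. single 0 (w g) * g)
        = single 0 (- (\<Sum>g\<in>F0. u g * c g)) * M + (\<Sum>g\<in>F0. single 0 (u g) * g)"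
      using F by (simp add: w_def)
    also have "\<dots> = (\<Sum>g\<in>F0. single 0 (u g) * \<tau> g)"
    proof -
      have s: "single 0 (sum f A) = (\<Sum>g\<in>A. single 0 (f g) :: 'a mpoly)" for f :: "'a mpoly \<Rightarrow> 'a" and A
        by (induction A rule: infinite_finite_induct) (simp_all add: single_add)
      have m: "single 0 (a * b) = (single 0 a * single 0 b :: 'a mpoly)" for a b
        by (simp add: mult_single)
      show ?thesis
        by (simp add: \<tau>_def right_diff_distrib sum_subtractf single_uminus s m sum_distrib_right mult.assoc)
    qed
    also have "\<dots> = 0" by (rule that)
    finally have w: "(\<Sum>g\<in>F. single 0 (w g) * g) = 0" .
    show ?thesis
    proof
      fix g assume g: "g \<in> F0"
      then have "w g = 0" using ind[OF w, of g] F(1) by simp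
      moreover have "g \<noteq> M" using g F(2) by blast
      ultimately show "u g = 0" by (simp add: w_def)
    qed
  qed
  have inj: "inj_on \<tau> F0"
  proof (rule inj_onI, rule ccontr)
    fix g h assume gh: "g \<in> F0" "h \<in> F0" "\<tau> g = \<tau> h" "g \<noteq> h"
    define u :: "'a mpoly \<Rightarrow> 'a" where "u = (\<lambda>x. if x = g then 1 else if x = h then - 1 else 0)"
    have "(\<Sum>x\<in>F0. single 0 (u x) * \<tau> x) = (\<Sum>x\<in>{g, h}. single 0 (u x) * \<tau> x)"
      by (rule sum.mono_neutral_right) (use F gh in \<open>auto simp: u_def\<close>)
    also have "\<dots> = 0" using gh by (simp add: u_def single_uminus)
    finally have "u g = 0" using rel gh(1) by blast
    then show False by (simp add: u_def)
  qed
  have ind': "lin_indep (\<tau> ` F0)"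
    unfolding lin_indep_def
  proof (intro allI impI)
    fix u assume "(\<Sum>g\<in>\<tau> ` F0. single 0 (u g) * g) = 0"
    then have "(\<Sum>g\<in>F0. single 0 ((u \<circ> \<tau>) g) * \<tau> g) = 0"
      by (subst (asm) sum.reindex[OF inj]) (simp add: o_def)
    from rel[OF this] show "\<forall>g\<in>\<tau> ` F0. u g = 0" by simp
  qed
  have "n = card (\<tau> ` F0)" using Suc.hyps(2) F card_image[OF inj] by simp
  moreover have tF: "\<tau> ` F0 \<subseteq> linear_forms (V - {y})" using \<tau>L Suc.prems(2) F by blast
  ultimately obtain F' where F': "triangular (V - {y}) F'" "card F' = n" "idl (V - {y}) F' = idl (V - {y}) (\<tau> ` F0)"
    using Suc.hyps(1)[OF _ _ _ ind'] F(3) by (metis finite_imageI)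
  note F'l = triangular_linear_forms[OF F'(1)]
  have MV: "M \<in> polys V" using linear_forms_polys[OF Mlin] .
  have sub: "\<tau> ` F0 \<subseteq> polys (V - {y})" "F' \<subseteq> polys (V - {y})"
    using linear_forms_subset_polys tF F'l by blast+
  have subV: "\<tau> ` F0 \<subseteq> polys V" "F' \<subseteq> polys V" using sub polys_mono[of "V - {y}" V] by blast+
  have e1: "idl V F' = idl V (\<tau> ` F0)" by (rule idl_eq_extend_vars[OF _ sub(2,1) F'(3)]) blast
  have FV: "F \<subseteq> polys V" using linear_forms_subset_polys[OF Suc.prems(2)] .
  have e2: "idl V (insert M (\<tau> ` F0)) = idl V F"
  proof
    show "idl V (insert M (\<tau> ` F0)) \<subseteq> idl V F"
    proof (rule idl_least[OF ideal_idl[OF FV]])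
      have "\<tau> g \<in> idl V F" if "g \<in> F0" for g
        unfolding \<tau>_def using idl_incl[OF FV] that F(1)
        by (intro ideal_diff[OF ideal_idl[OF FV]] ideal_mult[OF ideal_idl[OF FV]]) auto
      then show "insert M (\<tau> ` F0) \<subseteq> idl V F" using idl_incl[OF FV M] by auto
    qed
    have iV: "insert M (\<tau> ` F0) \<subseteq> polys V" using subV MV by simp
    have "g \<in> idl V (insert M (\<tau> ` F0))" if "g \<in> F0" for g
    proof -
      have "\<tau> g + single 0 (c g) * M \<in> idl V (insert M (\<tau> ` F0))"
        using idl_incl[OF iV] that
        by (intro ideal_add[OF ideal_idl[OF iV]] ideal_mult[OF ideal_idl[OF iV]]) auto
      then show ?thesis by (simp add: \<tau>_def)
    qed
    then show "idl V F \<subseteq> idl V (insert M (\<tau> ` F0))"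
      using idl_incl[OF iV] F(1) by (intro idl_least[OF ideal_idl[OF iV]]) auto
  qed
  have "idl V (insert M F') = idl V (insert M (\<tau> ` F0))"
    using e1 idl_insert[OF MV subV(1)] idl_insert[OF MV subV(2)] by simp
  moreover have "card (insert M F') = Suc n"
    using F'(2) F'l triangular_step_notin[OF F'(1) y(2)] by simp
  moreover have "triangular V (insert M F')" by (rule triangular.insert[OF y(1) F'(1) Mlin y(2)])
  ultimately show ?case using e2 Suc.hyps(2) by metis
qed

text \<open>Solving the equation \<open>M = 0\<close> for the variable y.\<close>

lemma variable_elimination:
  fixes M :: "('a::field) mpoly"
  assumes yV: "y \<in> V" and M: "M \<in> linear_forms V" "lookup M (single y 1) \<noteq> 0"
  obtains \<sigma> where "\<And>i. i \<in> V \<Longrightarrow> \<sigma> i \<in> polys (V - {y})" "\<And>i. i \<in> V - {y} \<Longrightarrow> \<sigma> i = Var i"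
    "\<And>F p. finite F \<Longrightarrow> F \<subseteq> polys (V - {y}) \<Longrightarrow> p \<in> polys V \<Longrightarrow>
       subst_mpoly \<sigma> p \<in> idl (V - {y}) F \<longleftrightarrow> p \<in> idl V (insert M F)"
proof -
  define a where "a = lookup M (single y 1)"
  have a: "a \<noteq> 0" using M by (simp add: a_def)
  define Y where "Y = Var y - single 0 (inverse a) * M"
  have VarL: "Var y \<in> linear_forms V" using yV by (auto simp: Var_def linear_forms_def)
  have lV: "lookup (Var y :: 'a mpoly) (single y 1) = 1" by (simp add: Var_def)
  have "Y \<in> linear_forms (V - {y})"
    unfolding linear_forms_Diff_iff Y_def
    using linear_forms_diff[OF VarL linear_forms_scale[OF M(1)]] a[unfolded a_def] lV
    by (simp add: lookup_minus a_def)
  then have Y: "Y \<in> polys (V - {y})" by (rule linear_forms_polys)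
  define \<sigma> where "\<sigma> = (\<lambda>i. if i = y then Y else Var i)"
  have \<sigma>: "\<sigma> i \<in> polys (V - {y})" if "i \<in> V" for i using that Y by (simp add: \<sigma>_def)
  have sV: "subst_mpoly \<sigma> p \<in> polys (V - {y})" if "p \<in> polys V" for p
    using subst_polys[OF that \<sigma>] .
  have sid: "subst_mpoly \<sigma> p = p" if "p \<in> polys (V - {y})" for p
  proof -
    have "subst_mpoly \<sigma> p = subst_mpoly Var p" by (rule subst_cong[OF that]) (simp add: \<sigma>_def)
    then show ?thesis by (simp add: subst_Var_id)
  qed
  have MV: "M \<in> polys V" using M(1) by (rule linear_forms_polys)
  have sM: "subst_mpoly \<sigma> M = 0"
  proof -
    define r where "r = M - single 0 a * Var y"
    have "r \<in> linear_forms (V - {y})"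
      unfolding linear_forms_Diff_iff r_def
      using linear_forms_diff[OF M(1) linear_forms_scale[OF VarL]] lV
      by (simp add: lookup_minus a_def)
    then have "subst_mpoly \<sigma> r = r" using sid linear_forms_polys by blast
    then have "subst_mpoly \<sigma> M - single 0 a * Y = r"
      by (simp add: r_def subst_diff subst_mult \<sigma>_def)
    then have "subst_mpoly \<sigma> M = M - single 0 a * Var y + single 0 a * Y" by (simp add: r_def algebra_simps)
    also have "\<dots> = M - (single 0 a * single 0 (inverse a)) * M" by (simp add: Y_def algebra_simps)
    also have "\<dots> = 0" using a by (simp add: mult_single)
    finally show ?thesis .
  qed
  have key: "subst_mpoly \<sigma> p \<in> idl (V - {y}) F \<longleftrightarrow> p \<in> idl V (insert M F)"
    if F: "finite F" "F \<subseteq> polys (V - {y})" and p: "p \<in> polys V" for F p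
  proof -
    note FVy = F(2)
    have FV: "F \<subseteq> polys V" using FVy polys_mono[of "V - {y}" V] by blast
    have iV: "insert M F \<subseteq> polys V" using FV MV by simp
    note idl1 = ideal_idl[OF iV]
    show ?thesis
  proof
    assume s: "subst_mpoly \<sigma> p \<in> idl (V - {y}) F"
    have "subst_mpoly \<sigma> p - p \<in> idl V (insert M F)"
    proof (rule subst_diff_mem_ideal[OF idl1 p])
      fix i assume i: "i \<in> V"
      have "- (single 0 (inverse a) * M) \<in> idl V (insert M F)"
        using idl_incl[OF iV] by (intro ideal_uminus[OF idl1] ideal_mult[OF idl1]) auto
      then show "\<sigma> i \<in> polys V \<and> \<sigma> i - Var i \<in> idl V (insert M F)"
        using \<sigma>[OF i] polys_mono[of "V - {y}" V] ideal_0[OF idl1] by (auto simp: \<sigma>_def Y_def)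
    qed
    moreover have "subst_mpoly \<sigma> p \<in> idl V (insert M F)"
      using s idl_extend_vars[of "V - {y}" V, OF _ FVy] idl_mono[OF _ iV, of F] by blast
    ultimately have "subst_mpoly \<sigma> p - (subst_mpoly \<sigma> p - p) \<in> idl V (insert M F)"
      using ideal_diff[OF idl1] by blast
    then show "p \<in> idl V (insert M F)" by simp
  next
    assume "p \<in> idl V (insert M F)"
    then obtain r b where rb: "p = r * M + b" "b \<in> idl V F" using idl_insert[OF MV FV] by blast
    obtain q where q: "\<forall>g\<in>F. q g \<in> polys V" "b = (\<Sum>g\<in>F. q g * g)"
      using idl_finite[OF F(1) FV rb(2)] by blast
    have "subst_mpoly \<sigma> p = (\<Sum>g\<in>F. subst_mpoly \<sigma> (q g) * subst_mpoly \<sigma> g)"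
      by (simp add: rb(1) q(2) subst_add subst_mult sM subst_sum)
    also have "\<dots> = (\<Sum>g\<in>F. subst_mpoly \<sigma> (q g) * g)" using sid FVy by (intro sum.cong) auto
    also have "\<dots> \<in> idl (V - {y}) F"
      using q(1) sV idl_incl[OF FVy]
      by (intro ideal_sum[OF ideal_idl[OF FVy]] ideal_mult[OF ideal_idl[OF FVy]]) auto
    finally show "subst_mpoly \<sigma> p \<in> idl (V - {y}) F" .
  qed
  qed
  show thesis
    by (rule that[of \<sigma>]) (use \<sigma> key in \<open>auto simp: \<sigma>_def\<close>)
qed

text \<open>Eliminating the pivots identifies the quotient by a linear ideal with a polynomial ring.\<close>

lemma triangular_elimination:
  fixes F :: "('a::field) mpoly set"
  assumes "triangular V F" "finite V"
  shows "\<exists>W \<phi>. W \<subseteq> V \<and> card W + card F = card V \<and> (\<forall>i\<in>V. \<phi> i \<in> polys W) \<and> (\<forall>i\<in>W. \<phi> i = Var i) \<and>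
     (\<forall>p\<in>polys V. subst_mpoly \<phi> p = 0 \<longleftrightarrow> p \<in> idl V F)"
  using assms
proof (induction rule: triangular.induct)
  case (empty V)
  show ?case
    by (rule exI[of _ V], rule exI[of _ Var]) (simp add: subst_Var_id)
next
  case (insert y V F M)
  then obtain W \<phi>0 where W: "W \<subseteq> V - {y}" "card W + card F = card (V - {y})" "\<forall>i\<in>V - {y}. \<phi>0 i \<in> polys W"
    "\<forall>i\<in>W. \<phi>0 i = Var i" "\<forall>p\<in>polys (V - {y}). subst_mpoly \<phi>0 p = 0 \<longleftrightarrow> p \<in> idl (V - {y}) F" by auto
  obtain \<sigma> where \<sigma>: "\<And>i. i \<in> V \<Longrightarrow> \<sigma> i \<in> polys (V - {y})" "\<And>i. i \<in> V - {y} \<Longrightarrow> \<sigma> i = Var i"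
    and key: "\<And>F p. finite F \<Longrightarrow> F \<subseteq> polys (V - {y}) \<Longrightarrow> p \<in> polys V \<Longrightarrow>
       subst_mpoly \<sigma> p \<in> idl (V - {y}) F \<longleftrightarrow> p \<in> idl V (insert M F)"
    using variable_elimination[OF insert.hyps(1,3,4)] by metis
  have FL: "finite F" "F \<subseteq> linear_forms (V - {y})" using triangular_linear_forms[OF insert.hyps(2)] by auto
  have FVy: "F \<subseteq> polys (V - {y})" using linear_forms_subset_polys[OF FL(2)] .
  define \<phi> where "\<phi> = (\<lambda>i. subst_mpoly \<phi>0 (\<sigma> i))"
  have "card W + card (insert M F) = card V"
    using W(2) insert.hyps(1) insert.prems FL(1) triangular_step_notin[OF insert.hyps(2,4)]
    by (simp add: card_Diff_singleton) (metis One_nat_def Suc_pred card_gt_0_iff empty_iff)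
  moreover have "\<phi> i \<in> polys W" if "i \<in> V" for i
    unfolding \<phi>_def using subst_polys[OF \<sigma>(1)[OF that]] W(3) by blast
  moreover have "\<phi> i = Var i" if "i \<in> W" for i
  proof -
    have "i \<in> V - {y}" using that W(1) by blast
    then show ?thesis using \<sigma>(2)[of i] W(4) that by (simp add: \<phi>_def)
  qed
  moreover have "subst_mpoly \<phi> p = 0 \<longleftrightarrow> p \<in> idl V (insert M F)" if "p \<in> polys V" for p
    unfolding \<phi>_def subst_subst[of \<phi>0 \<sigma> p, symmetric]
    using key[OF FL(1) FVy that] W(5) subst_polys[of p V \<sigma> "V - {y}", OF that \<sigma>(1)]
    by blast
  moreover have "W \<subseteq> V" using W(1) by blast
  ultimately show ?case by blast
qed

lemma triangular_ideal_prime: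
  fixes F :: "('a::field) mpoly set"
  assumes F: "triangular V F" "finite V"
  shows "1 \<notin> idl V F"
    and "a \<in> polys V \<Longrightarrow> b \<in> polys V \<Longrightarrow> a * b \<in> idl V F \<Longrightarrow> a \<in> idl V F \<or> b \<in> idl V F"
proof -
  obtain \<phi> where \<phi>: "\<forall>p\<in>polys V. subst_mpoly \<phi> p = 0 \<longleftrightarrow> p \<in> idl V F"
    using triangular_elimination[OF F] by blast
  show "1 \<notin> idl V F" using \<phi>[rule_format, of 1] by simp
  show "a \<in> polys V \<Longrightarrow> b \<in> polys V \<Longrightarrow> a * b \<in> idl V F \<Longrightarrow> a \<in> idl V F \<or> b \<in> idl V F"
    using \<phi>[rule_format, of "a * b"] \<phi>[rule_format, of a] \<phi>[rule_format, of b] polys_mult[of a V b]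
    by (simp add: subst_mult)
qed

lemma linear_ideal_prime:
  fixes F :: "('a::field) mpoly set"
  assumes "finite V" "finite F" "F \<subseteq> linear_forms V" "lin_indep F"
    and "a \<in> polys V" "b \<in> polys V" "a * b \<in> idl V F"
  shows "a \<in> idl V F \<or> b \<in> idl V F"
  using echelon_form[OF assms(2-4)] triangular_ideal_prime(2)[OF _ assms(1,5,6)] assms(7) by metis

section \<open>Ideals of star configurations\<close>

text \<open>Defined by membership, so that it is the unit ideal and not the set of all
  polynomials when c exceeds the number of forms.\<close>

definition star :: "nat set \<Rightarrow> ('a::comm_ring_1) mpoly set \<Rightarrow> nat \<Rightarrow> 'a mpoly set" where
  "star V F c = {p \<in> polys V. \<forall>J. J \<subseteq> F \<longrightarrow> card J = c \<longrightarrow> p \<in> idl V J}"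

lemma star_ideal_eq_star:
  assumes inj: "inj_on L {1..l}" and "c \<le> l" and L: "L ` {1..l} \<subseteq> polys V"
  shows "star_ideal V L l c = star V (L ` {1..l}) c"
proof -
  have "(`) L ` {J. J \<subseteq> {1..l} \<and> card J = c} = {J. J \<subseteq> L ` {1..l} \<and> card J = c}"
  proof (intro equalityI subsetI)
    fix X assume "X \<in> (`) L ` {J. J \<subseteq> {1..l} \<and> card J = c}"
    then obtain J where "X = L ` J" "J \<subseteq> {1..l}" "card J = c" by blast
    then show "X \<in> {J. J \<subseteq> L ` {1..l} \<and> card J = c}"
      using card_image[OF inj_on_subset[OF inj], of J] by auto
  next
    fix X assume X: "X \<in> {J. J \<subseteq> L ` {1..l} \<and> card J = c}"
    then obtain J where J: "J \<subseteq> {1..l}" "X = L ` J" by (auto simp: subset_image_iff)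
    then have "card J = c" using card_image[OF inj_on_subset[OF inj], of J] X by simp
    then show "X \<in> (`) L ` {J. J \<subseteq> {1..l} \<and> card J = c}" using J by blast
  qed
  note im = this
  have eq: "star_ideal V L l c = \<Inter>(idl V ` {J. J \<subseteq> L ` {1..l} \<and> card J = c})"
    unfolding star_ideal_def im[symmetric] image_image ..
  have "c \<le> card (L ` {1..l})" using card_image[OF inj] assms(2) by simp
  then obtain J where J: "J \<subseteq> L ` {1..l}" "card J = c" by (rule obtain_subset_with_card_n)
  then have "J \<subseteq> polys V" using L by blast
  then have "idl V J \<subseteq> polys V" by (rule idl_subset_polys)
  then show ?thesis unfolding eq star_def using J by blast
qed

lemma ideal_star:
  fixes F :: "('a::comm_ring_1) mpoly set"
  assumes "F \<subseteq> polys V"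
  shows "ideal (star V F c) (mpoly_ring V)"
proof -
  have i: "ideal (idl V J) (mpoly_ring V)" if "J \<subseteq> F" for J
    using that assms by (intro ideal_idl) blast
  show ?thesis
    unfolding ideal_mpoly_ring_iff
  proof (intro conjI ballI)
    show "0 \<in> star V F c" using ideal_0[OF i] by (simp add: star_def)
    fix a b assume "a \<in> star V F c" "b \<in> star V F c"
    then show "a + b \<in> star V F c" using ideal_add[OF i] by (auto simp: star_def)
  next
    fix r a :: "'a mpoly" assume "r \<in> polys V" "a \<in> star V F c"
    then show "r * a \<in> star V F c" using ideal_mult[OF i] by (auto simp: star_def)
  qed (auto simp: star_def)
qed

text \<open>The numbers force D to meet every set J of c forms.\<close>

lemma prod_mem_star:
  fixes F :: "('a::comm_ring_1) mpoly set"
  assumes F: "finite F" "F \<subseteq> polys V" and D: "D \<subseteq> F" "card F < card D + c"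
  shows "\<Prod>D \<in> star V F c"
  unfolding star_def
proof (intro CollectI conjI allI impI)
  have fD: "finite D" using D(1) F(1) finite_subset by blast
  show DV: "\<Prod>D \<in> polys V" using D(1) F(2) by (intro polys_prod) blast
  fix J assume J: "J \<subseteq> F" "card J = c"
  have fJ: "finite J" using J(1) F(1) finite_subset by blast
  have "D \<inter> J \<noteq> {}"
  proof
    assume "D \<inter> J = {}"
    then have "card (D \<union> J) = card D + c" using card_Un_disjoint[OF fD fJ] J(2) by simp
    moreover have "card (D \<union> J) \<le> card F" using D(1) J(1) F(1) by (intro card_mono) auto
    ultimately show False using D(2) by simp
  qed
  then obtain g where g: "g \<in> D" "g \<in> J" by blast
  have JV: "J \<subseteq> polys V" using J(1) F(2) by blast
  have "\<Prod>D = \<Prod>(D - {g}) * g" using g(1) fD by (simp add: prod.remove mult.commute)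
  also have "\<dots> \<in> idl V J"
    using D(1) F(2) by (intro ideal_mult[OF ideal_idl[OF JV]] idl_incl[OF JV g(2)] polys_prod) blast
  finally show "\<Prod>D \<in> idl V J" .
qed

text \<open>Modulo the prime ideal generated by K, a form that vanishes on e + 1 or more distinct
  hyperplanes is divisible by more linear forms than its degree allows.\<close>

lemma mem_linear_ideal_of_low_degree:
  fixes f :: "('a::field) mpoly"
  assumes V: "finite V" and K: "finite K" "K \<subseteq> linear_forms V"
    and T: "finite T" "T \<subseteq> linear_forms V" "T \<inter> K = {}"
    and f: "f \<in> polys V" "homogeneous e f" "e < card T" "\<And>j. j \<in> T \<Longrightarrow> f \<in> idl V (insert j K)"
    and ind: "\<And>i j. i \<in> T \<Longrightarrow> j \<in> T \<Longrightarrow> lin_indep (insert i (insert j K))"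
  shows "f \<in> idl V K"
  using T(1) T(2-) f ind
proof (induction T arbitrary: e f rule: finite_induct)
  case (insert a T)
  have KV: "K \<subseteq> polys V" using linear_forms_subset_polys[OF K(2)] .
  have aL: "a \<in> linear_forms V" and aV: "a \<in> polys V" using insert.prems(1) linear_forms_polys by auto
  have "f \<in> idl V (insert a K)" using insert.prems by blast
  then obtain r b where rb: "f = r * a + b" "r \<in> polys V" "b \<in> idl V K"
    using idl_insert[OF aV KV] by blast
  have hb: "hcomp e b \<in> idl V K" by (rule linear_ideal_homogeneous[OF K rb(3)])
  have f_eq: "f = hcomp e (r * a) + hcomp e b"
    using hcomp_homogeneous[OF insert.prems(4), of e] rb(1) by (simp add: hcomp_add)
  show ?case
  proof (cases e)
    case 0
    then have "hcomp e (r * a) = 0"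
      using hcomp_mult_homogeneous_less[OF homogeneous_linear_form[OF aL]] by simp
    then show ?thesis using f_eq hb by simp
  next
    case (Suc e')
    define r' where "r' = hcomp e' r"
    have "hcomp e (r * a) = r' * a"
      using hcomp_mult_homogeneous[OF homogeneous_linear_form[OF aL], of e' r] Suc by (simp add: r'_def)
    then have f': "f = r' * a + hcomp e b" using f_eq by simp
    have r'V: "r' \<in> polys V" unfolding r'_def using hcomp_polys[OF rb(2)] .
    have "r' \<in> idl V K"
    proof (rule insert.IH)
      show "homogeneous e' r'" unfolding r'_def by (rule homogeneous_hcomp)
      show "e' < card T" using insert.prems(5) insert.hyps Suc by simp
      fix j assume j: "j \<in> T"
      have jL: "insert j K \<subseteq> linear_forms V" using insert.prems(1) K(2) j by blast
      have jV: "insert j K \<subseteq> polys V" using linear_forms_subset_polys[OF jL] .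
      have "hcomp e b \<in> idl V (insert j K)" using hb idl_mono[OF _ jV, of K] by blast
      moreover have "f \<in> idl V (insert j K)" using insert.prems(6) j by blast
      ultimately have "f - hcomp e b \<in> idl V (insert j K)" using ideal_diff[OF ideal_idl[OF jV]] by blast
      then have "r' * a \<in> idl V (insert j K)" using f' by simp
      moreover have "lin_indep (insert j K)"
        using insert.prems(7)[of j j] j by simp
      ultimately have "r' \<in> idl V (insert j K) \<or> a \<in> idl V (insert j K)"
        using linear_ideal_prime[OF V _ jL _ r'V aV] K(1) by blast
      moreover have "a \<notin> idl V (insert j K)"
      proof (rule linear_form_notin_ideal)
        show "finite (insert j K)" using K(1) by simp
        show "insert a (insert j K) \<subseteq> linear_forms V" using jL aL by blast
        show "a \<notin> insert j K" using insert.hyps(2) insert.prems(2) j by blast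
        show "lin_indep (insert a (insert j K))" using insert.prems(7) j by blast
      qed
      ultimately show "r' \<in> idl V (insert j K)" by blast
    next
      fix i j assume "i \<in> T" "j \<in> T"
      then show "lin_indep (insert i (insert j K))" using insert.prems(7) by blast
    qed (use insert.prems r'V in auto)
    then have "r' * a \<in> idl V K"
      using ideal_mult[OF ideal_idl[OF KV] _ aV, of r'] by (simp add: mult.commute)
    then show ?thesis using f' hb ideal_add[OF ideal_idl[OF KV]] by metis
  qed
qed simp

text \<open>Descending induction on the number of elements of K: a component of degree at most
  \<open>card F - c\<close> of an element of the star ideal lies in the ideal generated by any K of at most c forms, and in the end in the one generated by no form at all.\<close>

lemma star_min_degree:
  fixes F :: "('a::field) mpoly set"
  assumes V: "finite V" and F: "finite F" "F \<subseteq> linear_forms V" and c: "c \<le> card F"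
    and ind: "\<And>J. J \<subseteq> F \<Longrightarrow> card J \<le> c + 1 \<Longrightarrow> lin_indep J"
    and p: "p \<in> star V F c" and m: "m \<in> keys p"
  shows "card F < mdeg m + c"
proof (rule ccontr)
  assume "\<not> card F < mdeg m + c"
  then have e: "mdeg m \<le> card F - c" using c by simp
  define f where "f = hcomp (mdeg m) p"
  have fV: "f \<in> polys V" using p hcomp_polys by (auto simp: star_def f_def)
  have fJ: "f \<in> idl V J" if "J \<subseteq> F" "card J = c" for J
  proof -
    have "finite J" "J \<subseteq> linear_forms V" using that F finite_subset by blast+
    then show ?thesis unfolding f_def using p that by (intro linear_ideal_homogeneous) (auto simp: star_def)
  qed
  have "f \<in> idl V K" if "K \<subseteq> F" "card K \<le> c" for K
    using that
  proof (induction "c - card K" arbitrary: K)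
    case 0
    then show ?case using fJ by simp
  next
    case (Suc k)
    have fK: "finite K" using Suc.prems F finite_subset by blast
    show ?case
    proof (rule mem_linear_ideal_of_low_degree[OF V fK, where T = "F - K" and e = "mdeg m"])
      show "homogeneous (mdeg m) f" unfolding f_def by (rule homogeneous_hcomp)
      have "card (F - K) = card F - card K" using card_Diff_subset[OF fK] Suc.prems by blast
      then show "mdeg m < card (F - K)" using e Suc.hyps(2) Suc.prems c by linarith
      fix j assume j: "j \<in> F - K"
      then have cj: "card (insert j K) = Suc (card K)" using fK by simp
      then have "k = c - card (insert j K)" "card (insert j K) \<le> c" using Suc.hyps(2) by linarith+
      then show "f \<in> idl V (insert j K)" using Suc.hyps(1)[of "insert j K"] j Suc.prems by blast
      fix i assume i: "i \<in> F - K"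
      have "card (insert i (insert j K)) \<le> Suc (card (insert j K))" using fK by (simp add: card_insert_if)
      then have "card (insert i (insert j K)) \<le> c + 1" using cj Suc.hyps(2) by linarith
      then show "lin_indep (insert i (insert j K))" by (rule ind[rotated]) (use i j Suc.prems in auto)
    qed (use Suc.prems F fV in auto)
  qed
  from this[of "{}"] have "f = 0" by simp
  moreover have "lookup f m = lookup p m" by (simp add: f_def lookup_hcomp)
  ultimately show False using m by (simp add: in_keys_iff)
qed

section \<open>Squarefree initial ideals force triangular forms\<close>

text \<open>All that the two implications into triangularity use of the star ideal, for \<open>d = card F - c + 1\<close>. It
  passes to the two ideals of a vertex decomposition, without these having to be identified as
  star ideals.\<close>

definition product_saturated :: "('a::comm_ring_1) mpoly set \<Rightarrow> 'a mpoly set \<Rightarrow> nat \<Rightarrow> bool" where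
  "product_saturated I F d \<longleftrightarrow> (\<forall>p\<in>I. \<forall>m\<in>keys p. d \<le> mdeg m) \<and>
     (\<forall>D. D \<subseteq> F \<longrightarrow> card D = d \<longrightarrow> \<Prod>D \<in> I)"

lemma lead_linear_form:
  assumes "is_lead lt u L" "L \<in> linear_forms V"
  obtains y where "y \<in> V" "u = single y 1" "lookup L (single y 1) \<noteq> 0"
proof -
  have "u \<in> keys L" using assms(1) by (simp add: is_lead_def)
  moreover then obtain y where "y \<in> V" "u = single y 1" using assms(2) unfolding linear_forms_def by blast
  ultimately show thesis using that by (simp add: in_keys_iff)
qed

text \<open>The form with the largest leading variable is the only one in which this variable occurs.\<close>

lemma triangular_of_distinct_leads:
  fixes F :: "('a::field) mpoly set"
  assumes mo: "monomial_order V lt" and F: "finite F" "F \<subseteq> linear_forms V"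
    and u: "\<And>L. L \<in> F \<Longrightarrow> is_lead lt (u L) L" and inj: "inj_on u F"
  shows "triangular V F"
proof -
  have "triangular W F" if "W \<subseteq> V" "F \<subseteq> linear_forms W" for W
    using F(1) that u inj
  proof (induction "card F" arbitrary: F W)
    case 0
    then show ?case by (simp add: triangular.empty)
  next
    case (Suc n)
    have uV: "u L \<in> monoms V" if "L \<in> F" for L
    proof -
      have "L \<in> polys V" using linear_forms_polys linear_forms_mono[OF Suc.prems(2)] Suc.prems(3) that by blast
      then show ?thesis using is_lead_monoms Suc.prems(4)[OF that] by blast
    qed
    have "F \<noteq> {}" using Suc.hyps(2) by auto
    then obtain t where t: "t \<in> u ` F" "\<forall>m\<in>u ` F. m \<noteq> t \<longrightarrow> lt m t"
      using finite_max_monom[OF mo, of "u ` F"] Suc.prems(1) uV by blast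
    then obtain M where M: "M \<in> F" "t = u M" by blast
    have Mlin: "M \<in> linear_forms W" using M Suc.prems(3) by blast
    obtain y where y: "y \<in> W" "u M = single y 1" "lookup M (single y 1) \<noteq> 0"
      using lead_linear_form[OF Suc.prems(4)[OF M(1)] Mlin] .
    have "L \<in> linear_forms (W - {y})" if L: "L \<in> F - {M}" for L
      unfolding linear_forms_Diff_iff
    proof
      show "L \<in> linear_forms W" using L Suc.prems(3) by blast
      have "u L \<noteq> u M" using Suc.prems(5) L M(1) unfolding inj_on_def by blast
      then have lt: "lt (u L) (u M)" using t(2) L M(2) by simp
      show "lookup L (single y 1) = 0"
      proof (rule ccontr)
        assume "lookup L (single y 1) \<noteq> 0"
        then have "u M \<in> keys L" using y(2) by (simp add: in_keys_iff)
        then have "u M = u L \<or> lt (u M) (u L)" using Suc.prems(4) L is_lead_le by blast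
        then show False using lt mo_asym[OF mo] mo_irrefl[OF mo] uV L M(1) by (metis DiffD1)
      qed
    qed
    then have sub: "F - {M} \<subseteq> linear_forms (W - {y})" by blast
    have "triangular (W - {y}) (F - {M})"
    proof (rule Suc.hyps(1))
      show "n = card (F - {M})" using Suc.hyps(2) Suc.prems(1) M(1) by simp
      show "inj_on u (F - {M})" using Suc.prems(5) by (rule inj_on_subset) blast
    qed (use Suc.prems sub in auto)
    from triangular.insert[OF y(1) this Mlin y(3)] show ?case using M(1) by (simp add: insert_absorb)
  qed
  then show ?thesis using F(2) by blast
qed

text \<open>If two forms have the same leading variable, then the leading monomial of a product of d forms
  among which they are has a squarefree part of degree less than d, and no term of that degree
  occurs in I.\<close>

theorem knutson_imp_triangular:
  fixes F :: "('a::field) mpoly set"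
  assumes V: "finite V" and F: "finite F" "F \<subseteq> linear_forms V" "0 \<notin> F"
    and d: "2 \<le> d" "d \<le> card F" and I: "product_saturated I F d" and K: "knutson_ideal V I"
  shows "triangular V F"
proof -
  obtain lt f where f: "monomial_order V lt" "f \<in> polys V - {0}" "squarefree_monom (lead_monom lt f)"
    "I \<in> knutson_set V f" using K unfolding knutson_ideal_def by blast
  note mo = f(1)
  have leadf: "is_lead lt (lead_monom lt f) f" using lead_monom_is_lead[OF mo] f(2) by blast
  have FV: "F \<subseteq> polys V" using linear_forms_subset_polys[OF F(2)] .
  define u where "u = (lead_monom lt :: 'a mpoly \<Rightarrow> monom)"
  have u: "is_lead lt (u L) L" if "L \<in> F" for L
    unfolding u_def using lead_monom_is_lead[OF mo] that FV F(3) by blast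
  have u1: "mdeg (u L) = 1" if "L \<in> F" for L
    using homogeneous_linear_form[of L V] F(2) u[OF that] that unfolding homogeneous_def is_lead_def by blast
  have "inj_on u F"
  proof (rule inj_onI, rule ccontr)
    fix L L' assume L: "L \<in> F" "L' \<in> F" "u L = u L'" "L \<noteq> L'"
    obtain B where B: "B \<subseteq> F - {L, L'}" "card B = d - 2" "finite B"
    proof -
      have "card (F - {L, L'}) = card F - 2" using L F(1) by (simp add: card_Diff_subset)
      then have "d - 2 \<le> card (F - {L, L'})" using d by simp
      then show thesis using that by (rule obtain_subset_with_card_n)
    qed
    define D where "D = insert L (insert L' B)"
    have D: "D \<subseteq> F" "finite D" "card D = d" using B L d by (auto simp: D_def card_insert_if)
    have DI: "\<Prod>D \<in> I" using I D unfolding product_saturated_def by blast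
    define w where "w = (\<Sum>L\<in>D. u L)"
    have "is_lead lt (\<Sum>L\<in>D. u L) (\<Prod>L\<in>D. L)"
      by (rule is_lead_prod[OF mo D(2)]) (use D(1) FV u in blast)
    then have "is_lead lt w (\<Prod>D)" by (simp add: w_def)
    from knutson_squarefree_initial[OF V mo _ leadf f(3) f(4) DI this] f(2)
    obtain h where h: "h \<in> I" "lookup h (squarefree_part w) \<noteq> 0" by blast
    have le: "d \<le> mdeg (squarefree_part w)"
      using I h unfolding product_saturated_def by (auto simp: in_keys_iff)
    have "mdeg (sum u A) = card A" if "finite A" "A \<subseteq> F" for A
      using that by (induction A) (auto simp: mdeg_add u1)
    then have wd: "mdeg w = d" using D by (simp add: w_def)
    obtain y where y: "u L = single y 1" using lead_linear_form[OF u[OF L(1)]] F(2) L(1) by blast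
    have "L \<notin> insert L' B" "L' \<notin> B" using B(1) L(4) by auto
    then have "w = u L + (u L' + sum u B)" using B(3) by (simp add: w_def D_def)
    then have y2: "2 \<le> lookup w y" using y L(3) by (simp add: lookup_add)
    \<comment> \<open>The variable y has exponent at least two, so the squarefree part has smaller degree.\<close>
    have k: "keys (squarefree_part w) = keys w"
      by (auto simp: in_keys_iff lookup_squarefree_part split: if_splits)
    have "mdeg (squarefree_part w) = (\<Sum>i\<in>keys w. 1)"
      unfolding mdeg_def k by (intro sum.cong) (auto simp: lookup_squarefree_part)
    also have "\<dots> < (\<Sum>i\<in>keys w. lookup w i)"
    proof (rule sum_strict_mono_ex1)
      show "\<forall>i\<in>keys w. 1 \<le> lookup w i" by (auto simp: in_keys_iff)
      show "\<exists>i\<in>keys w. 1 < lookup w i" using y2 by (intro bexI[of _ y]) (auto simp: in_keys_iff)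
    qed simp
    finally show False using le wd by (simp add: mdeg_def)
  qed
  then show ?thesis using triangular_of_distinct_leads[OF mo F(1,2) u] by blast
qed

section \<open>Leading forms in one variable\<close>

lemma lookup_coeff_in:
  fixes f :: "('a::comm_ring_1) mpoly"
  shows "lookup (coeff_in y i f) k = (if lookup k y = 0 then lookup f (k + single y i) else 0)"
proof -
  let ?A = "{m \<in> keys f. lookup m y = i}"
  have eq: "m - single y i = k \<longleftrightarrow> lookup k y = 0 \<and> m = k + single y i" if "lookup m y = i" for m
  proof
    assume k: "m - single y i = k"
    have "single y i + (m - single y i) = m"
      using that by (intro monom_add_diff) (auto simp: lookup_single when_def)
    moreover have "lookup (m - single y i) y = 0" using that by (simp add: lookup_minus)
    ultimately show "lookup k y = 0 \<and> m = k + single y i" using k by (simp add: add.commute)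
  qed simp
  have "lookup (coeff_in y i f) k = (\<Sum>m\<in>?A. if m - single y i = k then lookup f m else 0)"
    unfolding coeff_in_def by (simp add: lookup_sum lookup_single when_def)
  also have "\<dots> = (\<Sum>m\<in>?A. if m = k + single y i then (if lookup k y = 0 then lookup f m else 0) else 0)"
    using eq by (intro sum.cong) auto
  also have "\<dots> = (if lookup k y = 0 then lookup f (k + single y i) else 0)"
    by (auto simp: sum.delta lookup_add not_in_keys_iff_lookup_eq_zero)
  finally show ?thesis .
qed

lemma coeff_in_add: "coeff_in y i (p + q) = coeff_in y i p + coeff_in y i q"
  by (intro poly_mapping_eqI) (simp add: lookup_coeff_in lookup_add)

lemma coeff_in_0 [simp]: "coeff_in y i 0 = 0"
  by (intro poly_mapping_eqI) (simp add: lookup_coeff_in)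

lemma coeff_in_sum: "coeff_in y i (sum f A) = (\<Sum>x\<in>A. coeff_in y i (f x))"
  by (induction A rule: infinite_finite_induct) (simp_all add: coeff_in_add)

lemma coeff_in_polys:
  assumes "p \<in> polys V"
  shows "coeff_in y i p \<in> polys (V - {y})"
  unfolding polys_iff
proof
  fix m assume "m \<in> keys (coeff_in y i p)"
  then have "lookup m y = 0" "m + single y i \<in> keys p"
    by (auto simp: in_keys_iff lookup_coeff_in split: if_splits)
  then have "lookup m y = 0" "m + single y i \<in> monoms V" using assms by (auto simp: polys_iff)
  then show "m \<in> monoms (V - {y})" by (simp add: monoms_Diff_iff)
qed

lemma polys_Diff_iff: "p \<in> polys (V - {y}) \<longleftrightarrow> p \<in> polys V \<and> (\<forall>m\<in>keys p. lookup m y = 0)"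
  by (auto simp: polys_iff monoms_Diff_iff)

lemma coeff_in_without:
  assumes "p \<in> polys (V - {y})"
  shows "coeff_in y i p = (if i = 0 then p else 0)"
proof (rule poly_mapping_eqI)
  fix m
  have z: "lookup p n = 0" if "lookup n y \<noteq> 0" for n
  proof -
    have "n \<notin> keys p" using assms that unfolding polys_Diff_iff by metis
    then show ?thesis by (simp add: in_keys_iff)
  qed
  show "lookup (coeff_in y i p) m = lookup (if i = 0 then p else 0) m"
    using z[of m] z[of "m + single y i"] by (simp add: lookup_coeff_in lookup_add)
qed

lemma coeff_in_mult_without:
  fixes r g :: "('a::comm_ring_1) mpoly"
  assumes "g \<in> polys (V - {y})"
  shows "coeff_in y i (r * g) = coeff_in y i r * g"
proof -
  have mono: "coeff_in y i (single n c * r) = single n c * coeff_in y i r" if n: "lookup n y = 0" for n c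
  proof (rule poly_mapping_eqI)
    fix k
    show "lookup (coeff_in y i (single n c * r)) k = lookup (single n c * coeff_in y i r) k"
    proof (cases "monom_dvd n k")
      case True
      then obtain s where s: "k = n + s" by (rule monom_dvdE)
      then show ?thesis using n lookup_single_mult[of n c r "s + single y i"]
        by (simp add: lookup_coeff_in lookup_single_mult lookup_add add.assoc)
    next
      case False
      have "lookup (single n c * coeff_in y i r) k = 0"
        by (rule lookup_single_mult_notin) (use False monom_dvd_add in blast)
      moreover have "lookup (single n c * r) (k + single y i) = 0"
      proof (rule lookup_single_mult_notin)
        fix s
        show "k + single y i \<noteq> n + s"
        proof
          assume eq: "k + single y i = n + s"
          have "lookup n j \<le> lookup k j" for j
            using arg_cong[OF eq, of "\<lambda>m. lookup m j"] n
            by (cases "j = y") (auto simp: lookup_add lookup_single when_def)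
          then show False using False by (simp add: monom_dvd_def)
        qed
      qed
      ultimately show ?thesis by (simp add: lookup_coeff_in)
    qed
  qed
  have "r * g = (\<Sum>n\<in>keys g. single n (lookup g n) * r)"
    by (subst mpoly_eq_sum_monomials[of g]) (simp add: sum_distrib_left mult.commute)
  then have "coeff_in y i (r * g) = (\<Sum>n\<in>keys g. single n (lookup g n) * coeff_in y i r)"
    using assms mono by (simp add: coeff_in_sum polys_Diff_iff)
  also have "\<dots> = coeff_in y i r * g"
    by (subst (2) mpoly_eq_sum_monomials[of g]) (simp add: sum_distrib_left mult.commute)
  finally show ?thesis .
qed

lemma coeff_in_idl:
  assumes G: "finite G" "G \<subseteq> polys (V - {y})" and p: "p \<in> idl V G"
  shows "coeff_in y i p \<in> idl (V - {y}) G"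
proof -
  have GV: "G \<subseteq> polys V" using G(2) polys_mono[of "V - {y}" V] by auto
  obtain q where q: "\<forall>g\<in>G. q g \<in> polys V" "p = (\<Sum>g\<in>G. q g * g)"
    using idl_finite[OF G(1) GV p] by blast
  have "coeff_in y i p = (\<Sum>g\<in>G. coeff_in y i (q g) * g)"
    unfolding q(2) coeff_in_sum
    by (intro sum.cong refl coeff_in_mult_without[of _ V]) (use G(2) in blast)
  also have "\<dots> \<in> idl (V - {y}) G"
  proof (rule ideal_sum[OF ideal_idl[OF G(2)]])
    fix g assume "g \<in> G"
    then show "coeff_in y i (q g) * g \<in> idl (V - {y}) G"
      using q(1) coeff_in_polys[of "q g" V] idl_incl[OF G(2)] ideal_mult[OF ideal_idl[OF G(2)]] by blast
  qed
  finally show ?thesis .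
qed

lemma idl_contraction:
  assumes G: "finite G" "G \<subseteq> polys (V - {y})"
  shows "idl V G \<inter> polys (V - {y}) = idl (V - {y}) G"
proof
  show "idl V G \<inter> polys (V - {y}) \<subseteq> idl (V - {y}) G"
  proof
    fix p assume p: "p \<in> idl V G \<inter> polys (V - {y})"
    then have "coeff_in y 0 p = p" using coeff_in_without[of p V y 0] by simp
    then show "p \<in> idl (V - {y}) G" using coeff_in_idl[OF G, of p 0] p by simp
  qed
  show "idl (V - {y}) G \<subseteq> idl V G \<inter> polys (V - {y})"
    using idl_extend_vars[of "V - {y}" V G] idl_subset_polys[of G "V - {y}"] G(2) by blast
qed

lemma coeff_in_mult_Var: "coeff_in y 0 (r * Var y) = 0"
proof (rule poly_mapping_eqI)
  fix m
  have "lookup (Var y * r) m = 0" if "lookup m y = 0"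
    unfolding Var_def by (rule lookup_single_mult_notin) (use that in \<open>auto simp: lookup_add\<close>)
  then show "lookup (coeff_in y 0 (r * Var y)) m = lookup 0 m"
    by (simp add: lookup_coeff_in mult.commute)
qed

lemma Var_power: "Var y ^ n = single (single y n) (1 :: 'a::comm_ring_1)"
  by (induction n) (simp_all add: Var_def mult_single flip: single_add)

lemma lookup_coeff_in_mult_Var_power:
  fixes f :: "('a::comm_ring_1) mpoly"
  shows "lookup (coeff_in y k f * Var y ^ k) m = (if lookup m y = k then lookup f m else 0)"
proof -
  have f: "coeff_in y k f * Var y ^ k = single (single y k) 1 * coeff_in y k f"
    by (simp add: Var_power mult.commute)
  show ?thesis
  proof (cases "monom_dvd (single y k) m")
    case True
    then obtain s where s: "m = single y k + s" by (rule monom_dvdE)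
    show ?thesis unfolding f s lookup_single_mult lookup_coeff_in
      by (simp add: lookup_add add.commute)
  next
    case False
    have "lookup (coeff_in y k f * Var y ^ k) m = 0"
      unfolding f by (rule lookup_single_mult_notin) (use False monom_dvd_add in blast)
    moreover have "lookup m y \<noteq> k"
      using False by (auto simp: monom_dvd_def lookup_single when_def split: if_splits)
    ultimately show ?thesis by simp
  qed
qed

lemma lookup_initial_form:
  "lookup (initial_form y f) m = (if lookup m y = deg_in y f then lookup f m else 0)"
  unfolding initial_form_def lead_coeff_in_def by (rule lookup_coeff_in_mult_Var_power)

lemma deg_in_ge: "m \<in> keys f \<Longrightarrow> lookup m y \<le> deg_in y f"
  unfolding deg_in_def by (rule Max_ge) auto

lemma deg_in_attained:
  assumes "f \<noteq> 0"
  obtains m where "m \<in> keys f" "lookup m y = deg_in y f"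
proof -
  have "deg_in y f \<in> (\<lambda>m. lookup m y) ` keys f"
    unfolding deg_in_def by (rule Max_in) (use assms in auto)
  then obtain m where "m \<in> keys f" "deg_in y f = lookup m y" by blast
  then show thesis using that by simp
qed

lemma initial_form_polys: "f \<in> polys V \<Longrightarrow> initial_form y f \<in> polys V"
  by (auto simp: polys_iff in_keys_iff lookup_initial_form split: if_splits)

lemma lead_coeff_in_polys: "f \<in> polys V \<Longrightarrow> lead_coeff_in y f \<in> polys (V - {y})"
  unfolding lead_coeff_in_def by (rule coeff_in_polys)

lemma coeff_in_initial_form: "coeff_in y (deg_in y f) (initial_form y f) = lead_coeff_in y f"
  unfolding lead_coeff_in_def
  by (intro poly_mapping_eqI) (simp add: lookup_coeff_in lookup_initial_form lookup_add)

lemma lead_coeff_in_nonzero: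
  assumes "f \<noteq> 0"
  shows "lead_coeff_in y f \<noteq> 0"
proof -
  obtain m where m: "m \<in> keys f" "lookup m y = deg_in y f" using deg_in_attained[OF assms] .
  have "single y (deg_in y f) + (m - single y (deg_in y f)) = m"
    using m(2) by (intro monom_add_diff) (auto simp: lookup_single when_def)
  then have "lookup (lead_coeff_in y f) (m - single y (deg_in y f)) \<noteq> 0"
    using m by (simp add: lead_coeff_in_def lookup_coeff_in lookup_minus in_keys_iff add.commute)
  then show ?thesis by auto
qed

lemma deg_in_0:
  assumes "f \<in> polys (V - {y})" "f \<noteq> 0"
  shows "deg_in y f = 0" "initial_form y f = f" "lead_coeff_in y f = f"
proof -
  show d: "deg_in y f = 0" using deg_in_attained[OF assms(2)] assms(1) by (metis polys_Diff_iff)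
  show l: "lead_coeff_in y f = f" unfolding lead_coeff_in_def d using coeff_in_without[OF assms(1)] by simp
  show "initial_form y f = f" by (simp add: initial_form_def l d)
qed

text \<open>The order \<^term>\<open>(<)\<close> on monomials is lexicographic. Comparing the exponent of y before makes it
  compatible with y.\<close>

definition var_first_order :: "nat \<Rightarrow> monom_rel" where
  "var_first_order y a b \<longleftrightarrow> lookup a y < lookup b y \<or> lookup a y = lookup b y \<and> a < b"

lemma monomial_order_less: "monomial_order V (<)"
proof -
  have "0 < a" if "a \<noteq> 0" for a :: monom
  proof (rule ccontr)
    assume "\<not> 0 < a"
    then have "a < 0" using that by simp
    then obtain k where "lookup a k < lookup 0 k"
      unfolding less_poly_mapping.rep_eq less_fun_def by blast
    then show False by simp
  qed
  then show ?thesis unfolding monomial_order_def by (auto simp: add_strict_right_mono)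
qed

lemma monomial_order_var_first: "monomial_order V (var_first_order y)"
  unfolding monomial_order_def var_first_order_def
proof (intro conjI ballI impI)
  fix a :: monom assume "a \<noteq> 0"
  then have "0 < a" using monomial_order_less[of UNIV] by (simp add: monomial_order_def monoms_def)
  then show "lookup 0 y < lookup a y \<or> lookup 0 y = lookup a y \<and> 0 < a" by auto
qed (auto simp: lookup_add add_strict_right_mono)

lemma lead_var_first:
  fixes L :: "('a::comm_ring_1) mpoly"
  assumes L: "L \<in> linear_forms V" "y \<in> V" "lookup L (single y 1) \<noteq> 0"
  shows "is_lead (var_first_order y) (single y 1) L"
  unfolding is_lead_def
proof (intro conjI ballI impI)
  show "single y 1 \<in> keys L" using L(3) by (simp add: in_keys_iff)
  fix m assume m: "m \<in> keys L" "m \<noteq> single y 1"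
  then obtain i where "m = single i 1" "i \<noteq> y" using L(1) unfolding linear_forms_def by blast
  then show "var_first_order y m (single y 1)" by (simp add: var_first_order_def lookup_single when_def)
qed

lemma linear_form_keys: "L \<in> linear_forms V \<Longrightarrow> m \<in> keys L \<Longrightarrow> \<exists>i. m = single i 1"
  unfolding linear_forms_def by auto

lemma lead_coeff_linear_mult:
  fixes M P :: "('a::field) mpoly"
  assumes M: "M \<in> linear_forms V" "lookup M (single y 1) \<noteq> 0" and P: "P \<in> polys (V - {y})" "P \<noteq> 0"
  shows "deg_in y (M * P) = 1" "lead_coeff_in y (M * P) = single 0 (lookup M (single y 1)) * P"
proof -
  let ?y = "single y (1 :: nat)"
  have "coeff_in y 1 M = single 0 (lookup M ?y)"
  proof (rule poly_mapping_eqI)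
    fix m
    have "m = 0" if k: "m + ?y \<in> keys M"
    proof -
      obtain i where "m + ?y = single i 1" using linear_form_keys[OF M(1) k] by blast
      then have "mdeg (m + ?y) = 1" by simp
      then show ?thesis by (simp add: mdeg_add)
    qed
    then show "lookup (coeff_in y 1 M) m = lookup (single 0 (lookup M ?y)) m"
      by (auto simp: lookup_coeff_in lookup_single when_def in_keys_iff)
  qed
  then have c1: "coeff_in y 1 (M * P) = single 0 (lookup M ?y) * P"
    using coeff_in_mult_without[OF P(1)] by simp
  have "M \<noteq> 0" using M(2) by auto
  then have MP: "M * P \<noteq> 0" using P(2) by simp
  have "lookup m y \<le> 1" if m: "m \<in> keys (M * P)" for m
  proof -
    obtain a b where ab: "m = a + b" "a \<in> keys M" "b \<in> keys P" using m keys_mult[of M P] by blast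
    have "lookup b y = 0" using ab(3) P(1) by (auto simp: polys_Diff_iff)
    moreover obtain i where "a = single i 1" using linear_form_keys[OF M(1) ab(2)] by blast
    ultimately show ?thesis by (simp add: ab(1) lookup_add lookup_single when_def)
  qed
  moreover obtain m where "m \<in> keys (M * P)" "lookup m y = deg_in y (M * P)"
    using deg_in_attained[OF MP] .
  ultimately have le: "deg_in y (M * P) \<le> 1" by fastforce
  have "coeff_in y 1 (M * P) \<noteq> 0"
  proof -
    have "single 0 (lookup M ?y) \<noteq> (0 :: 'a mpoly)" using M(2) by (metis lookup_single_eq lookup_zero)
    then show ?thesis unfolding c1 using P(2) by simp
  qed
  then obtain m where "m \<in> keys (coeff_in y 1 (M * P))" by (metis keys_eq_empty ex_in_conv)
  then have "m + ?y \<in> keys (M * P)" by (auto simp: in_keys_iff lookup_coeff_in split: if_splits)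
  from deg_in_ge[OF this, of y] le show d: "deg_in y (M * P) = 1" by (simp add: lookup_add)
  then show "lead_coeff_in y (M * P) = single 0 (lookup M ?y) * P" using c1 by (simp add: lead_coeff_in_def)
qed

section \<open>Geometrically vertex decomposable ideals force triangular forms\<close>

lemma min_degree_idl:
  fixes F :: "('a::comm_ring_1) mpoly set"
  assumes F: "F \<subseteq> polys V" and d: "\<And>f m. f \<in> F \<Longrightarrow> m \<in> keys f \<Longrightarrow> d \<le> mdeg m"
    and p: "p \<in> idl V F" "m \<in> keys p"
  shows "d \<le> mdeg m"
proof -
  let ?I = "{p :: 'a mpoly. p \<in> polys V \<and> (\<forall>m\<in>keys p. d \<le> mdeg m)}"
  have "ideal ?I (mpoly_ring V)"
    unfolding ideal_mpoly_ring_iff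
  proof (intro conjI ballI)
    fix a b :: "'a mpoly" assume "a \<in> ?I" "b \<in> ?I"
    then show "a + b \<in> ?I" using keys_add[of a b] by auto
  next
    fix r a :: "'a mpoly" assume "r \<in> polys V" "a \<in> ?I"
    then show "r * a \<in> ?I" using keys_mult[of r a] by (fastforce simp: mdeg_add)
  qed auto
  then have "idl V F \<subseteq> ?I"
  proof (rule idl_least)
    show "F \<subseteq> ?I"
    proof
      fix f assume f: "f \<in> F"
      then have "f \<in> polys V" using F by (rule subsetD[rotated])
      moreover have "\<forall>m\<in>keys f. d \<le> mdeg m" using d[OF f] by (rule ballI)
      ultimately show "f \<in> ?I" by simp
    qed
  qed
  then have "p \<in> ?I" using p(1) by (rule subsetD)
  then show ?thesis using p(2) by simp
qed

lemma product_saturated_degree: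
  "product_saturated I F d \<Longrightarrow> p \<in> I \<Longrightarrow> m \<in> keys p \<Longrightarrow> d \<le> mdeg m"
  by (simp add: product_saturated_def)

lemma product_saturated_prod:
  "product_saturated I F d \<Longrightarrow> D \<subseteq> F \<Longrightarrow> card D = d \<Longrightarrow> \<Prod>D \<in> I"
  by (simp add: product_saturated_def)

text \<open>At most one of the forms involves the decomposition variable y. The other ones inherit the hypothesis:
  for N with the same d, which suffices if at least d forms remain. If only \<open>d - 1\<close> remain, the
  leading coefficient in y of the product of all forms puts their product into C, and the
  terms of C have degree at least \<open>d - 1\<close>.\<close>

lemma gvd_imp_triangular:
  fixes F :: "('k::field) mpoly set"
  assumes "gvd V I" "finite V" "finite F" "F \<subseteq> linear_forms V" "0 \<notin> F" "2 \<le> d" "d \<le> card F"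
    "product_saturated I F d"
  shows "triangular V F"
  using assms
proof (induction arbitrary: F d rule: gvd.induct)
  case (unit I V)
  have "1 \<in> I" using unit.hyps(3) by simp
  then have "d \<le> mdeg 0" by (rule product_saturated_degree[OF unit.prems(7)]) simp
  then show ?case using unit.prems by simp
next
  case (variables I V A)
  show ?case
  proof (cases "A = {}")
    case True
    then have I0: "I = {0}" using variables.hyps by simp
    obtain D where D: "D \<subseteq> F" "card D = d" "finite D"
      using variables.prems(6) by (rule obtain_subset_with_card_n)
    then have "\<Prod>D = 0" using product_saturated_prod[OF variables.prems(7)] I0 by simp
    then have "0 \<in> D" using D(3) by (simp add: prod_zero_iff)
    then show ?thesis using D(1) variables.prems(4) by blast
  next
    case False
    then obtain a where a: "a \<in> A" by blast
    have "Var ` A \<subseteq> (polys V :: 'k mpoly set)" using variables.hyps(3) by auto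
    then have "(Var a :: 'k mpoly) \<in> I" using idl_incl[of "Var ` A" V "Var a"] a variables.hyps(4) by blast
    then have "d \<le> mdeg (single a 1)"
      by (rule product_saturated_degree[OF variables.prems(7)]) (simp add: Var_def)
    then show ?thesis using variables.prems(5) by simp
  qed
next
  case (decomposition I V y C N)
  let ?S = "V - {y}"
  note gd = decomposition.hyps(4)[unfolded geometric_vertex_decomposition_def]
  note fV = decomposition.prems(1) and fF = decomposition.prems(2) and FL = decomposition.prems(3)
    and F0 = decomposition.prems(4) and d = decomposition.prems(5,6) and ps = decomposition.prems(7)
  note iI = decomposition.hyps(1) and yV = decomposition.hyps(3)
  obtain G where G: "finite G" "G \<subseteq> I - {0}" "C = C_ideal V y G" "N = N_ideal V y G"
    using gd unfolding groebner_basis_def by blast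
  have inI: "initial_form_ideal V y I = C \<inter> (N <+>\<^bsub>mpoly_ring V\<^esub> idl V {Var y})" using gd by blast
  have IV: "I \<subseteq> polys V" using ideal_subset[OF iI] by blast
  have SV: "polys ?S \<subseteq> (polys V :: 'k mpoly set)" using polys_mono[of ?S V] by blast
  let ?GC = "lead_coeff_in y ` G" and ?GN = "lead_coeff_in y ` {g \<in> G. deg_in y g = 0}"
  have GS: "?GC \<subseteq> polys ?S" "?GN \<subseteq> polys ?S" using G(2) IV lead_coeff_in_polys by blast+
  have fG: "finite ?GC" "finite ?GN" using G(1) by auto
  have CN: "C = idl V ?GC" "N = idl V ?GN" using G by (auto simp: C_ideal_def N_ideal_def)
  have GV: "?GC \<subseteq> polys V" "?GN \<subseteq> polys V" using GS SV by blast+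
  have iC: "ideal C (mpoly_ring V)" and iN: "ideal N (mpoly_ring V)" using CN ideal_idl GV by auto
  have Cy: "coeff_in y i p \<in> C" if "p \<in> C" for p i
    using coeff_in_idl[OF fG(1) GS(1)] idl_extend_vars[OF _ GS(1), of V] that CN(1) by blast
  have Ny: "coeff_in y i p \<in> N" if "p \<in> N" for p i
    using coeff_in_idl[OF fG(2) GS(2)] idl_extend_vars[OF _ GS(2), of V] that CN(2) by blast
  have inV: "initial_form y ` (I - {0}) \<subseteq> polys V" using initial_form_polys IV by blast
  have deg_in_ideal: "d \<le> mdeg m" if "p \<in> initial_form_ideal V y I" "m \<in> keys p" for p m
  proof (rule min_degree_idl[OF inV _ that(1)[unfolded initial_form_ideal_def] that(2)])
    fix f m assume f: "f \<in> initial_form y ` (I - {0})" "m \<in> keys f"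
    then obtain g where g: "g \<in> I" "f = initial_form y g" by blast
    have "m \<in> keys g" using f(2) g(2) by (simp add: in_keys_iff lookup_initial_form split: if_splits)
    with g(1) show "d \<le> mdeg m" by (rule product_saturated_degree[OF ps])
  qed
  have deg_C: "d \<le> Suc (mdeg m)" if f: "f \<in> C" "m \<in> keys f" for f m
  proof -
    have fV': "f \<in> polys V" using ideal_subset[OF iC f(1)] .
    have yV': "(Var y :: 'k mpoly) \<in> polys V" using yV by simp
    have "Var y * f \<in> C" using ideal_mult[OF iC f(1) yV'] .
    moreover have "f * Var y \<in> idl V {Var y}" unfolding idl_singleton[OF yV'] using fV' by blast
    then have "0 + f * Var y \<in> N <+>\<^bsub>mpoly_ring V\<^esub> idl V {Var y}"
      unfolding set_add_mpoly_ring using ideal_0[OF iN] by blast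
    ultimately have "Var y * f \<in> initial_form_ideal V y I" unfolding inI by (simp add: mult.commute)
    moreover have "single y 1 + m \<in> keys (Var y * f)"
      using f(2) lookup_single_mult[of "single y 1" 1 f m] by (simp add: in_keys_iff Var_def)
    ultimately show ?thesis using deg_in_ideal[of "Var y * f" "single y 1 + m"] by (simp add: mdeg_add)
  qed
  have lead_C: "lead_coeff_in y g \<in> C" if "g \<in> I" "g \<noteq> 0" for g
  proof -
    have "initial_form y g \<in> initial_form_ideal V y I"
      unfolding initial_form_ideal_def using idl_incl[OF inV] that by blast
    then have "initial_form y g \<in> C" unfolding inI by blast
    then show ?thesis using Cy coeff_in_initial_form by metis
  qed
  have NI: "N \<subseteq> I"
    unfolding CN(2)
  proof (rule idl_least[OF iI], rule image_subsetI)
    fix g assume g: "g \<in> {g \<in> G. deg_in y g = 0}"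
    then have "g \<in> polys ?S"
      using G(2) IV deg_in_ge[of _ g y] by (auto simp: polys_Diff_iff)
    moreover have "g \<in> I" "g \<noteq> 0" using g G(2) by auto
    ultimately show "lead_coeff_in y g \<in> I" using deg_in_0(3)[of g V y] by simp
  qed
  have IN: "p \<in> N" if p: "p \<in> I" "p \<in> polys ?S" for p
  proof (cases "p = 0")
    case True
    then show ?thesis using ideal_0[OF iN] by simp
  next
    case False
    have "initial_form y p \<in> initial_form_ideal V y I"
      unfolding initial_form_ideal_def using idl_incl[OF inV] p False by blast
    then have "p \<in> N <+>\<^bsub>mpoly_ring V\<^esub> idl V {Var y}"
      unfolding inI deg_in_0(2)[OF p(2) False] by blast
    then obtain n r where nr: "p = n + r * Var y" "n \<in> N"
      unfolding set_add_mpoly_ring idl_singleton[OF Var_polys[OF yV]] by blast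
    have "p = coeff_in y 0 n"
      using nr(1) coeff_in_without[OF p(2), of 0] by (simp add: coeff_in_add coeff_in_mult_Var)
    then show ?thesis using Ny[OF nr(2)] by simp
  qed
  have FV: "F \<subseteq> polys V" using linear_forms_subset_polys[OF FL] .
  have prod0: "\<Prod>D \<noteq> 0" if "D \<subseteq> F" for D
    using that F0 finite_subset[OF that fF] by (auto simp: prod_zero_iff)
  have prod_hom: "homogeneous (card D) (\<Prod>D)" if "D \<subseteq> F" for D
    using homogeneous_prod[of D "\<lambda>L. L"] homogeneous_linear_form that FL finite_subset[OF that fF] by blast
  let ?y = "single y (1 :: nat)"
  \<comment> \<open>If y occurred in two of the forms, then in a product of d forms its degree would be at least two, and
    the leading coefficient in y would be an element of C of degree at most \<open>d - 2\<close>.\<close>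
  have unique: "L = L'" if L: "L \<in> F" "L' \<in> F" "lookup L ?y \<noteq> 0" "lookup L' ?y \<noteq> 0" for L L'
  proof (rule ccontr)
    assume ne: "L \<noteq> L'"
    have "card (F - {L, L'}) = card F - 2" using L ne fF by (simp add: card_Diff_subset)
    then have "d - 2 \<le> card (F - {L, L'})" using d by simp
    then obtain B where B: "B \<subseteq> F - {L, L'}" "card B = d - 2" "finite B" by (rule obtain_subset_with_card_n)
    define D where "D = insert L (insert L' B)"
    have D: "D \<subseteq> F" "finite D" "card D = d" using B L d ne by (auto simp: D_def card_insert_if)
    let ?lt = "var_first_order y"
    note mo = monomial_order_var_first[of V y]
    define u where "u = (\<lambda>M :: 'k mpoly. lead_monom ?lt M)"
    have u: "is_lead ?lt (u M) M" if "M \<in> D" for M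
      unfolding u_def by (rule lead_monom_is_lead[OF mo]) (use that D(1) FV F0 in auto)
    have uy: "u M = ?y" if "M \<in> {L, L'}" for M
      unfolding u_def
      by (rule lead_monom_eq[OF mo _ lead_var_first[OF _ yV]]) (use that L FL FV in auto)
    have "is_lead ?lt (\<Sum>M\<in>D. u M) (\<Prod>M\<in>D. M)"
      by (rule is_lead_prod[OF mo D(2)]) (use D(1) FV u in blast)
    then have k: "(\<Sum>M\<in>D. u M) \<in> keys (\<Prod>D)" by (simp add: is_lead_def)
    have "L \<notin> insert L' B" "L' \<notin> B" using B(1) ne by auto
    then have "(\<Sum>M\<in>D. u M) = ?y + (?y + sum u B)" using B(3) uy by (simp add: D_def)
    then have "2 \<le> lookup (\<Sum>M\<in>D. u M) y" by (simp add: lookup_add)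
    then have dg: "2 \<le> deg_in y (\<Prod>D)" using deg_in_ge[OF k, of y] by linarith
    have DI: "\<Prod>D \<in> I" by (rule product_saturated_prod[OF ps D(1,3)])
    have "lead_coeff_in y (\<Prod>D) \<noteq> 0" by (rule lead_coeff_in_nonzero[OF prod0[OF D(1)]])
    then obtain m where m: "m \<in> keys (lead_coeff_in y (\<Prod>D))" by (metis keys_eq_empty ex_in_conv)
    then have "m + single y (deg_in y (\<Prod>D)) \<in> keys (\<Prod>D)"
      by (auto simp: in_keys_iff lead_coeff_in_def lookup_coeff_in split: if_splits)
    then have "mdeg m + deg_in y (\<Prod>D) = d"
      using prod_hom[OF D(1)] D(3) by (auto simp: homogeneous_def mdeg_add)
    moreover have "d \<le> Suc (mdeg m)" by (rule deg_C[OF lead_C[OF DI prod0[OF D(1)]] m])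
    ultimately show False using dg by linarith
  qed
  define F' where "F' = {L \<in> F. lookup L ?y = 0}"
  have F': "F' \<subseteq> F" "finite F'" using fF by (auto simp: F'_def)
  have F'L: "F' \<subseteq> linear_forms ?S" using FL linear_forms_Diff_iff by (auto simp: F'_def)
  have F'S: "F' \<subseteq> polys ?S" using linear_forms_subset_polys[OF F'L] .
  have fS: "finite ?S" using fV by simp
  have triN: "triangular ?S F'" if "d \<le> card F'"
  proof (rule decomposition.IH(2)[OF fS F'(2) F'L _ d(1) that])
    show "0 \<notin> F'" using F0 F'(1) by blast
    show "product_saturated (N \<inter> polys ?S) F' d"
      unfolding product_saturated_def
    proof (intro conjI allI impI)
      show "\<forall>p\<in>N \<inter> polys ?S. \<forall>m\<in>keys p. d \<le> mdeg m"
        using NI product_saturated_degree[OF ps] by auto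
      fix D assume D: "D \<subseteq> F'" "card D = d"
      have "\<Prod>D \<in> polys ?S" using D(1) F'S by (intro polys_prod) blast
      moreover have "\<Prod>D \<in> I" using product_saturated_prod[OF ps _ D(2)] D(1) F'(1) by simp
      ultimately show "\<Prod>D \<in> N \<inter> polys ?S" using IN by blast
    qed
  qed
  show ?case
  proof (cases "F' = F")
    case True
    then show ?thesis using triN d(2) triangular_mono[of ?S F V] by auto
  next
    case False
    then obtain M where M: "M \<in> F" "lookup M ?y \<noteq> 0" by (auto simp: F'_def)
    then have F: "F = insert M F'" "M \<notin> F'" using unique by (auto simp: F'_def)
    have cF: "card F = Suc (card F')" using F F'(2) by simp
    have "triangular ?S F'"
    proof (cases "d \<le> card F'")
      case False
      then have cF': "card F' = d - 1" "card F = d" using cF d by auto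
      show ?thesis
      proof (cases "d = 2")
        case True
        then obtain L where L: "F' = {L}" using cF' card_1_singletonE by auto
        then have Llin: "L \<in> linear_forms ?S" and "L \<noteq> 0" using F'L F'(1) F0 by auto
        then obtain z where z: "z \<in> ?S" "lookup L (single z 1) \<noteq> 0" by (rule linear_form_has_variable)
        show ?thesis unfolding L by (rule triangular.insert[OF z(1) triangular.empty Llin z(2)])
      next
        case d2: False
        show ?thesis
        proof (rule decomposition.IH(1)[OF fS F'(2) F'L])
          show "0 \<notin> F'" using F0 F'(1) by blast
          show "2 \<le> d - 1" "d - 1 \<le> card F'" using d d2 cF' by auto
          show "product_saturated (C \<inter> polys ?S) F' (d - 1)"
            unfolding product_saturated_def
          proof (intro conjI allI impI)
            show "\<forall>p\<in>C \<inter> polys ?S. \<forall>m\<in>keys p. d - 1 \<le> mdeg m" using deg_C by fastforce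
            fix D assume D: "D \<subseteq> F'" "card D = d - 1"
            then have DF: "D = F'" using cF'(1) F'(2) card_subset_eq by metis
            have PS: "\<Prod>F' \<in> polys ?S" using F'S by (intro polys_prod) blast
            have P: "\<Prod>F = M * \<Prod>F'" using F F'(2) by simp
            have FI: "\<Prod>F \<in> I" using product_saturated_prod[OF ps _ cF'(2)] by simp
            have "lead_coeff_in y (M * \<Prod>F') = single 0 (lookup M ?y) * \<Prod>F'"
              using lead_coeff_linear_mult(2)[OF _ M(2) PS prod0[OF F'(1)]] FL M(1) by blast
            then have "lead_coeff_in y (\<Prod>F) = single 0 (lookup M ?y) * \<Prod>F'" unfolding P .
            then have "single 0 (lookup M ?y) * \<Prod>F' \<in> C"
              using lead_C[OF FI prod0[of F]] by simp
            from ideal_mult[OF iC this, of "single 0 (inverse (lookup M ?y))"]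
            have "(single 0 (inverse (lookup M ?y)) * single 0 (lookup M ?y)) * \<Prod>F' \<in> C"
              by (simp add: mult.assoc)
            then have "\<Prod>F' \<in> C" using M(2) by (simp add: mult_single)
            then show "\<Prod>D \<in> C \<inter> polys ?S" using DF PS by simp
          qed
        qed
      qed
    qed (rule triN)
    then show ?thesis unfolding F(1)
      using triangular.insert[OF yV _ _ M(2)] FL M(1) by blast
  qed
qed

section \<open>Triangular forms give Knutson ideals\<close>

definition del_var :: "nat \<Rightarrow> monom \<Rightarrow> monom" where
  "del_var y a = a - single y (lookup a y)"

lemma lookup_del_var: "lookup (del_var y a) i = (if i = y then 0 else lookup a i)"
  by (simp add: del_var_def lookup_minus lookup_single when_def)

lemma del_var_add: "del_var y (a + b) = del_var y a + del_var y b"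
  by (intro poly_mapping_eqI) (simp add: lookup_del_var lookup_add)

lemma del_var_id: "lookup a y = 0 \<Longrightarrow> del_var y a = a"
  by (intro poly_mapping_eqI) (simp add: lookup_del_var)

lemma del_var_monoms: "a \<in> monoms V \<Longrightarrow> del_var y a \<in> monoms (V - {y})"
  by (auto simp: monoms_def in_keys_iff lookup_del_var subset_iff split: if_splits)

definition extend_order :: "nat \<Rightarrow> monom_rel \<Rightarrow> monom_rel" where
  "extend_order y lt a b \<longleftrightarrow>
     lookup a y < lookup b y \<or> lookup a y = lookup b y \<and> lt (del_var y a) (del_var y b)"

lemma monomial_order_extend:
  assumes mo: "monomial_order (V - {y}) lt"
  shows "monomial_order V (extend_order y lt)"
  unfolding monomial_order_def
proof (intro conjI ballI impI)
  fix a assume a: "a \<in> monoms V"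
  note da = del_var_monoms[OF a, of y]
  show "\<not> extend_order y lt a a" using mo_irrefl[OF mo da] by (simp add: extend_order_def)
  show "extend_order y lt 0 a" if "a \<noteq> 0"
  proof (cases "lookup a y = 0")
    case True
    then have "lt 0 (del_var y a)" using mo_zero[OF mo da] that by (simp add: del_var_id)
    then show ?thesis using True by (simp add: extend_order_def del_var_id)
  qed (simp add: extend_order_def)
  fix b assume b: "b \<in> monoms V"
  note db = del_var_monoms[OF b, of y]
  show "extend_order y lt a b \<or> extend_order y lt b a" if "a \<noteq> b"
  proof (cases "lookup a y = lookup b y")
    case True
    have "del_var y a \<noteq> del_var y b"
    proof
      assume "del_var y a = del_var y b"
      then have "lookup (del_var y a) i = lookup (del_var y b) i" for i by simp
      then have "lookup a i = lookup b i" for i using True by (metis lookup_del_var)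
      then show False using that poly_mapping_eqI by blast
    qed
    then show ?thesis using mo_total[OF mo da db] True by (auto simp: extend_order_def)
  qed (auto simp: extend_order_def)
  fix c assume c: "c \<in> monoms V"
  note dc = del_var_monoms[OF c, of y]
  show "extend_order y lt a c" if "extend_order y lt a b" "extend_order y lt b c"
    using that mo_trans[OF mo da db dc] by (auto simp: extend_order_def)
  show "extend_order y lt (a + c) (b + c)" if "extend_order y lt a b"
    using that mo_add[OF mo da db dc] by (auto simp: extend_order_def lookup_add del_var_add)
qed

text \<open>In the lexicographic order that compares the pivots in the order of elimination, each pivot is
  the leading monomial of its form.\<close>

lemma triangular_squarefree_lead:
  fixes F :: "('a::field) mpoly set"
  assumes "triangular V F"
  shows "\<exists>lt u. monomial_order V lt \<and> is_lead lt u (\<Prod>F) \<and> squarefree_monom u"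
  using assms
proof (induction rule: triangular.induct)
  case (empty V)
  have "is_lead (<) 0 (\<Prod>({} :: 'a mpoly set))" by (simp add: is_lead_def)
  then show ?case using monomial_order_less[of V]
    by (intro exI[of _ "(<)"] exI[of _ 0]) (simp add: squarefree_monom_def)
next
  case (insert y V F M)
  then obtain lt u where lt: "monomial_order (V - {y}) lt" "is_lead lt u (\<Prod>F)" "squarefree_monom u" by blast
  let ?lt = "extend_order y lt"
  note mo = monomial_order_extend[OF lt(1)]
  note tl = triangular_linear_forms[OF insert.hyps(2)]
  have PS: "\<Prod>F \<in> polys (V - {y})"
    using linear_forms_subset_polys tl by (intro polys_prod) blast
  then have PV: "\<Prod>F \<in> polys V" using polys_mono[of "V - {y}" V] by blast
  have MV: "M \<in> polys V" using linear_forms_polys[OF insert.hyps(3)] .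
  have uS: "lookup u y = 0" using is_lead_monoms[OF lt(2) PS] by (simp add: monoms_Diff_iff)
  have "is_lead ?lt u (\<Prod>F)"
    unfolding is_lead_def
  proof (intro conjI ballI impI)
    show "u \<in> keys (\<Prod>F)" using lt(2) by (simp add: is_lead_def)
    fix m assume m: "m \<in> keys (\<Prod>F)" "m \<noteq> u"
    then have "lookup m y = 0" using PS by (simp add: polys_Diff_iff)
    moreover have "lt m u" using lt(2) m by (simp add: is_lead_def)
    ultimately show "?lt m u" using uS by (simp add: extend_order_def del_var_id)
  qed
  moreover have "is_lead ?lt (single y 1) M"
    unfolding is_lead_def
  proof (intro conjI ballI impI)
    show "single y 1 \<in> keys M" using insert.hyps(4) by (simp add: in_keys_iff)
    fix m assume m: "m \<in> keys M" "m \<noteq> single y 1"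
    then obtain i where "m = single i 1" "i \<noteq> y" using insert.hyps(3) unfolding linear_forms_def by blast
    then show "?lt m (single y 1)" by (simp add: extend_order_def lookup_single when_def)
  qed
  ultimately have "is_lead ?lt (single y 1 + u) (M * \<Prod>F)" using is_lead_mult[OF mo MV PV] by blast
  moreover have "\<Prod>(insert M F) = M * \<Prod>F"
    using tl triangular_step_notin[OF insert.hyps(2,4)] by simp
  moreover have "squarefree_monom (single y 1 + u)"
    using lt(3) uS by (auto simp: squarefree_monom_def lookup_add lookup_single when_def)
  ultimately show ?case using mo by (intro exI[of _ ?lt] exI[of _ "single y 1 + u"]) simp
qed

lemma star_eq_Inter:
  fixes F :: "('a::comm_ring_1) mpoly set"
  assumes F: "finite F" "F \<subseteq> polys V" and c: "c \<le> card F"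
  shows "star V F c = \<Inter>(idl V ` {J. J \<subseteq> F \<and> card J = c})"
    and "{J. J \<subseteq> F \<and> card J = c} \<noteq> {}" and "finite {J. J \<subseteq> F \<and> card J = c}"
proof -
  obtain J where J: "J \<subseteq> F" "card J = c" using c by (rule obtain_subset_with_card_n)
  then show ne: "{J. J \<subseteq> F \<and> card J = c} \<noteq> {}" by blast
  show "finite {J. J \<subseteq> F \<and> card J = c}" using F(1) by simp
  have "idl V J \<subseteq> polys V" using J F(2) by (intro idl_subset_polys) blast
  then have "p \<in> polys V" if "p \<in> \<Inter>(idl V ` {J. J \<subseteq> F \<and> card J = c})" for p
    using that J by blast
  then show "star V F c = \<Inter>(idl V ` {J. J \<subseteq> F \<and> card J = c})" unfolding star_def by auto
qed

text \<open>For the product f of all forms, the ideal of a form is the colon ideal of (f) by the product of the other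
  forms, and the star ideal is an intersection of sums of such ideals.\<close>

theorem triangular_imp_knutson:
  fixes F :: "('a::field) mpoly set"
  assumes tri: "triangular V F" and c: "1 \<le> c" "c \<le> card F"
  shows "knutson_ideal V (star V F c)"
proof -
  obtain lt u where lt: "monomial_order V lt" "is_lead lt u (\<Prod>F)" "squarefree_monom u"
    using triangular_squarefree_lead[OF tri] by blast
  note tl = triangular_linear_forms[OF tri]
  have fF: "finite F" and FV: "F \<subseteq> polys V" using tl linear_forms_subset_polys by auto
  let ?f = "\<Prod>F" and ?K = "knutson_set V (\<Prod>F)"
  have fV: "?f \<in> polys V" using FV by (intro polys_prod) blast
  have f0: "?f \<noteq> 0" using lt(2) by (auto simp: is_lead_def)
  have one: "idl V {M} \<in> ?K" if M: "M \<in> F" for M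
  proof -
    define P where "P = \<Prod>(F - {M})"
    have PV: "P \<in> polys V" unfolding P_def using FV by (intro polys_prod) blast
    have MV: "M \<in> polys V" using M FV by blast
    have f: "?f = M * P" using M fF by (simp add: P_def prod.remove)
    then have P0: "P \<noteq> 0" using f0 by auto
    have if1: "ideal (idl V {?f}) (mpoly_ring V)" using fV by (intro ideal_idl) simp
    have iP: "ideal (idl V {P}) (mpoly_ring V)" using PV by (intro ideal_idl) simp
    have "colon (mpoly_ring V) (idl V {?f}) (idl V {P}) = {r \<in> polys V. r * P \<in> idl V {?f}}"
      using colon_idl[OF if1, of "{P}"] PV by simp
    also have "\<dots> = idl V {M}"
    proof (intro equalityI subsetI)
      fix r assume r: "r \<in> {r \<in> polys V. r * P \<in> idl V {?f}}"
      then obtain s where s: "s \<in> polys V" "r * P = s * ?f" using idl_singleton[OF fV] by auto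
      then have "(r - s * M) * P = 0" by (simp add: f algebra_simps)
      then have "r = s * M" using P0 by simp
      then show "r \<in> idl V {M}" using s(1) idl_singleton[OF MV] by blast
    next
      fix r assume "r \<in> idl V {M}"
      then obtain s where s: "s \<in> polys V" "r = s * M" using idl_singleton[OF MV] by blast
      then have "r * P = s * ?f" by (simp add: f mult.assoc)
      then show "r \<in> {r \<in> polys V. r * P \<in> idl V {?f}}"
        using s MV idl_singleton[OF fV] by auto
    qed
    finally show ?thesis using knutson_set.colon[OF knutson_set.principal iP] by metis
  qed
  have sums: "idl V J \<in> ?K" if "finite J" "J \<noteq> {}" "J \<subseteq> F" for J
    using that
  proof (induction rule: finite_ne_induct)
    case (singleton M)
    then show ?case using one by simp
  next
    case (insert M J)
    have "idl V (insert M J) = idl V {M} <+>\<^bsub>mpoly_ring V\<^esub> idl V J"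
      using insert.prems FV by (intro idl_insert_set_add) auto
    then show ?case using knutson_set.sum[OF one[of M] insert.IH] insert.prems by auto
  qed
  have inters: "\<Inter>S \<in> ?K" if "finite S" "S \<noteq> {}" "S \<subseteq> ?K" for S
    using that
  proof (induction rule: finite_ne_induct)
    case (insert I S)
    then show ?case using knutson_set.inter[of I V ?f "\<Inter>S"] by simp
  qed simp
  have "idl V J \<in> ?K" if "J \<in> {J. J \<subseteq> F \<and> card J = c}" for J
  proof (rule sums)
    show "finite J" using that finite_subset[OF _ fF] by simp
    show "J \<noteq> {}" "J \<subseteq> F" using that c(1) by auto
  qed
  then have "star V F c \<in> ?K"
    unfolding star_eq_Inter(1)[OF fF FV c(2)]
    using star_eq_Inter(2,3)[OF fF FV c(2)] by (intro inters finite_imageI) auto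
  moreover have "squarefree_monom (lead_monom lt ?f)"
    using lead_monom_eq[OF lt(1) fV lt(2)] lt(3) by simp
  ultimately show ?thesis
    unfolding knutson_ideal_def using lt(1) fV f0 by (intro exI[of _ lt] exI[of _ ?f]) simp
qed

section \<open>Dimension and unmixedness\<close>

text \<open>Chains of primes of a quotient are compared in the ring itself, where those for different ideals can be
  put side by side.\<close>

definition prime_chain_above :: "('a, 'b) ring_scheme \<Rightarrow> 'a set \<Rightarrow> nat \<Rightarrow> bool" where
  "prime_chain_above R K r \<longleftrightarrow>
     (\<exists>P :: nat \<Rightarrow> 'a set. (\<forall>i\<le>r. primeideal (P i) R \<and> K \<subseteq> P i) \<and> (\<forall>i<r. P i \<subset> P (Suc i)))"

lemma primeideal_image:
  assumes R: "cring R" and S: "cring S" and h: "ring_hom_ring R S h" and surj: "h ` carrier R = carrier S"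
    and P: "primeideal P R" and ker: "a_kernel R S h \<subseteq> P"
  shows "primeideal (h ` P) S" and "\<And>x. x \<in> carrier R \<Longrightarrow> h x \<in> h ` P \<longleftrightarrow> x \<in> P"
proof -
  interpret ring_hom_ring R S h by (rule h)
  interpret P: primeideal P R by (rule P)
  show mem: "h x \<in> h ` P \<longleftrightarrow> x \<in> P" if x: "x \<in> carrier R" for x
  proof
    assume "h x \<in> h ` P"
    then obtain p where p: "p \<in> P" "h x = h p" by blast
    then have pR: "p \<in> carrier R" using P.Icarr by blast
    have "h (x \<ominus>\<^bsub>R\<^esub> p) = h x \<oplus>\<^bsub>S\<^esub> \<ominus>\<^bsub>S\<^esub> h p"
      unfolding a_minus_def using hom_add[OF x R.a_inv_closed[OF pR]] hom_a_inv[OF pR] by (simp only:)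
    also have "\<dots> = \<zero>\<^bsub>S\<^esub>" unfolding p(2) by (rule S.r_neg[OF hom_closed[OF pR]])
    finally have "h (x \<ominus>\<^bsub>R\<^esub> p) = \<zero>\<^bsub>S\<^esub>" .
    with R.minus_closed[OF x pR] have "x \<ominus>\<^bsub>R\<^esub> p \<in> a_kernel R S h"
      unfolding a_kernel_def' by blast
    then have d: "x \<ominus>\<^bsub>R\<^esub> p \<in> P" using ker by blast
    have "(x \<ominus>\<^bsub>R\<^esub> p) \<oplus>\<^bsub>R\<^esub> p = x"
      unfolding a_minus_def
      using R.a_assoc[OF x R.a_inv_closed[OF pR] pR] R.l_neg[OF pR] R.r_zero[OF x] by (simp only:)
    then show "x \<in> P"
      using additive_subgroup.a_closed[OF P.additive_subgroup_axioms d p(1)] by (simp only:)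
  qed blast
  show "primeideal (h ` P) S"
  proof (rule primeidealI)
    show "cring S" by (rule S)
    show "ideal (h ` P) S"
    proof (rule idealI)
      show "ring S" by (rule S.ring_axioms)
      show "subgroup (h ` P) (add_monoid S)"
        by (rule img_is_add_subgroup[OF P.a_subgroup])
      fix a x assume "a \<in> h ` P" "x \<in> carrier S"
      then obtain p r where pr: "p \<in> P" "a = h p" "r \<in> carrier R" "x = h r"
        unfolding surj[symmetric] by blast
      have "x \<otimes>\<^bsub>S\<^esub> a = h (r \<otimes>\<^bsub>R\<^esub> p)" "a \<otimes>\<^bsub>S\<^esub> x = h (p \<otimes>\<^bsub>R\<^esub> r)"
        using pr P.Icarr by auto
      then show "x \<otimes>\<^bsub>S\<^esub> a \<in> h ` P" "a \<otimes>\<^bsub>S\<^esub> x \<in> h ` P"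
        using imageI[OF P.I_l_closed[OF pr(1,3)], of h] imageI[OF P.I_r_closed[OF pr(1,3)], of h]
        by (simp_all only:)
    qed
    show "carrier S \<noteq> h ` P"
    proof
      assume "carrier S = h ` P"
      then have "h \<one>\<^bsub>R\<^esub> \<in> h ` P" using hom_closed[OF R.one_closed] by (simp only:)
      then have "\<one>\<^bsub>R\<^esub> \<in> P" using mem[OF R.one_closed] by blast
      then show False using P.one_imp_carrier P.I_notcarr by simp
    qed
    fix a b assume ab: "a \<in> carrier S" "b \<in> carrier S" "a \<otimes>\<^bsub>S\<^esub> b \<in> h ` P"
    then obtain x y where xy: "x \<in> carrier R" "a = h x" "y \<in> carrier R" "b = h y" unfolding surj[symmetric] by blast
    have "h (x \<otimes>\<^bsub>R\<^esub> y) \<in> h ` P" using ab(3) unfolding xy(2,4) hom_mult[OF xy(1,3)] .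
    then have "x \<otimes>\<^bsub>R\<^esub> y \<in> P" using mem[OF R.m_closed[OF xy(1,3)]] by blast
    then show "a \<in> h ` P \<or> b \<in> h ` P" using P.I_prime xy by blast
  qed
qed

lemma krull_dim_surjective:
  fixes R :: "('a, 'm) ring_scheme" and S :: "('b, 'n) ring_scheme"
  assumes R: "cring R" and S: "cring S" and h: "ring_hom_ring R S h" and surj: "h ` carrier R = carrier S"
  shows "krull_dim S = Sup {enat r | r. prime_chain_above R (a_kernel R S h) r}"
proof -
  interpret ring_hom_ring R S h by (rule h)
  have "(\<exists>Q :: nat \<Rightarrow> 'b set. (\<forall>i\<le>r. primeideal (Q i) S) \<and> (\<forall>i<r. Q i \<subset> Q (Suc i)))
      \<longleftrightarrow> prime_chain_above R (a_kernel R S h) r" for r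
  proof
    assume "\<exists>Q :: nat \<Rightarrow> 'b set. (\<forall>i\<le>r. primeideal (Q i) S) \<and> (\<forall>i<r. Q i \<subset> Q (Suc i))"
    then obtain Q :: "nat \<Rightarrow> 'b set"
      where "(\<forall>i\<le>r. primeideal (Q i) S) \<and> (\<forall>i<r. Q i \<subset> Q (Suc i))" by (elim exE)
    then have Q: "\<And>i. i \<le> r \<Longrightarrow> primeideal (Q i) S" "\<And>i. i < r \<Longrightarrow> Q i \<subset> Q (Suc i)" by simp_all
    let ?P = "\<lambda>i. {x \<in> carrier R. h x \<in> Q i}"
    have p: "primeideal (?P i) R" if "i \<le> r" for i by (rule primeideal_vimage[OF R Q(1)[OF that]])
    have k: "a_kernel R S h \<subseteq> ?P i" if i: "i \<le> r" for i
    proof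
      fix x assume "x \<in> a_kernel R S h"
      then have "x \<in> carrier R" "h x = \<zero>\<^bsub>S\<^esub>" unfolding a_kernel_def' by blast+
      moreover have "\<zero>\<^bsub>S\<^esub> \<in> Q i"
        by (rule additive_subgroup.zero_closed[OF ideal.axioms(1)[OF primeideal.axioms(1)[OF Q(1)[OF i]]]])
      ultimately show "x \<in> ?P i" by (simp only: mem_Collect_eq)
    qed
    have s: "?P i \<subset> ?P (Suc i)" if i: "i < r" for i
    proof -
      obtain b where b: "b \<in> Q (Suc i)" "b \<notin> Q i" using Q(2)[OF i] by blast
      have "b \<in> carrier S"
        by (rule ideal.Icarr[OF primeideal.axioms(1)[OF Q(1)[of "Suc i"]] b(1)]) (use i in simp)
      then obtain x where x: "x \<in> carrier R" "b = h x" unfolding surj[symmetric] by blast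
      then have "x \<in> ?P (Suc i)" "x \<notin> ?P i" using b by simp_all
      moreover have "?P i \<subseteq> ?P (Suc i)" using Q(2)[OF i] by blast
      ultimately show ?thesis by blast
    qed
    show "prime_chain_above R (a_kernel R S h) r"
      unfolding prime_chain_above_def
      by (intro exI[of _ ?P] conjI allI impI) (use p k s in simp_all)
  next
    assume "prime_chain_above R (a_kernel R S h) r"
    then obtain P :: "nat \<Rightarrow> 'a set"
      where "(\<forall>i\<le>r. primeideal (P i) R \<and> a_kernel R S h \<subseteq> P i) \<and> (\<forall>i<r. P i \<subset> P (Suc i))"
      unfolding prime_chain_above_def by (elim exE)
    then have P: "\<And>i. i \<le> r \<Longrightarrow> primeideal (P i) R" "\<And>i. i \<le> r \<Longrightarrow> a_kernel R S h \<subseteq> P i"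
      "\<And>i. i < r \<Longrightarrow> P i \<subset> P (Suc i)" by simp_all
    have s: "h ` P i \<subset> h ` P (Suc i)" if i: "i < r" for i
    proof -
      have ir: "i \<le> r" "Suc i \<le> r" using i by simp_all
      obtain x where x: "x \<in> P (Suc i)" "x \<notin> P i" using P(3)[OF i] by blast
      have xR: "x \<in> carrier R" by (rule ideal.Icarr[OF primeideal.axioms(1)[OF P(1)[OF ir(2)]] x(1)])
      have "h x \<notin> h ` P i"
        using primeideal_image(2)[OF R S h surj P(1)[OF ir(1)] P(2)[OF ir(1)] xR] x(2) by blast
      moreover have "h x \<in> h ` P (Suc i)" using x(1) by (rule imageI)
      moreover have "h ` P i \<subseteq> h ` P (Suc i)" using P(3)[OF i] by (intro image_mono) blast
      ultimately show ?thesis by blast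
    qed
    have p: "primeideal (h ` P i) S" if "i \<le> r" for i
      by (rule primeideal_image(1)[OF R S h surj P(1)[OF that] P(2)[OF that]])
    show "\<exists>Q :: nat \<Rightarrow> 'b set. (\<forall>i\<le>r. primeideal (Q i) S) \<and> (\<forall>i<r. Q i \<subset> Q (Suc i))"
      by (intro exI[of _ "\<lambda>i. h ` P i"] conjI allI impI) (use p s in simp_all)
  qed
  then show ?thesis unfolding krull_dim_def by (simp only:)
qed

lemma krull_dim_quotient:
  assumes R: "cring R" and I: "ideal I R"
  shows "krull_dim (R Quot I) = Sup {enat r | r. prime_chain_above R I r}"
proof -
  interpret ideal I R by (rule I)
  have h: "ring_hom_ring R (R Quot I) ((+>\<^bsub>R\<^esub>) I)" by (rule rcos_ring_hom_ring)
  have surj: "(+>\<^bsub>R\<^esub>) I ` carrier R = carrier (R Quot I)"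
    by (auto simp: FactRing_simps)
  have "a_kernel R (R Quot I) ((+>\<^bsub>R\<^esub>) I) = I"
  proof (intro equalityI subsetI)
    fix x assume "x \<in> a_kernel R (R Quot I) ((+>\<^bsub>R\<^esub>) I)"
    then have "x \<in> carrier R" "I +>\<^bsub>R\<^esub> x = I" by (auto simp: a_kernel_def' FactRing_def)
    then show "x \<in> I" using rcos_const_imp_mem by blast
  next
    fix x assume x: "x \<in> I"
    then have "I +>\<^bsub>R\<^esub> x = I" by (rule a_rcos_zero[OF I])
    then show "x \<in> a_kernel R (R Quot I) ((+>\<^bsub>R\<^esub>) I)"
      using x Icarr by (simp add: a_kernel_def' FactRing_def)
  qed
  then show ?thesis
    using krull_dim_surjective[OF R quotient_is_cring[OF R] h surj] by simp
qed

lemma ring_hom_subst: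
  fixes \<phi> :: "nat \<Rightarrow> ('a::comm_ring_1) mpoly"
  assumes "\<And>i. i \<in> V \<Longrightarrow> \<phi> i \<in> polys W"
  shows "ring_hom_ring (mpoly_ring V) (mpoly_ring W) (subst_mpoly \<phi>)"
proof (rule ring_hom_ringI)
  show "ring (mpoly_ring V :: 'a mpoly ring)" "ring (mpoly_ring W :: 'a mpoly ring)"
    using cring_mpoly_ring cring.axioms(1) by blast+
  show "subst_mpoly \<phi> x \<in> polys W" if "x \<in> polys V" for x
    using subst_polys[of x V \<phi> W, OF that assms] .
qed (simp_all add: subst_add subst_mult)

lemma triangular_primeideal:
  fixes F :: "('a::field) mpoly set"
  assumes F: "triangular V F" "finite V"
  shows "primeideal (idl V F) (mpoly_ring V)"
proof (rule primeidealI)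
  have FV: "F \<subseteq> polys V" using triangular_linear_forms[OF F(1)] linear_forms_subset_polys by blast
  show "ideal (idl V F) (mpoly_ring V)" by (rule ideal_idl[OF FV])
  show "cring (mpoly_ring V :: 'a mpoly ring)" by (rule cring_mpoly_ring)
  show "polys V \<noteq> idl V F"
  proof
    assume "polys V = idl V F"
    then have "1 \<in> idl V F" using polys_1 by blast
    then show False using triangular_ideal_prime(1)[OF F] by simp
  qed
  show "\<And>a b. a \<in> polys V \<Longrightarrow> b \<in> polys V \<Longrightarrow> a \<otimes>\<^bsub>mpoly_ring V\<^esub> b \<in> idl V F \<Longrightarrow> a \<in> idl V F \<or> b \<in> idl V F"
    using triangular_ideal_prime(2)[OF F] by simp
qed

lemma krull_dim_renaming:
  assumes "finite W" "finite W'" "card W = card W'"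
  shows "krull_dim (mpoly_ring W :: ('a::field) mpoly ring) = krull_dim (mpoly_ring W' :: 'a mpoly ring)"
proof -
  obtain \<sigma> where \<sigma>: "bij_betw \<sigma> W W'" using finite_same_card_bij[OF assms] by blast
  define \<phi> where "\<phi> = (\<lambda>i. Var (\<sigma> i) :: 'a mpoly)"
  define \<psi> where "\<psi> = (\<lambda>i. Var (the_inv_into W \<sigma> i) :: 'a mpoly)"
  have \<phi>: "\<phi> i \<in> polys W'" if "i \<in> W" for i
    unfolding \<phi>_def using bij_betwE[OF \<sigma>] that by (intro Var_polys) blast
  have \<psi>: "\<psi> i \<in> polys W" if "i \<in> W'" for i
    unfolding \<psi>_def using bij_betwE[OF bij_betw_the_inv_into[OF \<sigma>]] that by (intro Var_polys) blast
  have \<psi>\<phi>: "subst_mpoly \<psi> (subst_mpoly \<phi> p) = p" if "p \<in> polys W" for p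
  proof -
    have "subst_mpoly \<psi> (subst_mpoly \<phi> p) = subst_mpoly Var p"
      unfolding subst_subst
      by (rule subst_cong[OF that]) (use \<sigma> in \<open>simp add: \<phi>_def \<psi>_def the_inv_into_f_f bij_betw_def\<close>)
    then show ?thesis by (simp add: subst_Var_id)
  qed
  have \<phi>\<psi>: "subst_mpoly \<phi> (subst_mpoly \<psi> p) = p" if "p \<in> polys W'" for p
  proof -
    have "subst_mpoly \<phi> (subst_mpoly \<psi> p) = subst_mpoly Var p"
      unfolding subst_subst
      by (rule subst_cong[OF that]) (use \<sigma> in \<open>simp add: \<phi>_def \<psi>_def f_the_inv_into_f_bij_betw\<close>)
    then show ?thesis by (simp add: subst_Var_id)
  qed
  let ?R = "mpoly_ring W :: 'a mpoly ring" and ?S = "mpoly_ring W' :: 'a mpoly ring"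
  have h: "ring_hom_ring ?R ?S (subst_mpoly \<phi>)" using \<phi> by (rule ring_hom_subst)
  have surj: "subst_mpoly \<phi> ` carrier ?R = carrier ?S"
  proof (intro equalityI subsetI)
    fix x assume "x \<in> carrier ?S"
    then have "x = subst_mpoly \<phi> (subst_mpoly \<psi> x)" "subst_mpoly \<psi> x \<in> carrier ?R"
      using \<phi>\<psi> subst_polys[of x W' \<psi> W, OF _ \<psi>] by auto
    then show "x \<in> subst_mpoly \<phi> ` carrier ?R" by blast
  next
    fix x assume "x \<in> subst_mpoly \<phi> ` carrier ?R"
    then show "x \<in> carrier ?S" using subst_polys[of _ W \<phi> W', OF _ \<phi>] by blast
  qed
  have ker: "a_kernel ?R ?S (subst_mpoly \<phi>) = {0}"
  proof (intro equalityI subsetI)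
    fix x assume "x \<in> a_kernel ?R ?S (subst_mpoly \<phi>)"
    then have "x \<in> polys W" "subst_mpoly \<phi> x = 0" by (auto simp: a_kernel_def')
    then show "x \<in> {0}" using \<psi>\<phi>[of x] by simp
  qed (simp add: a_kernel_def')
  have "prime_chain_above ?R {0} r \<longleftrightarrow>
      (\<exists>P :: nat \<Rightarrow> 'a mpoly set. (\<forall>i\<le>r. primeideal (P i) ?R) \<and> (\<forall>i<r. P i \<subset> P (Suc i)))" for r
  proof -
    have "{0} \<subseteq> P" if "primeideal P ?R" for P
      using ideal_0[OF primeideal.axioms(1)[OF that]] by simp
    then show ?thesis unfolding prime_chain_above_def by blast
  qed
  then show ?thesis
    using krull_dim_surjective[OF cring_mpoly_ring cring_mpoly_ring h surj] ker
    unfolding krull_dim_def by simp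
qed

lemma krull_dim_triangular:
  fixes J J' :: "('a::field) mpoly set"
  assumes V: "finite V" and J: "triangular V J" and J': "triangular V J'" and c: "card J = card J'"
  shows "Sup {enat r | r. prime_chain_above (mpoly_ring V) (idl V J) r}
       = Sup {enat r | r. prime_chain_above (mpoly_ring V) (idl V J') r}"
proof -
  have main: "\<exists>W. W \<subseteq> V \<and> card W + card K = card V \<and>
      Sup {enat r | r. prime_chain_above (mpoly_ring V) (idl V K) r} = krull_dim (mpoly_ring W :: 'a mpoly ring)"
    if K: "triangular V K" for K :: "'a mpoly set"
  proof -
    obtain W \<phi> where W: "W \<subseteq> V" "card W + card K = card V" "\<forall>i\<in>V. \<phi> i \<in> polys W" "\<forall>i\<in>W. \<phi> i = Var i"
      "\<forall>p\<in>polys V. subst_mpoly \<phi> p = 0 \<longleftrightarrow> p \<in> idl V K"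
      using triangular_elimination[OF K V] by blast
    let ?R = "mpoly_ring V :: 'a mpoly ring" and ?S = "mpoly_ring W :: 'a mpoly ring"
    have h: "ring_hom_ring ?R ?S (subst_mpoly \<phi>)" by (rule ring_hom_subst) (use W(3) in blast)
    have surj: "subst_mpoly \<phi> ` carrier ?R = carrier ?S"
    proof (intro equalityI subsetI)
      fix x :: "'a mpoly" assume x: "x \<in> carrier ?S"
      have "subst_mpoly \<phi> x = subst_mpoly Var x" by (rule subst_cong[OF x]) (use W(4) in blast)
      then have "x = subst_mpoly \<phi> x" by (simp add: subst_Var_id)
      then show "x \<in> subst_mpoly \<phi> ` carrier ?R" using polys_mono[OF W(1) x] by (rule image_eqI)
    next
      fix x assume "x \<in> subst_mpoly \<phi> ` carrier ?R"
      then obtain p where p: "p \<in> polys V" "x = subst_mpoly \<phi> p" by blast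
      show "x \<in> carrier ?S" unfolding p(2) by (rule subst_polys[OF p(1)]) (use W(3) in blast)
    qed
    have KV: "K \<subseteq> polys V" using triangular_linear_forms[OF K] linear_forms_subset_polys by blast
    have "a_kernel ?R ?S (subst_mpoly \<phi>) = idl V K"
      using W(5) idl_subset_polys[OF KV] by (auto simp: a_kernel_def')
    then show ?thesis using krull_dim_surjective[OF cring_mpoly_ring cring_mpoly_ring h surj] W(1,2) by auto
  qed
  obtain W where W: "W \<subseteq> V" "card W + card J = card V"
    "Sup {enat r | r. prime_chain_above (mpoly_ring V) (idl V J) r} = krull_dim (mpoly_ring W :: 'a mpoly ring)"
    using main[OF J] by blast
  obtain W' where W': "W' \<subseteq> V" "card W' + card J' = card V"
    "Sup {enat r | r. prime_chain_above (mpoly_ring V) (idl V J') r} = krull_dim (mpoly_ring W' :: 'a mpoly ring)"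
    using main[OF J'] by blast
  have "card W = card W'" using W(2) W'(2) c by simp
  then show ?thesis
    using krull_dim_renaming[of W W'] W(1,3) W'(1,3) V by (metis finite_subset)
qed

text \<open>Otherwise the product of elements of the ideals that lie outside P would be in P.\<close>

lemma prime_contains_factor:
  fixes I :: "'i \<Rightarrow> ('a::field) mpoly set"
  assumes P: "primeideal P (mpoly_ring V)" and T: "finite T"
    and I: "\<And>t. t \<in> T \<Longrightarrow> ideal (I t) (mpoly_ring V)"
    and sub: "{p \<in> polys V. \<forall>t\<in>T. p \<in> I t} \<subseteq> P"
  shows "\<exists>t\<in>T. I t \<subseteq> P"
proof (rule ccontr)
  assume "\<not> ?thesis"
  then have "\<forall>t\<in>T. \<exists>x. x \<in> I t \<and> x \<notin> P" by blast
  from bchoice[OF this] obtain x where x: "\<forall>t\<in>T. x t \<in> I t \<and> x t \<notin> P" ..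
  interpret P: primeideal P "mpoly_ring V" by (rule P)
  have xV: "x t \<in> polys V" if "t \<in> T" for t using ideal_subset[OF I[OF that]] x that by blast
  have "prod x U \<in> polys V \<and> prod x U \<notin> P" if "finite U" "U \<subseteq> T" for U
    using that
  proof (induction U)
    case empty
    have "(1 :: 'a mpoly) \<notin> P" using P.one_imp_carrier P.I_notcarr by auto
    then show ?case by simp
  next
    case (insert t U)
    then have "x t * prod x U \<notin> P" using P.I_prime[of "x t" "prod x U"] xV[of t] x by auto
    then show ?case using insert xV[of t] by auto
  qed
  from this[OF T] have p: "prod x T \<in> polys V" "prod x T \<notin> P" by auto
  have "prod x T \<in> I t" if t: "t \<in> T" for t
  proof -
    have "prod x T = prod x (T - {t}) * x t" using T t by (simp add: prod.remove mult.commute)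
    moreover have "prod x (T - {t}) \<in> polys V" using xV by (intro polys_prod) blast
    ultimately show ?thesis using ideal_mult[OF I[OF t]] x t by simp
  qed
  then show False using sub p by blast
qed

text \<open>The associated primes of an intersection of the linear primes are among these primes, and the
  quotients by them are polynomial rings in the same number of variables.\<close>

lemma unmixed_star:
  fixes F :: "('a::field) mpoly set"
  assumes V: "finite V" and tri: "triangular V F"
  shows "unmixed (mpoly_ring V) (star V F c)"
  unfolding unmixed_def
proof
  let ?R = "mpoly_ring V :: 'a mpoly ring" and ?I = "star V F c"
  note tl = triangular_linear_forms[OF tri]
  have fF: "finite F" and FV: "F \<subseteq> polys V" using tl linear_forms_subset_polys by auto
  have iI: "ideal ?I ?R" by (rule ideal_star[OF FV])
  let ?T = "{J. J \<subseteq> F \<and> card J = c}"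
  have fT: "finite ?T" using fF by simp
  have triJ: "triangular V J" if "J \<in> ?T" for J using triangular_subset[OF tri] that by blast
  have primeJ: "primeideal (idl V J) ?R" if "J \<in> ?T" for J using triangular_primeideal[OF triJ[OF that] V] .
  have iJ: "ideal (idl V J) ?R" if "J \<in> ?T" for J using primeideal.axioms(1)[OF primeJ[OF that]] .
  fix P assume "P \<in> associated_primes ?R ?I"
  then obtain f where P: "primeideal P ?R" and f: "f \<in> polys V" "P = colon ?R ?I {f}"
    unfolding associated_primes_def by blast
  let ?T' = "{J \<in> ?T. f \<notin> idl V J}"
  have Peq: "P = {p \<in> polys V. \<forall>J\<in>?T'. p \<in> idl V J}"
  proof (intro equalityI subsetI)
    fix r assume "r \<in> P"
    then have r: "r \<in> polys V" "r * f \<in> ?I" by (auto simp: f(2) colon_def)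
    have "r \<in> idl V J" if J: "J \<in> ?T'" for J
    proof -
      have "r * f \<in> idl V J" using r(2) J by (simp add: star_def)
      then have "r \<in> idl V J \<or> f \<in> idl V J"
        using triangular_ideal_prime(2)[OF triJ V r(1) f(1)] J by blast
      then show ?thesis using J by blast
    qed
    then show "r \<in> {p \<in> polys V. \<forall>J\<in>?T'. p \<in> idl V J}" using r(1) by blast
  next
    fix r assume r: "r \<in> {p \<in> polys V. \<forall>J\<in>?T'. p \<in> idl V J}"
    have "r * f \<in> idl V J" if J: "J \<in> ?T" for J
    proof (cases "f \<in> idl V J")
      case True
      then show ?thesis using ideal_mult[OF iJ[OF J]] r by blast
    next
      case False
      then have "r \<in> idl V J" using r J by blast
      from ideal_mult[OF iJ[OF J] this f(1)] show ?thesis by (subst mult.commute)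
    qed
    then show "r \<in> P" using r f(1) by (auto simp: f(2) colon_def star_def)
  qed
  have "finite ?T'" by (rule finite_subset[OF _ fT]) blast
  from prime_contains_factor[OF P this, of "idl V"] iJ Peq
  obtain J0 where J0: "J0 \<in> ?T'" "idl V J0 \<subseteq> P" by blast
  then have PJ: "P = idl V J0" using Peq by blast
  have J0T: "J0 \<in> ?T" using J0(1) by blast
  have above: "prime_chain_above ?R ?I r \<longleftrightarrow> (\<exists>J\<in>?T. prime_chain_above ?R (idl V J) r)" for r
  proof
    assume "prime_chain_above ?R ?I r"
    then obtain Q where Q: "\<And>i. i \<le> r \<Longrightarrow> primeideal (Q i) ?R" "\<And>i. i \<le> r \<Longrightarrow> ?I \<subseteq> Q i"
      "\<And>i. i < r \<Longrightarrow> Q i \<subset> Q (Suc i)" unfolding prime_chain_above_def by blast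
    have "{p \<in> polys V. \<forall>J\<in>?T. p \<in> idl V J} \<subseteq> Q 0" using Q(2)[of 0] by (auto simp: star_def)
    from prime_contains_factor[OF Q(1)[of 0] fT iJ this] obtain J where J: "J \<in> ?T" "idl V J \<subseteq> Q 0" by auto
    have "Q 0 \<subseteq> Q i" if "i \<le> r" for i
      using that
    proof (induction i)
      case (Suc i)
      then show ?case using Q(3)[of i] by auto
    qed simp
    then have "idl V J \<subseteq> Q i" if "i \<le> r" for i using J(2) that by blast
    then show "\<exists>J\<in>?T. prime_chain_above ?R (idl V J) r"
      unfolding prime_chain_above_def using J(1) Q(1,3) by blast
  next
    assume "\<exists>J\<in>?T. prime_chain_above ?R (idl V J) r"
    moreover have "?I \<subseteq> idl V J" if "J \<in> ?T" for J using that by (auto simp: star_def)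
    ultimately show "prime_chain_above ?R ?I r" unfolding prime_chain_above_def by (meson subset_trans)
  qed
  let ?D = "\<lambda>K. Sup {enat r | r. prime_chain_above ?R K r}"
  have eqD: "?D (idl V J) = ?D (idl V J0)" if "J \<in> ?T" for J
    using krull_dim_triangular[OF V triJ[OF that] triJ[OF J0T]] that J0T by simp
  have "?D ?I = ?D (idl V J0)"
  proof (rule antisym)
    show "?D ?I \<le> ?D (idl V J0)"
    proof (rule Sup_least)
      fix x assume "x \<in> {enat r | r. prime_chain_above ?R ?I r}"
      then obtain r J where r: "x = enat r" "J \<in> ?T" "prime_chain_above ?R (idl V J) r" using above by blast
      then have "x \<le> ?D (idl V J)" by (intro Sup_upper) blast
      then show "x \<le> ?D (idl V J0)" using eqD[OF r(2)] by simp
    qed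
    show "?D (idl V J0) \<le> ?D ?I" by (rule Sup_subset_mono) (use above J0T in blast)
  qed
  then show "krull_dim (?R Quot P) = krull_dim (?R Quot ?I)"
    using krull_dim_quotient[OF cring_mpoly_ring iI] krull_dim_quotient[OF cring_mpoly_ring iJ[OF J0T]] PJ
    by simp
qed

section \<open>Triangular forms give geometrically vertex decomposable ideals\<close>

lemma compatible_var_first: "compatible_order TYPE('a::field) V y (var_first_order y)"
  unfolding compatible_order_def
proof (intro conjI ballI)
  note mo = monomial_order_var_first[of V y]
  show "monomial_order V (var_first_order y)" by (rule mo)
  fix f :: "'a mpoly" assume "f \<in> carrier (mpoly_ring V) - {0}"
  then have f: "f \<in> polys V" "f \<noteq> 0" by auto
  obtain u where u: "is_lead (var_first_order y) u f" using lead_exists[OF mo f] .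
  obtain m where m: "m \<in> keys f" "lookup m y = deg_in y f" using deg_in_attained[OF f(2)] .
  have "lookup u y = deg_in y f"
  proof (rule antisym)
    show "lookup u y \<le> deg_in y f" using u by (intro deg_in_ge) (simp add: is_lead_def)
    show "deg_in y f \<le> lookup u y" using is_lead_le[OF u m(1)] m(2) by (auto simp: var_first_order_def)
  qed
  then have l: "lookup (initial_form y f) u = lookup f u" by (simp add: lookup_initial_form)
  have "is_lead (var_first_order y) u (initial_form y f)"
    using u l by (auto simp: is_lead_def in_keys_iff lookup_initial_form split: if_splits)
  then show "lead_term (var_first_order y) (initial_form y f) = lead_term (var_first_order y) f"
    using lead_monom_eq[OF mo f(1) u] lead_monom_eq[OF mo initial_form_polys[OF f(1)]] l
    by (simp add: lead_term_def)
qed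

text \<open>Adding elements of I to a Groebner basis leaves it a Groebner basis. So generators of the two ideals of a
  decomposition can be inserted at will.\<close>

lemma groebner_basis_superset:
  fixes I :: "('a::field) mpoly set"
  assumes mo: "monomial_order V lt" and I: "ideal I (mpoly_ring V)" and G0: "monic_basis V lt I G0"
    and G: "finite G" "G0 \<subseteq> G" "G \<subseteq> I - {0}"
  shows "groebner_basis V lt I G"
proof -
  have lt_polys: "lead_term lt h \<in> polys V" if "h \<in> I - {0}" for h
  proof -
    have "h \<in> polys V" "h \<noteq> 0" using that ideal_subset[OF I] by auto
    from is_lead_monoms[OF lead_monom_is_lead[OF mo this] this(1)] show ?thesis by (simp add: lead_term_def)
  qed
  have IV: "lead_term lt ` (I - {0}) \<subseteq> polys V" using lt_polys by blast
  have GV: "lead_term lt ` G \<subseteq> polys V" using lt_polys G(3) by blast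
  have "lead_term lt h \<in> idl V (lead_term lt ` G)" if h: "h \<in> I - {0}" for h
  proof -
    have hV: "h \<in> polys V" "h \<noteq> 0" using h ideal_subset[OF I] by auto
    note hl = lead_monom_is_lead[OF mo hV]
    obtain g u where g: "g \<in> G0" "is_lead lt u g" "monom_dvd u (lead_monom lt h)"
      using G0 hl h unfolding monic_basis_def by blast
    have gV: "g \<in> polys V" using g(1) G(2,3) ideal_subset[OF I] by blast
    have lu: "lead_monom lt g = u" by (rule lead_monom_eq[OF mo gV g(2)])
    obtain u' where u': "is_lead lt u' g" "lookup g u' = 1" using G0 g(1) unfolding monic_basis_def by blast
    have "u' = u" using lead_monom_eq[OF mo gV u'(1)] lu by simp
    then have gt: "lead_term lt g = single u 1" using lu u'(2) by (simp add: lead_term_def)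
    obtain w where w: "lead_monom lt h = u + w" using g(3) by (rule monom_dvdE)
    have "w \<in> monoms V" using is_lead_monoms[OF hl hV(1)] w by simp
    then have "single w (lookup h (lead_monom lt h)) * lead_term lt g \<in> idl V (lead_term lt ` G)"
      using g(1) G(2) by (intro ideal_mult[OF ideal_idl[OF GV]] idl_incl[OF GV]) auto
    moreover have "single w (lookup h (lead_monom lt h)) * lead_term lt g = lead_term lt h"
      by (simp add: gt mult_single lead_term_def[of lt h] w add.commute)
    ultimately show ?thesis by simp
  qed
  then have "idl V (lead_term lt ` (I - {0})) \<subseteq> idl V (lead_term lt ` G)"
    by (intro idl_least[OF ideal_idl[OF GV]]) blast
  moreover have "idl V (lead_term lt ` G) \<subseteq> idl V (lead_term lt ` (I - {0}))"
    by (rule idl_mono[OF _ IV]) (use G(3) in blast)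
  ultimately show ?thesis unfolding groebner_basis_def using G by blast
qed

lemma sum_coeff_in_Var_power:
  fixes p :: "('a::comm_ring_1) mpoly"
  shows "p = (\<Sum>i\<le>deg_in y p. coeff_in y i p * Var y ^ i)"
proof (rule poly_mapping_eqI)
  fix m
  have "lookup (\<Sum>i\<le>deg_in y p. coeff_in y i p * Var y ^ i) m
      = (\<Sum>i\<le>deg_in y p. if i = lookup m y then lookup p m else 0)"
    unfolding lookup_sum lookup_coeff_in_mult_Var_power by (intro sum.cong) auto
  also have "\<dots> = lookup p m"
    using deg_in_ge[of m p y] by (auto simp: in_keys_iff)
  finally show "lookup p m = lookup (\<Sum>i\<le>deg_in y p. coeff_in y i p * Var y ^ i) m" ..
qed

lemma ideal_generators_nonzero:
  fixes A :: "('a::field) mpoly set"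
  assumes V: "finite V" and A: "ideal A (mpoly_ring V)"
  obtains H where "finite H" "H \<subseteq> A - {0}" "A = idl V H"
proof -
  obtain H where H: "finite H" "H \<subseteq> A" "A = idl V H"
    using ideal_finitely_generated[OF V monomial_order_less A] .
  have HV: "H \<subseteq> polys V" using H(2) ideal_subset[OF A] by blast
  have HV': "H - {0} \<subseteq> polys V" using HV by blast
  have "H \<subseteq> idl V (H - {0})"
    using ideal_0[OF ideal_idl[OF HV']] idl_incl[OF HV'] by blast
  then have "idl V H \<subseteq> idl V (H - {0})" by (rule idl_least[OF ideal_idl[OF HV']])
  moreover have "idl V (H - {0}) \<subseteq> idl V H" by (rule idl_mono[OF _ HV]) blast
  ultimately have "A = idl V (H - {0})" using H(3) by simp
  then show thesis using that[of "H - {0}"] H(1,2) by blast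
qed

text \<open>The hypotheses express \<open>I = A + M B\<close> through coefficients: those that lead in y range over B, and the elements
  of degree 0 in y form A. The Groebner basis is an arbitrary one, enlarged by generators of A and by
  the products of M with generators of B, so that N and C can be read off from it.\<close>

lemma geometric_vertex_decomposition_linear:
  fixes I A B :: "('a::field) mpoly set"
  assumes V: "finite V" and y: "y \<in> V" and M: "M \<in> linear_forms V" "lookup M (single y 1) \<noteq> 0"
    and I: "ideal I (mpoly_ring V)"
    and A: "ideal A (mpoly_ring (V - {y}))" and B: "ideal B (mpoly_ring (V - {y}))"
    and lead: "\<And>p. p \<in> I \<Longrightarrow> p \<noteq> 0 \<Longrightarrow> lead_coeff_in y p \<in> B"
    and contr: "I \<inter> polys (V - {y}) = A" and MB: "\<And>b. b \<in> B \<Longrightarrow> M * b \<in> I"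
  shows "\<exists>C N. geometric_vertex_decomposition V y I C N \<and>
    C \<inter> polys (V - {y}) = B \<and> N \<inter> polys (V - {y}) = A"
proof -
  let ?S = "V - {y}" and ?lt = "var_first_order y" and ?a = "lookup M (single y 1)"
  note mo = monomial_order_var_first[of V y]
  have fS: "finite ?S" using V by simp
  have IV: "I \<subseteq> polys V" using ideal_subset[OF I] by blast
  obtain HA where HA: "finite HA" "HA \<subseteq> A - {0}" "A = idl ?S HA" using ideal_generators_nonzero[OF fS A] .
  obtain HB where HB: "finite HB" "HB \<subseteq> B - {0}" "B = idl ?S HB" using ideal_generators_nonzero[OF fS B] .
  have HAS: "HA \<subseteq> polys ?S" and HBS: "HB \<subseteq> polys ?S"
    using HA(2) HB(2) ideal_subset[OF A] ideal_subset[OF B] by blast+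
  have SV: "polys ?S \<subseteq> (polys V :: 'a mpoly set)" using polys_mono[of ?S V] by blast
  have HAV: "HA \<subseteq> polys V" and HBV: "HB \<subseteq> polys V" using HAS HBS SV by blast+
  obtain G0 where G0: "monic_basis V ?lt I G0" using monic_basis_exists[OF V mo I] .
  define G where "G = G0 \<union> (*) M ` HB \<union> HA"
  have M0: "M \<noteq> 0" using M(2) by auto
  have G0n: "0 \<notin> G0" using G0 by (fastforce simp: monic_basis_def is_lead_def)
  have G: "finite G" "G0 \<subseteq> G" "G \<subseteq> I - {0}"
    using G0 HA HB G0n M0 contr MB by (auto simp: G_def monic_basis_def)
  define C where "C = C_ideal V y G"
  define N where "N = N_ideal V y G"
  have leadM: "deg_in y (M * b) = 1" "lead_coeff_in y (M * b) = single 0 ?a * b"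
    if "b \<in> B" "b \<noteq> 0" for b
    using lead_coeff_linear_mult[OF M ideal_subset[OF B that(1)] that(2)] by auto
  have leadA: "deg_in y a = 0" "initial_form y a = a" "lead_coeff_in y a = a" if "a \<in> A" "a \<noteq> 0" for a
    using deg_in_0[OF ideal_subset[OF A that(1)] that(2)] by auto
  have Ceq: "C = idl V HB"
  proof -
    have lG: "lead_coeff_in y ` G \<subseteq> polys V" using lead_coeff_in_polys IV G(3) SV by blast
    have "lead_coeff_in y ` G \<subseteq> idl V HB"
      using lead G(3) HB(3) idl_extend_vars[of ?S V HB, OF _ HBS] by blast
    then have "C \<subseteq> idl V HB" unfolding C_def C_ideal_def by (rule idl_least[OF ideal_idl[OF HBV]])
    moreover have "b \<in> C" if b: "b \<in> HB" for b
    proof -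
      have "lead_coeff_in y (M * b) \<in> lead_coeff_in y ` G" using b by (auto simp: G_def)
      then have "lead_coeff_in y (M * b) \<in> idl V (lead_coeff_in y ` G)" by (rule idl_incl[OF lG])
      moreover have "b \<in> B" "b \<noteq> 0" using b HB(2) by auto
      ultimately have "single 0 ?a * b \<in> idl V (lead_coeff_in y ` G)" using leadM(2) by simp
      from ideal_mult[OF ideal_idl[OF lG] this, of "single 0 (inverse ?a)"]
      have "(single 0 (inverse ?a) * single 0 ?a) * b \<in> idl V (lead_coeff_in y ` G)" by (simp add: mult.assoc)
      then show ?thesis using M(2) by (simp add: mult_single C_def C_ideal_def)
    qed
    moreover have "ideal C (mpoly_ring V)" unfolding C_def C_ideal_def by (rule ideal_idl[OF lG])
    ultimately show ?thesis using idl_least[of C V HB] by blast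
  qed
  have Neq: "N = idl V HA"
  proof -
    let ?L = "lead_coeff_in y ` {g \<in> G. deg_in y g = 0}"
    have lG: "?L \<subseteq> polys V" using lead_coeff_in_polys IV G(3) SV by blast
    have "lead_coeff_in y g \<in> A" if g: "g \<in> G" "deg_in y g = 0" for g
    proof -
      have gI: "g \<in> I" "g \<noteq> 0" using g(1) G(3) by auto
      have "g \<in> polys ?S" unfolding polys_Diff_iff using gI(1) IV deg_in_ge[of _ g y] g(2) by auto
      then have "g \<in> A" using contr gI(1) by blast
      then show ?thesis using leadA(3) gI(2) by simp
    qed
    then have "?L \<subseteq> idl V HA" using HA(3) idl_extend_vars[of ?S V HA, OF _ HAS] by blast
    then have "N \<subseteq> idl V HA" unfolding N_def N_ideal_def by (rule idl_least[OF ideal_idl[OF HAV]])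
    moreover have "HA \<subseteq> ?L"
    proof
      fix a assume a: "a \<in> HA"
      then have "deg_in y a = 0" "lead_coeff_in y a = a" "a \<in> G" using leadA HA(2) by (auto simp: G_def)
      then show "a \<in> ?L" by (metis (mono_tags, lifting) imageI mem_Collect_eq)
    qed
    then have "idl V HA \<subseteq> N" unfolding N_def N_ideal_def by (rule idl_mono[OF _ lG])
    ultimately show ?thesis by blast
  qed
  have CB: "C \<inter> polys ?S = B" unfolding Ceq HB(3) by (rule idl_contraction[OF HB(1) HBS])
  have NA: "N \<inter> polys ?S = A" unfolding Neq HA(3) by (rule idl_contraction[OF HA(1) HAS])
  have iC: "ideal C (mpoly_ring V)" unfolding Ceq by (rule ideal_idl[OF HBV])
  have iN: "ideal N (mpoly_ring V)" unfolding Neq by (rule ideal_idl[OF HAV])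
  have Cc: "coeff_in y i p \<in> B" if "p \<in> C" for p i
    using coeff_in_idl[OF HB(1) HBS] that unfolding Ceq HB(3) by blast
  have Nc: "coeff_in y i p \<in> A" if "p \<in> N" for p i
    using coeff_in_idl[OF HA(1) HAS] that unfolding Neq HA(3) by blast
  have yV: "(Var y :: 'a mpoly) \<in> polys V" using y by simp
  let ?Y = "idl V {Var y :: 'a mpoly}"
  have iY: "ideal ?Y (mpoly_ring V)" by (rule ideal_idl) (use yV in simp)
  have iNY: "ideal (N <+>\<^bsub>mpoly_ring V\<^esub> ?Y) (mpoly_ring V)" by (rule ideal_set_add[OF iN iY])
  let ?J = "initial_form_ideal V y I"
  have inV: "initial_form y ` (I - {0}) \<subseteq> polys V" using initial_form_polys IV by blast
  have iJ: "ideal ?J (mpoly_ring V)" unfolding initial_form_ideal_def by (rule ideal_idl[OF inV])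
  have inJ: "initial_form y p \<in> ?J" if "p \<in> I" "p \<noteq> 0" for p
    unfolding initial_form_ideal_def by (rule idl_incl[OF inV]) (use that in blast)
  have "?J = C \<inter> (N <+>\<^bsub>mpoly_ring V\<^esub> ?Y)"
  proof (intro equalityI subsetI)
    have "ideal (\<Inter>{C, N <+>\<^bsub>mpoly_ring V\<^esub> ?Y}) (mpoly_ring V)"
      by (rule ideal_Inter_polys) (use iC iNY in auto)
    then have i: "ideal (C \<inter> (N <+>\<^bsub>mpoly_ring V\<^esub> ?Y)) (mpoly_ring V)" by simp
    have "initial_form y p \<in> C \<inter> (N <+>\<^bsub>mpoly_ring V\<^esub> ?Y)" if p: "p \<in> I" "p \<noteq> 0" for p
    proof
      have e: "initial_form y p = Var y ^ deg_in y p * lead_coeff_in y p"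
        by (simp add: initial_form_def mult.commute)
      have lC: "lead_coeff_in y p \<in> C" using lead[OF p] CB by blast
      show "initial_form y p \<in> C" unfolding e using ideal_mult[OF iC lC polys_power[OF yV]] .
      have lV: "lead_coeff_in y p \<in> polys V" using ideal_subset[OF iC lC] .
      show "initial_form y p \<in> N <+>\<^bsub>mpoly_ring V\<^esub> ?Y"
      proof (cases "deg_in y p")
        case 0
        have "p \<in> polys ?S" unfolding polys_Diff_iff using p(1) IV deg_in_ge[of _ p y] 0 by auto
        then have "p \<in> A" using contr p(1) by blast
        then have "initial_form y p \<in> N" using leadA(2) p(2) NA by auto
        then have "initial_form y p + 0 \<in> N <+>\<^bsub>mpoly_ring V\<^esub> ?Y"
          unfolding set_add_mpoly_ring using ideal_0[OF iY] by blast
        then show ?thesis by simp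
      next
        case (Suc k)
        have "initial_form y p = (Var y ^ k * lead_coeff_in y p) * Var y" unfolding e Suc by simp
        then have "initial_form y p \<in> ?Y"
          unfolding idl_singleton[OF yV] using polys_mult[OF polys_power[OF yV] lV] by blast
        then have "0 + initial_form y p \<in> N <+>\<^bsub>mpoly_ring V\<^esub> ?Y"
          unfolding set_add_mpoly_ring using ideal_0[OF iN] by blast
        then show ?thesis by simp
      qed
    qed
    then have "?J \<subseteq> C \<inter> (N <+>\<^bsub>mpoly_ring V\<^esub> ?Y)"
      unfolding initial_form_ideal_def by (intro idl_least[OF i]) blast
    then show "p \<in> ?J \<Longrightarrow> p \<in> C \<inter> (N <+>\<^bsub>mpoly_ring V\<^esub> ?Y)" for p by blast
  next
    fix p assume p: "p \<in> C \<inter> (N <+>\<^bsub>mpoly_ring V\<^esub> ?Y)"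
    then obtain n r where nr: "p = n + r * Var y" "n \<in> N" "r \<in> polys V"
      unfolding set_add_mpoly_ring idl_singleton[OF yV] by blast
    have pC: "p \<in> C" using p by blast
    have "coeff_in y i p * Var y ^ i \<in> ?J" for i
    proof (cases i)
      case 0
      have "coeff_in y 0 p = coeff_in y 0 n" by (simp add: nr(1) coeff_in_add coeff_in_mult_Var)
      then have cA: "coeff_in y 0 p \<in> A" using Nc[OF nr(2)] by simp
      show ?thesis
      proof (cases "coeff_in y 0 p = 0")
        case True
        then show ?thesis using 0 ideal_0[OF iJ] by simp
      next
        case False
        have "coeff_in y 0 p \<in> I" using cA contr by blast
        from inJ[OF this False] show ?thesis using leadA(2)[OF cA False] 0 by simp
      qed
    next
      case (Suc k)
      let ?b = "coeff_in y i p"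
      have bB: "?b \<in> B" by (rule Cc[OF pC])
      show ?thesis
      proof (cases "?b = 0")
        case True
        then show ?thesis using ideal_0[OF iJ] by simp
      next
        case False
        have "M * ?b \<in> I" "M * ?b \<noteq> 0" using MB[OF bB] M0 False by auto
        then have "initial_form y (M * ?b) \<in> ?J" by (rule inJ)
        then have "single 0 ?a * ?b * Var y \<in> ?J"
          using leadM[OF bB False] by (simp add: initial_form_def)
        from ideal_mult[OF iJ this, of "single 0 (inverse ?a) * Var y ^ k"]
        have "(single 0 (inverse ?a) * Var y ^ k) * (single 0 ?a * ?b * Var y) \<in> ?J"
          using polys_mult[OF const_polys polys_power[OF yV]] by blast
        moreover have "(single 0 (inverse ?a) * Var y ^ k) * (single 0 ?a * ?b * Var y)
            = (single 0 (inverse ?a) * single 0 ?a) * (?b * (Var y ^ k * Var y))" by (simp only: mult_ac)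
        moreover have "single 0 (inverse ?a) * single 0 ?a = (1 :: 'a mpoly)" using M(2) by (simp add: mult_single)
        ultimately have "1 * (?b * (Var y ^ k * Var y)) \<in> ?J" by (simp only:)
        then show ?thesis by (simp only: mult_1 Suc power_Suc2)
      qed
    qed
    then have "(\<Sum>i\<le>deg_in y p. coeff_in y i p * Var y ^ i) \<in> ?J" by (intro ideal_sum[OF iJ])
    then show "p \<in> ?J" using sum_coeff_in_Var_power[of p y] by simp
  qed
  moreover have "groebner_basis V ?lt I G" by (rule groebner_basis_superset[OF mo I G0 G])
  ultimately have "geometric_vertex_decomposition V y I C N"
    unfolding geometric_vertex_decomposition_def using compatible_var_first[of V y] C_def N_def by blast
  then show ?thesis using CB NA by blast
qed

text \<open>For star configurations the decomposition at a pivot removes its form, keeping c in one of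
  the two ideals and lowering it in the other.\<close>

theorem triangular_imp_gvd:
  fixes F :: "('a::field) mpoly set"
  assumes "triangular V F" "finite V"
  shows "gvd V (star V F c)"
  using assms
proof (induction arbitrary: c rule: triangular.induct)
  case (empty V)
  have tri: "triangular V ({} :: 'a mpoly set)" by (rule triangular.empty)
  have id: "ideal (star V ({} :: 'a mpoly set) c) (mpoly_ring V)" by (rule ideal_star) simp
  note um = unmixed_star[OF empty.prems tri, of c]
  show ?case
  proof (cases "c = 0")
    case True
    then have "star V ({} :: 'a mpoly set) c = idl V (Var ` {})" by (auto simp: star_def)
    then show ?thesis using gvd.variables[OF id um, of "{}"] by simp
  next
    case False
    then have "star V ({} :: 'a mpoly set) c = polys V" by (auto simp: star_def)
    then show ?thesis using gvd.unit[OF id um] by simp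
  qed
next
  case (insert y V F M)
  let ?S = "V - {y}" and ?F = "insert M F"
  have tri: "triangular V ?F" by (rule triangular.insert[OF insert.hyps])
  note tl = triangular_linear_forms[OF tri] and tlF = triangular_linear_forms[OF insert.hyps(2)]
  have FV: "?F \<subseteq> polys V" and FS: "F \<subseteq> polys ?S" using tl tlF linear_forms_subset_polys by blast+
  have fF: "finite F" using tlF by simp
  have MF: "M \<notin> F" by (rule triangular_step_notin[OF insert.hyps(2,4)])
  have fS: "finite ?S" using insert.prems by simp
  have SV: "polys ?S \<subseteq> (polys V :: 'a mpoly set)" using polys_mono[of ?S V] by blast
  have MV: "M \<in> polys V" using FV by simp
  have id: "ideal (star V ?F c) (mpoly_ring V)" by (rule ideal_star[OF FV])
  note um = unmixed_star[OF insert.prems tri, of c]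
  have IH: "gvd ?S (star ?S F c)" for c using insert.IH[OF fS] .
  show ?case
  proof (cases c)
    case 0
    then have "star V ?F c = idl V (Var ` {})"
      using finite_subset[of _ ?F] fF by (auto simp: star_def)
    then show ?thesis using gvd.variables[OF id um, of "{}"] by simp
  next
    case (Suc c')
    obtain \<sigma> where \<sigma>: "\<And>i. i \<in> V - {y} \<Longrightarrow> \<sigma> i = Var i"
      and key: "\<And>F p. finite F \<Longrightarrow> F \<subseteq> polys ?S \<Longrightarrow> p \<in> polys V \<Longrightarrow>
         subst_mpoly \<sigma> p \<in> idl ?S F \<longleftrightarrow> p \<in> idl V (insert M F)"
      using variable_elimination[OF insert.hyps(1,3,4)] by metis
    have sid: "subst_mpoly \<sigma> p = p" if "p \<in> polys ?S" for p
    proof -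
      have "subst_mpoly \<sigma> p = subst_mpoly Var p" by (rule subst_cong[OF that]) (rule \<sigma>)
      then show ?thesis by (simp add: subst_Var_id)
    qed
    have sub: "idl ?S J \<subseteq> idl V J" if "J \<subseteq> F" for J
      using that FS by (intro idl_extend_vars) auto
    have JV: "J \<subseteq> polys V" if "J \<subseteq> ?F" for J using that FV by blast
    have cases: "(J \<subseteq> F \<and> card J = Suc c') \<or> (\<exists>J'. J' \<subseteq> F \<and> card J' = c' \<and> J = insert M J')"
      if J: "J \<subseteq> ?F" "card J = Suc c'" for J
    proof (cases "M \<in> J")
      case True
      have "finite J" using J(2) by (simp add: card_ge_0_finite)
      then have "card (J - {M}) = c'" using True J(2) by simp
      moreover have "J = insert M (J - {M})" "J - {M} \<subseteq> F" using True J(1) by auto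
      ultimately show ?thesis by blast
    next
      case False
      then show ?thesis using J by blast
    qed
    have iA: "ideal (star ?S F c') (mpoly_ring ?S)" and iB: "ideal (star ?S F c) (mpoly_ring ?S)"
      using ideal_star[OF FS] by auto
    have "lead_coeff_in y p \<in> star ?S F c" if p: "p \<in> star V ?F c" for p
      unfolding star_def
    proof (intro CollectI conjI allI impI)
      have "p \<in> polys V" using p by (simp add: star_def)
      then show "lead_coeff_in y p \<in> polys ?S" by (rule lead_coeff_in_polys)
      fix J assume J: "J \<subseteq> F" "card J = c"
      then have "p \<in> idl V J" using p by (auto simp: star_def)
      then show "lead_coeff_in y p \<in> idl ?S J"
        unfolding lead_coeff_in_def using J(1) fF FS by (intro coeff_in_idl) (auto intro: finite_subset)
    qed
    moreover have "star V ?F c \<inter> polys ?S = star ?S F c'"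
    proof (intro equalityI subsetI)
      fix p assume p: "p \<in> star V ?F c \<inter> polys ?S"
      show "p \<in> star ?S F c'"
        unfolding star_def
      proof (intro CollectI conjI allI impI)
        show pS: "p \<in> polys ?S" using p by blast
        fix J assume J: "J \<subseteq> F" "card J = c'"
        have fJ: "finite J" using J(1) fF by (rule finite_subset)
        have "card (insert M J) = c" using J MF fJ Suc by (subst card_insert_disjoint) auto
        moreover have "insert M J \<subseteq> ?F" using J(1) by blast
        ultimately have "p \<in> idl V (insert M J)" using p by (auto simp: star_def)
        moreover have "J \<subseteq> polys ?S" using J(1) FS by blast
        ultimately have "subst_mpoly \<sigma> p \<in> idl ?S J" using key[OF fJ _ subsetD[OF SV pS]] by blast
        then show "p \<in> idl ?S J" using sid[OF pS] by simp
      qed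
    next
      fix p assume p: "p \<in> star ?S F c'"
      then have pS: "p \<in> polys ?S" by (simp add: star_def)
      have "p \<in> idl V J" if J: "J \<subseteq> ?F" "card J = c" for J
      proof -
        obtain J' where J': "J' \<subseteq> J" "J' \<subseteq> F" "card J' = c'"
        proof (cases "J \<subseteq> F")
          case True
          have "c' \<le> card J" using J(2) Suc by simp
          then obtain J' where "J' \<subseteq> J" "card J' = c'" by (rule obtain_subset_with_card_n)
          then show thesis using that True by blast
        next
          case False
          then show thesis using cases[OF J(1)] J(2) Suc that by blast
        qed
        then have "p \<in> idl ?S J'" using p by (simp add: star_def)
        then have "p \<in> idl V J'" using sub[OF J'(2)] by blast
        then show ?thesis using idl_mono[OF J'(1) JV[OF J(1)]] by blast
      qed
      then show "p \<in> star V ?F c \<inter> polys ?S" using pS SV by (auto simp: star_def)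
    qed
    moreover have "M * b \<in> star V ?F c" if b: "b \<in> star ?S F c" for b
      unfolding star_def
    proof (intro CollectI conjI allI impI)
      have bV: "b \<in> polys V" using b SV by (auto simp: star_def)
      then show "M * b \<in> polys V" using MV by blast
      fix J assume J: "J \<subseteq> ?F" "card J = c"
      note iJ = ideal_idl[OF JV[OF J(1)]]
      show "M * b \<in> idl V J"
      proof (cases "M \<in> J")
        case True
        then show ?thesis using ideal_mult[OF iJ idl_incl[OF JV[OF J(1)] True] bV] by (simp add: mult.commute)
      next
        case False
        then have JF: "J \<subseteq> F" using J(1) by blast
        then have "b \<in> idl ?S J" using b J(2) by (simp add: star_def)
        then have "b \<in> idl V J" using sub[OF JF] by blast
        then show ?thesis by (rule ideal_mult[OF iJ _ MV])
      qed
    qed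
    ultimately obtain C N where CN: "geometric_vertex_decomposition V y (star V ?F c) C N"
      "C \<inter> polys ?S = star ?S F c" "N \<inter> polys ?S = star ?S F c'"
      using geometric_vertex_decomposition_linear[OF insert.prems insert.hyps(1,3,4) id iA iB] by blast
    show ?thesis
      by (rule gvd.decomposition[OF id um insert.hyps(1) CN(1)]) (use CN(2,3) IH in auto)
  qed
qed

section \<open>The equivalence\<close>

lemma star_all_forms:
  fixes F :: "('a::comm_ring_1) mpoly set"
  assumes "finite F" "F \<subseteq> polys V"
  shows "star V F (card F) = idl V F"
proof (intro equalityI subsetI)
  fix p assume "p \<in> idl V F"
  moreover have "p \<in> polys V" if "p \<in> idl V F" using idl_subset_polys[OF assms(2)] that by blast
  moreover have "J = F" if "J \<subseteq> F" "card J = card F" for J using card_subset_eq[OF assms(1) that] .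
  ultimately show "p \<in> star V F (card F)" by (auto simp: star_def)
qed (simp add: star_def)

theorem theorem1p3:
  fixes n c l :: nat
    and L :: "nat \<Rightarrow> ('k::field) mpoly"
  assumes "infinite (UNIV :: 'k set)"
    and "1 \<le> c" and "c \<le> n" and "c \<le> l"
    and "L ` {1..l} \<subseteq> linear_forms {0..n}"
    and "inj_on L {1..l}"
    and "\<And>T. T \<subseteq> L ` {1..l} \<Longrightarrow> card T \<le> min l (n + 1) \<Longrightarrow> \<not> module.dependent scale_mpoly T"
  shows "gvd {0..n} (star_ideal {0..n} L l c) \<longleftrightarrow> knutson_ideal {0..n} (star_ideal {0..n} L l c)"
proof -
  define V where "V = {0..n}"
  define F where "F = L ` {1..l}"
  have V: "finite V" by (simp add: V_def)
  have F: "finite F" "F \<subseteq> linear_forms V" "card F = l"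
    using assms(5) card_image[OF assms(6)] by (auto simp: F_def V_def)
  have FV: "F \<subseteq> polys V" using linear_forms_subset_polys[OF F(2)] .
  have ind: "lin_indep J" if J: "J \<subseteq> F" "card J \<le> min l (n + 1)" for J
  proof -
    have "finite J" using finite_subset[OF J(1) F(1)] .
    then show ?thesis using assms(7)[of J] J unfolding F_def by (simp add: lin_indep_iff_independent)
  qed
  have star: "star_ideal {0..n} L l c = star V F c"
    using star_ideal_eq_star[OF assms(6,4)] FV unfolding F_def V_def by simp
  show ?thesis
  proof (cases "c = l")
    case True
    \<comment> \<open>A single linear space: both sides hold.\<close>
    have "lin_indep F" using ind[of F] F(3) True assms(3) by simp
    then obtain F' where F': "triangular V F'" "card F' = card F" "idl V F' = idl V F"
      using echelon_form[OF F(1,2)] by blast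
    have fF': "finite F'" "F' \<subseteq> polys V"
      using triangular_linear_forms[OF F'(1)] linear_forms_subset_polys by auto
    have "star V F c = star V F' c"
      using star_all_forms[OF F(1) FV] star_all_forms[OF fF'] F'(2,3) F(3) True by simp
    moreover have "gvd V (star V F' c)" by (rule triangular_imp_gvd[OF F'(1) V])
    moreover have "knutson_ideal V (star V F' c)"
      by (rule triangular_imp_knutson[OF F'(1) assms(2)]) (use F'(2) F(3) True in simp)
    ultimately show ?thesis unfolding star V_def by simp
  next
    case False
    then have cl: "c < l" using assms(4) by simp
    define d where "d = l - c + 1"
    have d: "2 \<le> d" "d \<le> card F" using cl assms(2) F(3) by (auto simp: d_def)
    have ps: "product_saturated (star V F c) F d"
      unfolding product_saturated_def
    proof (intro conjI ballI allI impI)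
      fix p m assume pm: "p \<in> star V F c" "m \<in> keys p"
      have "lin_indep J" if "J \<subseteq> F" "card J \<le> c + 1" for J
        using ind[OF that(1)] that(2) cl assms(3) by simp
      from star_min_degree[OF V F(1,2) _ this pm] have "l < mdeg m + c" using F(3) cl by simp
      then show "d \<le> mdeg m" using cl by (simp add: d_def)
    next
      fix D assume "D \<subseteq> F" "card D = d"
      then show "\<Prod>D \<in> star V F c"
        using cl F(3) by (intro prod_mem_star[OF F(1) FV]) (auto simp: d_def)
    qed
    have F0: "0 \<notin> F"
    proof
      assume "0 \<in> F"
      then have "lin_indep {0 :: 'k mpoly}" using ind[of "{0}"] assms(2,4) by simp
      then have "(1 :: 'k) = 0"
        unfolding lin_indep_def by (elim allE[of _ "\<lambda>_. 1"]) simp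
      then show False by simp
    qed
    have "gvd V (star V F c) \<longleftrightarrow> triangular V F"
      using gvd_imp_triangular[OF _ V F(1,2) F0 d ps] triangular_imp_gvd[OF _ V] by blast
    moreover have "knutson_ideal V (star V F c) \<longleftrightarrow> triangular V F"
      using knutson_imp_triangular[OF V F(1,2) F0 d ps] triangular_imp_knutson[OF _ assms(2)] F(3) assms(4)
      by blast
    ultimately show ?thesis unfolding star V_def by simp
  qed
qed

end
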